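(* Let $n\in\{2,3\}$, let $\Omega\subset\mathbb{R}^n$ be a bounded connected open set with Lipschitz boundary, and let $D$ be an open set with $\overline{D}\subset\Omega$ whose boundary $\partial D$ is Lipschitz if $n=2$ and $C^2$ if $n=3$. Let $\sigma_0\ge 0$ and $\epsilon_0>0$ be constants and let $\omega\in\mathbb{R}$ with $\sigma_0^2+\omega^2\epsilon_0^2>0$. Let $\sigma,\epsilon$ be $n\times n$ real symmetric matrix-valued functions on $\Omega$ with essentially bounded components, $\sigma$ non-negative and $\epsilon$ uniformly positive definite in $\Omega$, such that $\sigma(x)=\sigma_0 I_n$ and $\epsilon(x)=\epsilon_0 I_n$ for $x\in\Omega\setminus D$. Fix $\vartheta\in S^{n-1}$ and $\vartheta^{\perp}\in S^{n-1}$ with $\vartheta\cdot\vartheta^{\perp}=0$, and let $I_{\vartheta,\vartheta^\perp}(\tau,t)$ be the indicator function defined in the context. Assume that there exist positive constants $C_\vartheta$ and $\delta_\vartheta$ such that for all $\xi\in\mathbb{R}^n$ and almost all $x\in D_\vartheta(\delta_\vartheta)$ $$\frac{\sigma_0(\sigma(x)-\sigma_0 I_n)+\omega^2\epsilon_0(\epsilon(x)-\epsilon_0 I_n)}{\sigma_0^2+\omega^2\epsilon_0^2}\xi\cdot\xi\le -C_\vartheta|\xi|^2.$$ Let $M>0$ and $m>0$ satisfy $$\frac{\sigma_0\sigma(x)+\omega^2\epsilon_0\epsilon(x)}{\sigma_0^2+\omega^2\epsilon_0^2}\xi\cdot\xi\ge m|\xi|^2\ \text{ for a.e. } x\in D,\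 \forall\xi\in\mathbb{R}^n,$$ and $$\left\|\frac{\epsilon_0\sigma(x)-\sigma_0\epsilon(x)}{\sigma_0^2+\omega^2\epsilon_0^2}\right\|\le M\ \text{ for a.e. } x\in D,$$ where $\|K\|=\sup_{|\xi|\le1}|K\xi|$. Let $\omega$ satisfy $0\le\omega<\frac{\sqrt{mC_\vartheta}}{M}$. Then: if $t>h_D(\vartheta)$, $\lim_{\tau\to\infty}|I_{\vartheta,\vartheta^{\perp}}(\tau,t)|=0$; if $t<h_D(\vartheta)$, $\lim_{\tau\to\infty}|I_{\vartheta,\vartheta^{\perp}}(\tau,t)|=\infty$; if $t=h_D(\vartheta)$, $\liminf_{\tau\to\infty}|I_{\vartheta,\vartheta^{\perp}}(\tau,t)|>0$. Moreover, for all $t\in\mathbb{R}$, $$\lim_{\tau\to\infty}\frac{\log|I_{\vartheta,\vartheta^{\perp}}(\tau,t)|}{2\tau}=h_D(\vartheta)-t.$$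
   Context: Dirichlet-to-Neumann map: for $n\times n$ real symmetric matrix-valued functions $\gamma,\eta$ on $\Omega$ with essentially bounded entries such that for every $f\in H^{1/2}(\partial\Omega)$ the problem $\nabla\cdot(\gamma-i\omega\eta)\nabla u=0$ in $\Omega$, $u=f$ on $\partial\Omega$ has a unique weak solution $u\in H^1(\Omega)$, define $\Lambda_{\gamma,\eta}f$ as the bounded linear functional on $H^{1/2}(\partial\Omega)$ given by $\langle\Lambda_{\gamma,\eta}f,g\rangle=\int_\Omega(\gamma-i\omega\eta)\nabla u\cdot\nabla v\,dx$, where $v\in H^1(\Omega)$ is any function with $v=g$ on $\partial\Omega$ (the pairing is bilinear). Define $\tilde\sigma=\frac{\sigma_0\sigma+\omega^2\epsilon_0\epsilon}{\sigma_0^2+\omega^2\epsilon_0^2}$ and $\tilde\epsilon=\frac{\sigma_0\epsilon-\epsilon_0\sigma}{\sigma_0^2+\omega^2\epsilon_0^2}$; then $\tilde\sigma=I_n$, $\tilde\epsilon=O_n$ (zero matrix) on $\Omega\setminus D$, $\tilde\sigma$ is uniformly positive definite, $\Lambda_{\tilde\sigma,\tilde\epsilon}$ is well defined and $\Lambda_{\tilde\sigma,\tilde\epsilon}=(\sigma_0-i\omega\epsilon_0)^{-1}\Lambda_{\sigma,\epsilon}$. The indicator function is, for $\tau>0$, $t\in\mathbb{R}$, $$I_{\vartheta,\vartheta^\perp}(\tau,t)=e^{-2\tau t}\,\mathrm{Re}\,\langle(\Lambda_{\tilde\sigma,\tilde\epsilon}-\Lambda_{I_n,O_n})f_\tau,\overline{f_\tau}\rangle,\quad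 f_\tau=e^{\tau x\cdot(\vartheta+i\vartheta^\perp)}|_{\partial\Omega}.$$ The support function is $h_D(\vartheta)=\sup_{x\in D}x\cdot\vartheta$, and for $\delta>0$, $D_\vartheta(\delta)=\{x\in D: h_D(\vartheta)-\delta<x\cdot\vartheta\le h_D(\vartheta)\}$. *)

theory Defs
  imports "HOL-Analysis.Analysis"
begin

definition pd :: "'n::finite \<Rightarrow> (real^'n \<Rightarrow> 'b::real_normed_vector) \<Rightarrow> real^'n \<Rightarrow> 'b" where
  "pd i f = (\<lambda>x. frechet_derivative f (at x) (axis i 1))"

definition cgrad :: "(real^'n::finite \<Rightarrow> 'b::real_normed_vector) \<Rightarrow> real^'n \<Rightarrow> 'b^'n" where
  "cgrad f x = (\<chi> i. pd i f x)"

definition smooth_fn :: "(real^'n::finite \<Rightarrow> real) \<Rightarrow> bool" where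
  "smooth_fn f \<longleftrightarrow> (\<forall>is :: 'n list. \<forall>x. (fold pd is f) differentiable (at x))"

definition test_fun :: "(real^'n::finite) set \<Rightarrow> (real^'n \<Rightarrow> real) \<Rightarrow> bool" where
  "test_fun U \<phi> \<longleftrightarrow> smooth_fn \<phi> \<and>
     (\<exists>K. compact K \<and> K \<subseteq> U \<and> (\<forall>x. x \<notin> K \<longrightarrow> \<phi> x = 0))"

definition L2 :: "(real^'n::finite) set \<Rightarrow> (real^'n \<Rightarrow> complex) \<Rightarrow> bool" where
  "L2 U u \<longleftrightarrow> u \<in> borel_measurable (lebesgue_on U) \<and>
     integrable (lebesgue_on U) (\<lambda>x. (norm (u x))\<^sup>2)"

definition H1 :: "(real^'n::finite) set \<Rightarrow> (real^'n \<Rightarrow> complex) \<Rightarrow> (real^'n \<Rightarrow> complex^'n) \<Rightarrow> bool" where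
  "H1 U u Du \<longleftrightarrow> L2 U u \<and> (\<forall>i. L2 U (\<lambda>x. Du x $ i)) \<and>
     (\<forall>\<phi> i. test_fun U \<phi> \<longrightarrow>
        (\<integral>x. u x * complex_of_real (pd i \<phi> x) \<partial>lebesgue_on U)
          = - (\<integral>x. Du x $ i * complex_of_real (\<phi> x) \<partial>lebesgue_on U))"

definition H10 :: "(real^'n::finite) set \<Rightarrow> (real^'n \<Rightarrow> complex) \<Rightarrow> bool" where
  "H10 U w \<longleftrightarrow> (\<exists>Dw a b. H1 U w Dw \<and> (\<forall>k. test_fun U (a k) \<and> test_fun U (b k)) \<and>
     ((\<lambda>k. (\<integral>x. (norm (w x - (complex_of_real (a k x) + \<i> * complex_of_real (b k x))))\<^sup>2
                 + (\<Sum>i\<in>UNIV. (norm (Dw x $ i - (complex_of_real (pd i (a k) x)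
                                  + \<i> * complex_of_real (pd i (b k) x))))\<^sup>2) \<partial>lebesgue_on U))
       \<longlonglongrightarrow> 0))"

definition weak_sol :: "(real^'n::finite) set \<Rightarrow> (real^'n \<Rightarrow> complex^'n^'n) \<Rightarrow> (real^'n \<Rightarrow> complex)
     \<Rightarrow> (real^'n \<Rightarrow> complex) \<Rightarrow> (real^'n \<Rightarrow> complex^'n) \<Rightarrow> bool" where
  "weak_sol U A F u Du \<longleftrightarrow> H1 U u Du \<and> H10 U (\<lambda>x. u x - F x) \<and>
     (\<forall>\<phi>. test_fun U \<phi> \<longrightarrow>
        (\<integral>x. (\<Sum>i\<in>UNIV. (\<Sum>j\<in>UNIV. A x $ i $ j * Du x $ j) * complex_of_real (pd i \<phi> x))
           \<partial>lebesgue_on U) = 0)"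

text \<open>Bilinear Dirichlet-to-Neumann pairing <Lambda f, g> with f the boundary value of F and
  g the boundary value of the smooth function v.\<close>
definition dn_pair :: "(real^'n::finite) set \<Rightarrow> (real^'n \<Rightarrow> complex^'n^'n) \<Rightarrow> (real^'n \<Rightarrow> complex)
     \<Rightarrow> (real^'n \<Rightarrow> complex) \<Rightarrow> complex" where
  "dn_pair U A F v = (THE c. \<exists>u Du. weak_sol U A F u Du \<and>
      c = (\<integral>x. (\<Sum>i\<in>UNIV. (\<Sum>j\<in>UNIV. A x $ i $ j * Du x $ j) * cgrad v x $ i) \<partial>lebesgue_on U))"

definition coef :: "(real^'n::finite \<Rightarrow> real^'n^'n) \<Rightarrow> (real^'n \<Rightarrow> real^'n^'n) \<Rightarrow> real
     \<Rightarrow> real^'n \<Rightarrow> complex^'n^'n" where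
  "coef \<gamma> \<eta> \<omega> x = (\<chi> i j. complex_of_real (\<gamma> x $ i $ j) - \<i> * complex_of_real \<omega> * complex_of_real (\<eta> x $ i $ j))"

definition sig_t :: "(real^'n::finite \<Rightarrow> real^'n^'n) \<Rightarrow> (real^'n \<Rightarrow> real^'n^'n) \<Rightarrow> real \<Rightarrow> real \<Rightarrow> real
     \<Rightarrow> real^'n \<Rightarrow> real^'n^'n" where
  "sig_t \<sigma> \<epsilon> \<sigma>0 \<epsilon>0 \<omega> x =
     inverse (\<sigma>0\<^sup>2 + \<omega>\<^sup>2 * \<epsilon>0\<^sup>2) *\<^sub>R (\<sigma>0 *\<^sub>R \<sigma> x + (\<omega>\<^sup>2 * \<epsilon>0) *\<^sub>R \<epsilon> x)"

definition eps_t :: "(real^'n::finite \<Rightarrow> real^'n^'n) \<Rightarrow> (real^'n \<Rightarrow> real^'n^'n) \<Rightarrow> real \<Rightarrow> real \<Rightarrow> real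
     \<Rightarrow> real^'n \<Rightarrow> real^'n^'n" where
  "eps_t \<sigma> \<epsilon> \<sigma>0 \<epsilon>0 \<omega> x =
     inverse (\<sigma>0\<^sup>2 + \<omega>\<^sup>2 * \<epsilon>0\<^sup>2) *\<^sub>R (\<sigma>0 *\<^sub>R \<epsilon> x - \<epsilon>0 *\<^sub>R \<sigma> x)"

definition cgo :: "real^'n::finite \<Rightarrow> real^'n \<Rightarrow> real \<Rightarrow> real^'n \<Rightarrow> complex" where
  "cgo \<theta> \<theta>p \<tau> x = exp (complex_of_real \<tau> * (complex_of_real (x \<bullet> \<theta>) + \<i> * complex_of_real (x \<bullet> \<theta>p)))"

definition indicator_fn :: "(real^'n::finite) set \<Rightarrow> (real^'n \<Rightarrow> real^'n^'n) \<Rightarrow> (real^'n \<Rightarrow> real^'n^'n)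
     \<Rightarrow> real \<Rightarrow> real \<Rightarrow> real \<Rightarrow> real^'n \<Rightarrow> real^'n \<Rightarrow> real \<Rightarrow> real \<Rightarrow> real" where
  "indicator_fn \<Omega> \<sigma> \<epsilon> \<sigma>0 \<epsilon>0 \<omega> \<theta> \<theta>p \<tau> t =
     exp (- 2 * \<tau> * t) *
     Re (dn_pair \<Omega> (coef (sig_t \<sigma> \<epsilon> \<sigma>0 \<epsilon>0 \<omega>) (eps_t \<sigma> \<epsilon> \<sigma>0 \<epsilon>0 \<omega>) \<omega>) (cgo \<theta> \<theta>p \<tau>)
           (\<lambda>x. cnj (cgo \<theta> \<theta>p \<tau> x))
       - dn_pair \<Omega> (coef (\<lambda>x. mat 1) (\<lambda>x. 0) \<omega>) (cgo \<theta> \<theta>p \<tau>) (\<lambda>x. cnj (cgo \<theta> \<theta>p \<tau> x)))"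

definition support_fn :: "(real^'n::finite) set \<Rightarrow> real^'n \<Rightarrow> real" where
  "support_fn D \<theta> = (SUP x\<in>D. x \<bullet> \<theta>)"

definition D_strip :: "(real^'n::finite) set \<Rightarrow> real^'n \<Rightarrow> real \<Rightarrow> (real^'n) set" where
  "D_strip D \<theta> \<delta> = {x \<in> D. support_fn D \<theta> - \<delta> < x \<bullet> \<theta> \<and> x \<bullet> \<theta> \<le> support_fn D \<theta>}"

text \<open>Boundary locally the graph of a function h over the hyperplane orthogonal to a unit vector e
  (h is constant along e), the set lying below the graph.\<close>
definition lipschitz_boundary :: "(real^'n::finite) set \<Rightarrow> bool" where
  "lipschitz_boundary U \<longleftrightarrow> (\<forall>p\<in>frontier U. \<exists>r>0. \<exists>e h L. norm e = 1 \<and>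
     (\<forall>x s. h (x + s *\<^sub>R e) = h x) \<and> (\<forall>x y. \<bar>h x - h y\<bar> \<le> L * norm (x - y)) \<and>
     U \<inter> ball p r = {x \<in> ball p r. x \<bullet> e < h x})"

definition C2_fn :: "(real^'n::finite \<Rightarrow> real) \<Rightarrow> bool" where
  "C2_fn h \<longleftrightarrow> (\<exists>g H. (\<forall>x. (h has_derivative (\<lambda>v. g x \<bullet> v)) (at x)) \<and>
      (\<forall>x. (g has_derivative (\<lambda>v. H x *v v)) (at x)) \<and> continuous_on UNIV H)"

definition C2_boundary :: "(real^'n::finite) set \<Rightarrow> bool" where
  "C2_boundary U \<longleftrightarrow> (\<forall>p\<in>frontier U. \<exists>r>0. \<exists>e h. norm e = 1 \<and>
     (\<forall>x s. h (x + s *\<^sub>R e) = h x) \<and> C2_fn h \<and>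
     U \<inter> ball p r = {x \<in> ball p r. x \<bullet> e < h x})"

definition ess_bounded_mat :: "(real^'n::finite) set \<Rightarrow> (real^'n \<Rightarrow> real^'n^'n) \<Rightarrow> bool" where
  "ess_bounded_mat U A \<longleftrightarrow> (\<forall>i j. (\<lambda>x. A x $ i $ j) \<in> borel_measurable (lebesgue_on U) \<and>
      (\<exists>B. AE x in lebesgue_on U. \<bar>A x $ i $ j\<bar> \<le> B))"

end

theory Submission
  imports Defs
begin

text \<open>
  Write \<open>A = G - i \<omega> E\<close> for the normalised coefficient, \<open>v\<close> for the harmonic exponential, \<open>u = v + w\<close> for
  the solution with the same boundary values, and \<open>p\<close>, \<open>q\<close> for the gradients of \<open>v\<close> and \<open>w\<close>.  Testing the
  equation for \<open>u\<close> with \<open>w\<close> and using that \<open>G\<close> is symmetric while \<open>i E\<close> is antisymmetric for the real form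
  \<open>Re (z \<cdot> cnj y)\<close>, the real part of the difference of the two pairings equals the integral of
  \<open>G p \<cdot> p - |p|\<^sup>2 - G q \<cdot> q + 2 \<omega> k(p, q)\<close>, where \<open>|k(p, q)| \<le> M |p| |q|\<close> vanishes off \<open>D\<close>.  The
  cross term is absorbed by \<open>G q \<cdot> q \<ge> m |q|\<^sup>2\<close> at the price of \<open>(\<omega>\<^sup>2 M\<^sup>2 / m) |p|\<^sup>2\<close>, which
  the jump condition on the strip beats because \<open>\<omega>\<^sup>2 M\<^sup>2 < m C\<close>.  Hence the gap is at most
  \<open>- c\<close> times the energy of \<open>v\<close> in the strip, up to an exponentially smaller term, and coercivity bounds it below by
  \<open>- C'\<close> times the energy of \<open>v\<close> in \<open>D\<close>.  Since \<open>|p|\<^sup>2 = 2 \<tau>\<^sup>2 exp (2 \<tau> x \<cdot> \<theta>)\<close>, it only remains to find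
  near a highest boundary point a subset of \<open>D\<close> of volume of order \<open>\<tau>\<^sup>-\<^sup>2\<close> at depth of order \<open>1 / \<tau>\<close>: a
  ball in a cone for a planar Lipschitz boundary, a flat slab inside a tangent paraboloid for a \<open>C\<^sup>2\<close>
  boundary in space.
\<close>

section \<open>Approximate Lax-Milgram theorem and square-integrable functions\<close>

text \<open>\<open>dn_pair\<close> is a definite description over weak solutions, so the energy
  identity says nothing before a solution exists and its gradient is unique almost everywhere.
  Existence is obtained on pairs of test functions with the Dirichlet form, an incomplete space:
  approximate solutions are produced there, and only their L2 limits are taken. Since the indicator
  sees only a real part, complex vectors carry the real inner product throughout. The volume order
  \<open>\<tau>\<^sup>-\<^sup>2\<close> is what the borderline case t = h demands: it cancels the
  factor \<open>\<tau>\<^sup>2\<close> of the energy density and leaves a lower bound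
  \<open>c * exp (2 * \<tau> * h)\<close> free of powers of \<tau>. A ball in a cone has volume of
  order \<open>\<tau>\<^sup>-\<^sup>n\<close>, which is right in the plane but loses a factor \<tau>
  in space; there the slab has thickness 1 / \<tau> and radius of order 1 / sqrt \<tau>. The upper
  bound may keep \<open>\<tau>\<^sup>2\<close>, because exponential decay and division of the
  logarithm by \<tau> both absorb it.\<close>

lemma discriminant_le:
  fixes a b c :: real
  assumes nn: "\<And>t. 0 \<le> a + 2 * t * b + t\<^sup>2 * c" and "0 \<le> a" "0 \<le> c"
  shows "\<bar>b\<bar> \<le> sqrt a * sqrt c"
proof -
  have "b\<^sup>2 \<le> a * c"
  proof (cases "c = 0")
    case True
    have "b = 0"
    proof (rule ccontr)
      assume "b \<noteq> 0"
      \<comment> \<open>For \<open>c = 0\<close> the expression is affine in t, and this t gives it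
        the value -1.\<close>
      then show False using nn[of "- (a + 1) / (2 * b)"] True by (simp add: field_simps)
    qed
    then show ?thesis using True by simp
  next
    case False
    then have "c > 0" using assms by simp
    then show ?thesis using nn[of "- b / c"]
      by (simp add: field_simps power2_eq_square)
  qed
  then show ?thesis
    by (metis real_sqrt_abs real_sqrt_le_mono real_sqrt_mult)
qed

text \<open>The intended vectors are pairs of test functions, a subset of a function type; hence the
  explicit carrier, and \<open>comb x t y\<close> standing for x + t y as the sole vector operation.
  The form is only semidefinite and completeness is not assumed.\<close>

locale semi_inner_space =
  fixes V :: "'v set" and comb :: "'v \<Rightarrow> real \<Rightarrow> 'v \<Rightarrow> 'v" and ip :: "'v \<Rightarrow> 'v \<Rightarrow> real"
  assumes nonempty: "V \<noteq> {}"
    and comb_closed: "x \<in> V \<Longrightarrow> y \<in> V \<Longrightarrow> comb x t y \<in> V"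
    and ip_comm: "x \<in> V \<Longrightarrow> y \<in> V \<Longrightarrow> ip x y = ip y x"
    and ip_nonneg: "x \<in> V \<Longrightarrow> 0 \<le> ip x x"
    and ip_comb: "x \<in> V \<Longrightarrow> y \<in> V \<Longrightarrow> z \<in> V \<Longrightarrow> ip (comb x t y) z = ip x z + t * ip y z"
begin

definition seminorm :: "'v \<Rightarrow> real" where "seminorm x = sqrt (ip x x)"

lemma seminorm_nonneg: "x \<in> V \<Longrightarrow> 0 \<le> seminorm x"
  by (simp add: seminorm_def ip_nonneg)

lemma seminorm_square: "x \<in> V \<Longrightarrow> seminorm x * seminorm x = ip x x"
  by (simp add: seminorm_def ip_nonneg)

lemma ip_comb_self:
  assumes "x \<in> V" "y \<in> V"
  shows "ip (comb x t y) (comb x t y) = ip x x + 2 * t * ip x y + t\<^sup>2 * ip y y"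
proof -
  have "ip (comb x t y) (comb x t y) = ip x (comb x t y) + t * ip y (comb x t y)"
    using assms comb_closed ip_comb by simp
  also have "ip x (comb x t y) = ip x x + t * ip y x"
    using assms comb_closed ip_comb ip_comm by metis
  also have "ip y (comb x t y) = ip x y + t * ip y y"
    using assms comb_closed ip_comb ip_comm by metis
  finally show ?thesis using ip_comm[OF assms]
    by (simp add: algebra_simps power2_eq_square)
qed

text \<open>An exact representative of \<open>l\<close> would minimise \<open>J\<close>. A point
  whose value is within \<open>e\<^sup>2 / 2\<close> of the infimum exists without completeness, and
  along every line through it the quadratic \<open>J\<close> stays above the infimum; the
  discriminant of this quadratic bounds the error by \<open>e * seminorm y\<close>.\<close>

lemma approximate_riesz:
  assumes l: "\<And>x y t. x \<in> V \<Longrightarrow> y \<in> V \<Longrightarrow> l (comb x t y) = l x + t * l y"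
    and B: "\<And>x. x \<in> V \<Longrightarrow> \<bar>l x\<bar> \<le> B * seminorm x" and "e > 0"
  obtains x where "x \<in> V" "\<And>y. y \<in> V \<Longrightarrow> \<bar>ip x y - l y\<bar> \<le> e * seminorm y"
proof -
  define J where "J x = ip x x / 2 - l x" for x
  have bound: "- (B\<^sup>2 / 2) \<le> J x" if "x \<in> V" for x
  proof -
    have "l x \<le> B * seminorm x" using B[OF that] by simp
    also have "\<dots> \<le> (B\<^sup>2 + seminorm x * seminorm x) / 2"
      using sum_squares_bound[of B "seminorm x"] by (simp add: power2_eq_square)
    finally show ?thesis using seminorm_square[OF that] by (simp add: J_def field_simps)
  qed
  have bdd: "bdd_below (J ` V)" using bound by (auto simp: bdd_below_def)
  have "\<exists>z\<in>J ` V. z < Inf (J ` V) + e\<^sup>2 / 2"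
    using cInf_lessD[of "J ` V" "Inf (J ` V) + e\<^sup>2 / 2"] nonempty \<open>e > 0\<close> by auto
  then obtain x where x: "x \<in> V" "J x < Inf (J ` V) + e\<^sup>2 / 2" by blast
  show thesis
  proof (rule that[OF x(1)])
    fix y assume y: "y \<in> V"
    have "0 \<le> e\<^sup>2 / 2 + 2 * t * ((ip x y - l y) / 2) + t\<^sup>2 * (ip y y / 2)" for t
    proof -
      have "Inf (J ` V) \<le> J (comb x t y)"
        by (rule cInf_lower[OF _ bdd]) (simp add: comb_closed x(1) y)
      then have "J x - e\<^sup>2 / 2 \<le> J (comb x t y)" using x(2) by simp
      then show ?thesis unfolding J_def l[OF x(1) y] ip_comb_self[OF x(1) y]
        by (simp add: field_simps)
    qed
    then have "\<bar>(ip x y - l y) / 2\<bar> \<le> sqrt (e\<^sup>2 / 2) * sqrt (ip y y / 2)"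
      by (rule discriminant_le) (use ip_nonneg[OF y] in auto)
    also have "\<dots> = e * seminorm y / 2"
      using \<open>e > 0\<close> by (simp add: real_sqrt_divide seminorm_def)
    finally show "\<bar>ip x y - l y\<bar> \<le> e * seminorm y" by simp
  qed
qed

text \<open>Because \<open>a\<close> differs from the inner product by a factor
  \<open>q < 1\<close>, one correction step contracts the residual. Instead of following an
  iteration, the set \<open>R\<close> of all achievable residual bounds is considered: containing
  \<open>q * r + 2 * \<eta>\<close> along with \<open>r\<close>, for every \<eta> > 0, forces
  \<open>Inf R \<le> q * Inf R\<close>, so the infimum is not positive.\<close>

lemma approximate_lax_milgram:
  assumes a: "\<And>x y z t. x \<in> V \<Longrightarrow> y \<in> V \<Longrightarrow> z \<in> V \<Longrightarrow> a (comb x t y) z = a x z + t * a y z"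
    and a': "\<And>x y z t. x \<in> V \<Longrightarrow> y \<in> V \<Longrightarrow> z \<in> V \<Longrightarrow> a z (comb x t y) = a z x + t * a z y"
    and q: "\<And>x y. x \<in> V \<Longrightarrow> y \<in> V \<Longrightarrow> \<bar>ip x y - a x y\<bar> \<le> q * seminorm x * seminorm y" "0 \<le> q" "q < 1"
    and l: "\<And>x y t. x \<in> V \<Longrightarrow> y \<in> V \<Longrightarrow> l (comb x t y) = l x + t * l y"
    and B: "\<And>x. x \<in> V \<Longrightarrow> \<bar>l x\<bar> \<le> B * seminorm x" and "e > 0"
  obtains x where "x \<in> V" "\<And>y. y \<in> V \<Longrightarrow> \<bar>a x y - l y\<bar> \<le> e * seminorm y"
proof -
  define R where "R = {r. 0 \<le> r \<and> (\<exists>x\<in>V. \<forall>y\<in>V. \<bar>a x y - l y\<bar> \<le> r * seminorm y)}"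
  \<comment> \<open>Subtracting an approximate Riesz representative of the residual shrinks it by the factor q.\<close>
  have step: "q * r + 2 * \<eta> \<in> R" if "r \<in> R" "\<eta> > 0" for r \<eta>
  proof -
    obtain x where x: "x \<in> V" "\<And>y. y \<in> V \<Longrightarrow> \<bar>a x y - l y\<bar> \<le> r * seminorm y" and "0 \<le> r"
      using \<open>r \<in> R\<close> unfolding R_def by blast
    obtain w where w: "w \<in> V" "\<And>y. y \<in> V \<Longrightarrow> \<bar>ip w y - (a x y - l y)\<bar> \<le> \<eta> * seminorm y"
      by (rule approximate_riesz[of "\<lambda>y. a x y - l y" r \<eta>])
        (use x a' l \<open>\<eta> > 0\<close> in \<open>auto simp: algebra_simps\<close>)
    \<comment> \<open>Testing with \<open>y = w\<close> bounds the representative itself by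
      \<open>r + \<eta>\<close>.\<close>
    have "seminorm w * seminorm w \<le> (r + \<eta>) * seminorm w"
      using w(2)[OF w(1)] x(2)[OF w(1)] seminorm_square[OF w(1)]
      by (simp add: algebra_simps)
    then have "seminorm w \<le> r + \<eta>"
      using seminorm_nonneg[OF w(1)] \<open>0 \<le> r\<close> \<open>\<eta> > 0\<close>
      by (metis add_nonneg_nonneg less_eq_real_def mult_right_le_imp_le)
    then have qw: "q * seminorm w \<le> q * r + \<eta>"
      using q(2,3) \<open>\<eta> > 0\<close> mult_left_mono[of "seminorm w" "r + \<eta>" q] mult_right_mono[of q 1 \<eta>]
      unfolding distrib_left by linarith
    have "\<bar>a (comb x (-1) w) y - l y\<bar> \<le> (q * r + 2 * \<eta>) * seminorm y" if y: "y \<in> V" for y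
    proof -
      have "\<bar>a (comb x (-1) w) y - l y\<bar> \<le> \<eta> * seminorm y + q * seminorm w * seminorm y"
        using w(2)[OF y] q(1)[OF w(1) y] a[OF x(1) w(1) y, of "-1"] by linarith
      also have "\<dots> \<le> (q * r + 2 * \<eta>) * seminorm y"
        using mult_right_mono[OF qw seminorm_nonneg[OF y]] by (simp add: algebra_simps)
      finally show ?thesis .
    qed
    then show ?thesis unfolding R_def
      using comb_closed[OF x(1) w(1)] q(2) \<open>0 \<le> r\<close> \<open>\<eta> > 0\<close> by fastforce
  qed
  have ne: "R \<noteq> {}"
  proof -
    obtain z where z: "z \<in> V" using nonempty by blast
    have "\<bar>a z y - l y\<bar> \<le> (seminorm z + q * seminorm z + \<bar>B\<bar>) * seminorm y" if y: "y \<in> V" for y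
    proof -
      have "\<bar>ip z y\<bar> \<le> seminorm z * seminorm y"
        unfolding seminorm_def
        by (rule discriminant_le) (use ip_nonneg comb_closed z y ip_comb_self[OF z y] in metis)+
      moreover have "B * seminorm y \<le> \<bar>B\<bar> * seminorm y"
        by (intro mult_right_mono seminorm_nonneg y) auto
      ultimately show ?thesis using q(1)[OF z y] B[OF y] by (simp add: algebra_simps)
    qed
    then have "seminorm z + q * seminorm z + \<bar>B\<bar> \<in> R"
      unfolding R_def using z q(2) seminorm_nonneg by auto
    then show ?thesis by blast
  qed
  have bdd: "bdd_below R" by (auto simp: bdd_below_def R_def)
  have "Inf R \<le> q * Inf R"
  proof (rule field_le_epsilon)
    fix \<epsilon> :: real assume "\<epsilon> > 0"
    obtain r where r: "r \<in> R" "r < Inf R + \<epsilon> / 2"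
      using cInf_lessD[OF ne, of "Inf R + \<epsilon> / 2"] \<open>\<epsilon> > 0\<close> by auto
    have "Inf R \<le> q * r + 2 * (\<epsilon> / 4)"
      by (rule cInf_lower[OF step bdd]) (use r \<open>\<epsilon> > 0\<close> in auto)
    also have "\<dots> \<le> q * (Inf R + \<epsilon> / 2) + \<epsilon> / 2"
      using r q(2) by (simp add: mult_left_mono)
    also have "\<dots> \<le> q * Inf R + \<epsilon>"
      using q(3) \<open>\<epsilon> > 0\<close> mult_right_mono[of q 1 "\<epsilon> / 2"] unfolding distrib_left by linarith
    finally show "Inf R \<le> q * Inf R + \<epsilon>" .
  qed
  then have "(1 - q) * Inf R \<le> 0" by (simp add: algebra_simps)
  then have "Inf R \<le> 0" using q(3) by (simp add: mult_le_0_iff)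
  then obtain r where r: "r \<in> R" "r < e"
    using cInf_lessD[OF ne, of e] \<open>e > 0\<close> by auto
  then obtain x where x: "x \<in> V" "\<And>y. y \<in> V \<Longrightarrow> \<bar>a x y - l y\<bar> \<le> r * seminorm y"
    unfolding R_def by blast
  show thesis
  proof (rule that[OF x(1)])
    fix y assume y: "y \<in> V"
    show "\<bar>a x y - l y\<bar> \<le> e * seminorm y"
      using x(2)[OF y] mult_right_mono[OF less_imp_le[OF r(2)] seminorm_nonneg[OF y]] by linarith
  qed
qed

end

section \<open>Square-integrable Euclidean-valued functions: Cauchy-Schwarz and completeness\<close>

definition square_integrable :: "'a measure \<Rightarrow> ('a \<Rightarrow> 'b::euclidean_space) \<Rightarrow> bool" where
  "square_integrable M f \<longleftrightarrow> f \<in> borel_measurable M \<and> integrable M (\<lambda>x. (norm (f x))\<^sup>2)"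

definition l2norm :: "'a measure \<Rightarrow> ('a \<Rightarrow> 'b::euclidean_space) \<Rightarrow> real" where
  "l2norm M f = sqrt (\<integral>x. (norm (f x))\<^sup>2 \<partial>M)"

lemma l2norm_nonneg: "0 \<le> l2norm M f"
  by (simp add: l2norm_def)

lemma l2norm_square: "(l2norm M f)\<^sup>2 = (\<integral>x. (norm (f x))\<^sup>2 \<partial>M)"
  by (simp add: l2norm_def)

lemma square_integrable_inner:
  assumes "square_integrable M f" "square_integrable M g"
  shows "integrable M (\<lambda>x. f x \<bullet> g x)"
proof (rule Bochner_Integration.integrable_bound)
  show "integrable M (\<lambda>x. (norm (f x))\<^sup>2 + (norm (g x))\<^sup>2)"
    using assms by (simp add: square_integrable_def)
  show "(\<lambda>x. f x \<bullet> g x) \<in> borel_measurable M"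
    using assms borel_measurable_inner[of f M g] by (simp add: square_integrable_def)
  have "norm (f x \<bullet> g x) \<le> norm ((norm (f x))\<^sup>2 + (norm (g x))\<^sup>2)" for x
  proof -
    have "norm (f x \<bullet> g x) \<le> norm (f x) * norm (g x)"
      by (simp add: Cauchy_Schwarz_ineq2)
    also have "\<dots> \<le> (norm (f x))\<^sup>2 + (norm (g x))\<^sup>2"
      using sum_squares_bound[of "norm (f x)" "norm (g x)"]
        mult_nonneg_nonneg[OF norm_ge_zero[of "f x"] norm_ge_zero[of "g x"]] by linarith
    finally show ?thesis by simp
  qed
  then show "AE x in M. norm (f x \<bullet> g x) \<le> norm ((norm (f x))\<^sup>2 + (norm (g x))\<^sup>2)" by simp
qed

lemma norm_combination_square:
  fixes a b :: "'b::real_inner"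
  shows "(norm (a + t *\<^sub>R b))\<^sup>2 = (norm a)\<^sup>2 + 2 * t * (a \<bullet> b) + t\<^sup>2 * (norm b)\<^sup>2"
  unfolding power2_norm_eq_inner
  by (simp add: inner_add_left inner_add_right inner_commute[of b a] power2_eq_square[of t] distrib_left)

lemma square_integrable_combination:
  assumes "square_integrable M f" "square_integrable M g"
  shows "square_integrable M (\<lambda>x. f x + t *\<^sub>R g x)"
proof -
  show ?thesis
    using assms square_integrable_inner[OF assms] by (auto simp: square_integrable_def norm_combination_square)
qed

lemma square_integrable_add:
  "square_integrable M f \<Longrightarrow> square_integrable M g \<Longrightarrow> square_integrable M (\<lambda>x. f x + g x)"
  using square_integrable_combination[of M f g 1] by simp

lemma square_integrable_diff:
  "square_integrable M f \<Longrightarrow> square_integrable M g \<Longrightarrow> square_integrable M (\<lambda>x. f x - g x)"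
  using square_integrable_combination[of M f g "-1"] by simp

lemma square_integrable_bounded_image:
  assumes f: "square_integrable M f" and g: "g \<in> borel_measurable M"
    and b: "AE x in M. norm (g x) \<le> K * norm (f x)"
  shows "square_integrable M g"
  unfolding square_integrable_def
proof (intro conjI g)
  show "integrable M (\<lambda>x. (norm (g x))\<^sup>2)"
  proof (rule Bochner_Integration.integrable_bound)
    show "integrable M (\<lambda>x. K\<^sup>2 * (norm (f x))\<^sup>2)" using f by (simp add: square_integrable_def)
    show "(\<lambda>x. (norm (g x))\<^sup>2) \<in> borel_measurable M" using g by simp
    show "AE x in M. norm ((norm (g x))\<^sup>2) \<le> norm (K\<^sup>2 * (norm (f x))\<^sup>2)"
      using b by eventually_elim (simp add: power_mono flip: power_mult_distrib)
  qed
qed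

lemma borel_measurable_vec_iff:
  fixes f :: "'a \<Rightarrow> 'b::euclidean_space^'n"
  shows "f \<in> borel_measurable M \<longleftrightarrow> (\<forall>i. (\<lambda>x. f x $ i) \<in> borel_measurable M)"
proof
  assume f: "f \<in> borel_measurable M"
  show "\<forall>i. (\<lambda>x. f x $ i) \<in> borel_measurable M"
  proof
    fix i
    have "continuous_on UNIV (\<lambda>v::'b^'n. v $ i)" by (intro continuous_intros)
    then show "(\<lambda>x. f x $ i) \<in> borel_measurable M"
      using f by (auto intro: borel_measurable_continuous_on)
  qed
next
  assume f: "\<forall>i. (\<lambda>x. f x $ i) \<in> borel_measurable M"
  have "(\<lambda>x. f x \<bullet> b) \<in> borel_measurable M" if b: "b \<in> Basis" for b
  proof -
    obtain i c where "b = axis i c" using b by (auto simp: Basis_vec_def)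
    then show ?thesis using f borel_measurable_inner[of "\<lambda>x. f x $ i" M "\<lambda>x. c"] by (simp add: inner_axis)
  qed
  then show "f \<in> borel_measurable M" by (subst borel_measurable_euclidean_space) blast
qed

lemma square_integrable_component:
  fixes f :: "'a \<Rightarrow> 'b::euclidean_space^'n"
  shows "square_integrable M f \<longleftrightarrow> (\<forall>i. square_integrable M (\<lambda>x. f x $ i))"
proof
  assume f: "square_integrable M f"
  show "\<forall>i. square_integrable M (\<lambda>x. f x $ i)"
  proof
    fix i
    show "square_integrable M (\<lambda>x. f x $ i)"
      by (rule square_integrable_bounded_image[OF f, of _ 1])
        (use f in \<open>auto simp: square_integrable_def borel_measurable_vec_iff[of f] Finite_Cartesian_Product.norm_nth_le\<close>)
  qed
next
  assume f: "\<forall>i. square_integrable M (\<lambda>x. f x $ i)"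
  have "(norm (f x))\<^sup>2 = (\<Sum>i\<in>UNIV. (norm (f x $ i))\<^sup>2)" for x
    by (simp add: norm_vec_def L2_set_def sum_nonneg)
  then show "square_integrable M f" using f by (simp add: square_integrable_def borel_measurable_vec_iff[of f])
qed

lemma l2_Cauchy_Schwarz:
  assumes "square_integrable M f" "square_integrable M g"
  shows "\<bar>\<integral>x. f x \<bullet> g x \<partial>M\<bar> \<le> l2norm M f * l2norm M g"
  unfolding l2norm_def
proof (rule discriminant_le)
  fix t
  have "0 \<le> (\<integral>x. (norm (f x + t *\<^sub>R g x))\<^sup>2 \<partial>M)" by simp
  also have "(\<integral>x. (norm (f x + t *\<^sub>R g x))\<^sup>2 \<partial>M)
      = (\<integral>x. (norm (f x))\<^sup>2 \<partial>M) + 2 * t * (\<integral>x. f x \<bullet> g x \<partial>M) + t\<^sup>2 * (\<integral>x. (norm (g x))\<^sup>2 \<partial>M)"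
    using assms square_integrable_inner[OF assms]
    by (simp add: square_integrable_def norm_combination_square)
  finally show "0 \<le> (\<integral>x. (norm (f x))\<^sup>2 \<partial>M) + 2 * t * (\<integral>x. f x \<bullet> g x \<partial>M) + t\<^sup>2 * (\<integral>x. (norm (g x))\<^sup>2 \<partial>M)" .
qed auto

lemma l2_tendsto_inner:
  assumes f: "\<And>k. square_integrable M (f k)" "square_integrable M h" and g: "square_integrable M g"
    and lim: "(\<lambda>k. l2norm M (\<lambda>x. f k x - h x)) \<longlonglongrightarrow> 0"
  shows "(\<lambda>k. \<integral>x. f k x \<bullet> g x \<partial>M) \<longlonglongrightarrow> (\<integral>x. h x \<bullet> g x \<partial>M)"
proof -
  have "(\<lambda>k. (\<integral>x. f k x \<bullet> g x \<partial>M) - (\<integral>x. h x \<bullet> g x \<partial>M)) \<longlonglongrightarrow> 0"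
  proof (rule Lim_null_comparison)
    show "\<forall>\<^sub>F k in sequentially. norm ((\<integral>x. f k x \<bullet> g x \<partial>M) - (\<integral>x. h x \<bullet> g x \<partial>M))
        \<le> l2norm M (\<lambda>x. f k x - h x) * l2norm M g"
    proof (rule always_eventually, rule allI)
      fix k
      have "(\<integral>x. f k x \<bullet> g x \<partial>M) - (\<integral>x. h x \<bullet> g x \<partial>M) = (\<integral>x. (f k x - h x) \<bullet> g x \<partial>M)"
        using f g by (simp add: inner_diff_left square_integrable_inner)
      then show "norm ((\<integral>x. f k x \<bullet> g x \<partial>M) - (\<integral>x. h x \<bullet> g x \<partial>M))
          \<le> l2norm M (\<lambda>x. f k x - h x) * l2norm M g"
        using l2_Cauchy_Schwarz[OF square_integrable_diff[OF f] g] by simp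
    qed
    show "(\<lambda>k. l2norm M (\<lambda>x. f k x - h x) * l2norm M g) \<longlonglongrightarrow> 0"
      using tendsto_mult_left_zero[OF lim] .
  qed
  then show ?thesis by (simp add: LIM_zero_iff)
qed

lemma (in finite_measure) square_integrable_imp_integrable:
  assumes "square_integrable M f"
  shows "integrable M f" "(\<integral>x. norm (f x) \<partial>M) \<le> l2norm M f * sqrt (measure M (space M))"
proof -
  have n: "square_integrable M (\<lambda>x. norm (f x))" and c: "square_integrable M (\<lambda>x. 1::real)"
    using assms by (auto simp: square_integrable_def)
  have "integrable M (\<lambda>x. norm (f x))" using square_integrable_inner[OF n c] by simp
  then show "integrable M f" using assms by (simp add: square_integrable_def integrable_norm_iff)
  show "(\<integral>x. norm (f x) \<partial>M) \<le> l2norm M f * sqrt (measure M (space M))"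
    using l2_Cauchy_Schwarz[OF n c] by (simp add: l2norm_def)
qed

text \<open>This is the Riesz-Fischer theorem. On a finite measure space an L2 Cauchy sequence is L1
  Cauchy, which yields a subsequence converging almost everywhere; Fatou's lemma along it turns the
  pointwise limit into an L2 limit of the whole sequence.\<close>

lemma (in finite_measure) square_integrable_complete:
  fixes f :: "nat \<Rightarrow> 'a \<Rightarrow> 'b::euclidean_space"
  assumes f: "\<And>k. square_integrable M (f k)"
    and cauchy: "\<And>e. e > 0 \<Longrightarrow> \<exists>N. \<forall>i\<ge>N. \<forall>j\<ge>N. l2norm M (\<lambda>x. f i x - f j x) < e"
  obtains g where "square_integrable M g" "(\<lambda>k. l2norm M (\<lambda>x. f k x - g x)) \<longlonglongrightarrow> 0"
proof -
  have [measurable]: "\<And>k. f k \<in> borel_measurable M" using f by (simp add: square_integrable_def)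
  have "\<exists>N. \<forall>i\<ge>N. \<forall>j\<ge>N. (\<integral>x. norm (f i x - f j x) \<partial>M) < e" if "e > 0" for e
  proof -
    \<comment> \<open>The summand 1 keeps \<open>K\<close> positive also when the measure
      vanishes.\<close>
    define K where "K = sqrt (measure M (space M)) + 1"
    have K: "K > 0" "sqrt (measure M (space M)) \<le> K" by (auto simp: K_def add_nonneg_pos)
    obtain N where N: "\<And>i j. i \<ge> N \<Longrightarrow> j \<ge> N \<Longrightarrow> l2norm M (\<lambda>x. f i x - f j x) < e / K"
      using cauchy[of "e / K"] \<open>e > 0\<close> K by auto
    have "(\<integral>x. norm (f i x - f j x) \<partial>M) < e" if "i \<ge> N" "j \<ge> N" for i j
    proof -
      have "(\<integral>x. norm (f i x - f j x) \<partial>M) \<le> l2norm M (\<lambda>x. f i x - f j x) * K"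
        using square_integrable_imp_integrable(2)[OF square_integrable_diff[OF f f, of i j]]
          mult_left_mono[OF K(2) l2norm_nonneg[of M "\<lambda>x. f i x - f j x"]] by linarith
      also have "\<dots> < e" using N[OF that] K by (simp add: field_simps)
      finally show ?thesis .
    qed
    then show ?thesis by blast
  qed
  then obtain r where r: "strict_mono r" "AE x in M. Cauchy (\<lambda>i. f (r i) x)"
    using cauchy_L1_AE_cauchy_subseq[of M f] square_integrable_imp_integrable(1)[OF f] by blast
  define g where "g x = lim (\<lambda>i. f (r i) x)" for x
  have [measurable]: "g \<in> borel_measurable M"
    unfolding g_def by (rule borel_measurable_lim_metric) simp
  have lim: "AE x in M. (\<lambda>i. f (r i) x) \<longlonglongrightarrow> g x"
    using r(2) unfolding g_def by eventually_elim (simp add: Cauchy_convergent convergent_LIMSEQ_iff[symmetric])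
  \<comment> \<open>The index k is fixed: the integrand is the liminf of those with
    \<open>f (r i)\<close> in place of the limit, and \<open>r i \<ge> i\<close> puts all late
    indices beyond \<open>N\<close>.\<close>
  have est: "integrable M (\<lambda>x. (norm (f k x - g x))\<^sup>2) \<and> (\<integral>x. (norm (f k x - g x))\<^sup>2 \<partial>M) \<le> e"
    if k: "\<And>j. j \<ge> N \<Longrightarrow> (\<integral>x. (norm (f k x - f j x))\<^sup>2 \<partial>M) \<le> e" "0 \<le> e" for k N e
  proof -
    have "(\<integral>\<^sup>+x. ennreal ((norm (f k x - g x))\<^sup>2) \<partial>M)
        = (\<integral>\<^sup>+x. liminf (\<lambda>i. ennreal ((norm (f k x - f (r i) x))\<^sup>2)) \<partial>M)"
    proof (rule nn_integral_cong_AE)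
      show "AE x in M. ennreal ((norm (f k x - g x))\<^sup>2)
          = liminf (\<lambda>i. ennreal ((norm (f k x - f (r i) x))\<^sup>2))"
        using lim
      proof eventually_elim
        fix x assume "(\<lambda>i. f (r i) x) \<longlonglongrightarrow> g x"
        then have "(\<lambda>i. ennreal ((norm (f k x - f (r i) x))\<^sup>2)) \<longlonglongrightarrow> ennreal ((norm (f k x - g x))\<^sup>2)"
          by (intro tendsto_intros)
        then show "ennreal ((norm (f k x - g x))\<^sup>2) = liminf (\<lambda>i. ennreal ((norm (f k x - f (r i) x))\<^sup>2))"
          using lim_imp_Liminf[OF sequentially_bot] by metis
      qed
    qed
    also have "\<dots> \<le> liminf (\<lambda>i. \<integral>\<^sup>+x. ennreal ((norm (f k x - f (r i) x))\<^sup>2) \<partial>M)"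
      by (rule nn_integral_liminf) simp
    also have "\<dots> \<le> ennreal e"
    proof (rule Liminf_le)
      show "\<forall>\<^sub>F i in sequentially. (\<integral>\<^sup>+x. ennreal ((norm (f k x - f (r i) x))\<^sup>2) \<partial>M) \<le> ennreal e"
        using eventually_ge_at_top[of N]
      proof eventually_elim
        fix i assume "N \<le> i"
        then have "N \<le> r i" using seq_suble[OF r(1), of i] by simp
        then show "(\<integral>\<^sup>+x. ennreal ((norm (f k x - f (r i) x))\<^sup>2) \<partial>M) \<le> ennreal e"
          using k square_integrable_diff[OF f f, of k "r i"]
          by (subst nn_integral_eq_integral) (auto simp: square_integrable_def intro!: ennreal_leI)
      qed
    qed simp
    finally have *: "(\<integral>\<^sup>+x. ennreal ((norm (f k x - g x))\<^sup>2) \<partial>M) \<le> ennreal e" .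
    then have i: "integrable M (\<lambda>x. (norm (f k x - g x))\<^sup>2)"
      by (intro integrableI_bounded) (auto simp: le_less_trans)
    moreover have "(\<integral>x. (norm (f k x - g x))\<^sup>2 \<partial>M) \<le> e"
      using * i \<open>0 \<le> e\<close> by (subst (asm) nn_integral_eq_integral) auto
    ultimately show ?thesis by blast
  qed
  have est': "\<exists>N. \<forall>k\<ge>N. integrable M (\<lambda>x. (norm (f k x - g x))\<^sup>2) \<and> l2norm M (\<lambda>x. f k x - g x) < e"
    if e: "e > 0" for e
  proof -
    obtain N where N: "\<And>i j. i \<ge> N \<Longrightarrow> j \<ge> N \<Longrightarrow> l2norm M (\<lambda>x. f i x - f j x) < e / 2"
      using cauchy[of "e / 2"] e by auto
    have "(\<integral>x. (norm (f i x - f j x))\<^sup>2 \<partial>M) \<le> (e / 2)\<^sup>2" if "i \<ge> N" "j \<ge> N" for i j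
      using power_mono[OF less_imp_le[OF N[OF that]] l2norm_nonneg, of 2] by (simp add: l2norm_square)
    then have *: "integrable M (\<lambda>x. (norm (f k x - g x))\<^sup>2)"
        "(\<integral>x. (norm (f k x - g x))\<^sup>2 \<partial>M) \<le> (e / 2)\<^sup>2" if "k \<ge> N" for k
      using est[of N k "(e / 2)\<^sup>2"] that by auto
    have "l2norm M (\<lambda>x. f k x - g x) < e" if "k \<ge> N" for k
      using real_sqrt_le_mono[OF *(2)[OF that]] e by (simp add: l2norm_def)
    then show ?thesis using *(1) by (intro exI[of _ N]) simp
  qed
  show thesis
  proof (rule that)
    obtain N where N: "square_integrable M (\<lambda>x. f N x - g x)"
      using est'[of 1] by (auto simp: square_integrable_def)
    show "square_integrable M g"
      using square_integrable_diff[OF f[of N] N] by simp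
    show "(\<lambda>k. l2norm M (\<lambda>x. f k x - g x)) \<longlonglongrightarrow> 0"
      by (rule LIMSEQ_I) (use est' in \<open>fastforce simp: l2norm_nonneg\<close>)
  qed
qed

section \<open>Smooth bump functions\<close>

text \<open>The classical exp (- c / x), extended by 0. The powers in the denominator make the
  family closed under differentiation, and letting \<open>c\<close> tend to 0 later turns bumps into
  indicators of boxes.\<close>

definition flat :: "real \<Rightarrow> nat \<Rightarrow> real \<Rightarrow> real" where
  "flat c k x = (if x > 0 then exp (- c / x) / x ^ k else 0)"

lemma power_le_fact_exp:
  fixes y :: real assumes "0 \<le> y"
  shows "y ^ m \<le> fact m * exp y"
proof -
  have "y ^ m / fact m \<le> (\<Sum>i\<le>m. y ^ i / fact i)"
    using assms by (intro member_le_sum) auto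
  also have "\<dots> \<le> exp y"
    using assms sum_le_suminf[OF summable_exp_generic[of y], of "{..m}"]
    by (simp add: exp_def divide_inverse mult.commute)
  finally show ?thesis by (simp add: field_simps)
qed

text \<open>Comes from \<open>y ^ m \<le> fact m * exp y\<close> with \<open>y = c / x\<close> and
  \<open>m = k + 2\<close>: k powers cancel the denominator, and the other two give a bound strong
  enough for a zero derivative at the origin.\<close>

lemma flat_le_square:
  assumes "c > 0"
  shows "\<bar>flat c k x\<bar> \<le> fact (k + 2) / c ^ (k + 2) * x\<^sup>2"
proof (cases "x > 0")
  case True
  have "(c / x) ^ (k + 2) \<le> fact (k + 2) * exp (c / x)"
    using assms True by (intro power_le_fact_exp) simp
  then have "exp (- c / x) \<le> fact (k + 2) * x ^ (k + 2) / c ^ (k + 2)"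
    using assms True by (simp add: exp_minus field_simps power_divide)
  then have "exp (- c / x) / x ^ k \<le> fact (k + 2) * x ^ (k + 2) / c ^ (k + 2) / x ^ k"
    using True by (intro divide_right_mono) auto
  also have "\<dots> = fact (k + 2) / c ^ (k + 2) * x\<^sup>2"
    using True by (simp add: power_add power2_eq_square)
  finally show ?thesis using True by (simp add: flat_def)
qed (use assms in \<open>simp add: flat_def\<close>)

lemma flat_has_derivative:
  assumes "c > 0"
  shows "(flat c k has_real_derivative (c * flat c (k + 2) x - real k * flat c (k + 1) x)) (at x)"
proof -
  consider "x > 0" | "x < 0" | "x = 0" by linarith
  then show ?thesis
  proof cases
    case 1
    have "((\<lambda>x. exp (- c / x) / x ^ k) has_real_derivative
        (c * flat c (k + 2) x - real k * flat c (k + 1) x)) (at x)"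
    proof -
      have e: "((\<lambda>x. exp (- c / x)) has_real_derivative exp (- c / x) * (c / x\<^sup>2)) (at x)"
        using 1 by (auto intro!: derivative_eq_intros simp: power2_eq_square)
      have "((\<lambda>x. exp (- c / x) / x ^ k) has_real_derivative
          (exp (- c / x) * (c / x\<^sup>2) * x ^ k - exp (- c / x) * (real k * x ^ (k - 1))) / (x ^ k * x ^ k)) (at x)"
        using DERIV_divide[OF e DERIV_pow] 1 by simp
      moreover have "(exp (- c / x) * (c / x\<^sup>2) * x ^ k - exp (- c / x) * (real k * x ^ (k - 1))) / (x ^ k * x ^ k)
          = c * flat c (k + 2) x - real k * flat c (k + 1) x"
        \<comment> \<open>The case \<open>k = 0\<close> is separate because \<open>k - 1\<close> is
          truncated subtraction.\<close>
        using 1 by (cases k) (simp_all add: flat_def field_simps power2_eq_square)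
      ultimately show ?thesis by simp
    qed
    moreover have "\<forall>\<^sub>F y in nhds x. exp (- c / y) / y ^ k = flat c k y"
      using 1 by (intro eventually_mono[OF eventually_nhds_in_open[of "{0<..}" x]]) (auto simp: flat_def)
    ultimately show ?thesis by (subst DERIV_cong_ev[OF refl _ refl, symmetric])
  next
    case 2
    have "\<forall>\<^sub>F y in nhds x. 0 = flat c k y"
      using 2 by (intro eventually_mono[OF eventually_nhds_in_open[of "{..<0}" x]]) (auto simp: flat_def)
    moreover have "((\<lambda>x. 0) has_real_derivative (c * flat c (k + 2) x - real k * flat c (k + 1) x)) (at x)"
      using 2 by (simp add: flat_def)
    ultimately show ?thesis by (subst DERIV_cong_ev[OF refl _ refl, symmetric])
  next
    case 3
    define C where "C = fact (k + 2) / c ^ (k + 2)"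
    have "((\<lambda>h. flat c k h / h) \<longlongrightarrow> 0) (at 0)"
    proof (rule Lim_null_comparison)
      show "\<forall>\<^sub>F h in at 0. norm (flat c k h / h) \<le> C * \<bar>h\<bar>"
      proof (rule eventually_mono[OF eventually_neq_at_within[of 0]])
        fix h :: real assume "h \<noteq> 0"
        then show "norm (flat c k h / h) \<le> C * \<bar>h\<bar>"
          using flat_le_square[OF assms, of k h]
          by (simp add: C_def abs_divide divide_le_eq power2_eq_square abs_mult flip: mult.assoc)
      qed
      have "((\<lambda>h. C * \<bar>h\<bar>) \<longlongrightarrow> C * \<bar>0\<bar>) (at (0::real))" by (intro tendsto_intros)
      then show "((\<lambda>h. C * \<bar>h\<bar>) \<longlongrightarrow> 0) (at (0::real))" by simp
    qed
    then show ?thesis using 3 by (simp add: DERIV_def flat_def)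
  qed
qed

text \<open>An algebra of functions closed under partial derivatives, which therefore consists of smooth
  functions.\<close>

inductive flat_algebra :: "(real^'n::finite \<Rightarrow> real) \<Rightarrow> bool" where
  const: "flat_algebra (\<lambda>x. r)"
| flat: "c > 0 \<Longrightarrow> flat_algebra (\<lambda>x. flat c k (s * x $ i + r))"
| add: "flat_algebra f \<Longrightarrow> flat_algebra g \<Longrightarrow> flat_algebra (\<lambda>x. f x + g x)"
| mult: "flat_algebra f \<Longrightarrow> flat_algebra g \<Longrightarrow> flat_algebra (\<lambda>x. f x * g x)"

lemma flat_algebra_derivative:
  fixes f :: "real^'n::finite \<Rightarrow> real"
  assumes "flat_algebra f"
  shows "\<exists>f'. (\<forall>x. (f has_derivative f' x) (at x)) \<and> (\<forall>i. flat_algebra (\<lambda>x. f' x (axis i 1)))"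
  using assms
proof induction
  case (const r)
  have "((\<lambda>x. r) has_derivative (\<lambda>h. 0)) (at x)" for x :: "real^'n" by simp
  then show ?case using flat_algebra.const[of 0] by (intro exI[of _ "\<lambda>x h. 0"]) auto
next
  case (flat c k s i r)
  define d where "d x = c * flat c (k + 2) x - real k * flat c (k + 1) x" for x
  have "((\<lambda>x. flat c k (s * x $ i + r)) has_derivative (\<lambda>h. d (s * x $ i + r) * (s * h $ i))) (at x)"
    for x :: "real^'n"
  proof -
    have "((\<lambda>x::real^'n. s * x $ i + r) has_derivative (\<lambda>h. s * h $ i)) (at x)"
      by (auto intro!: derivative_eq_intros bounded_linear_imp_has_derivative bounded_linear_vec_nth)
    moreover have "(flat c k has_derivative (*) (d (s * x $ i + r))) (at (s * x $ i + r))"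
      using flat_has_derivative[OF flat, of k] unfolding d_def has_field_derivative_def .
    ultimately show ?thesis
      using has_derivative_compose by fastforce
  qed
  moreover have "flat_algebra (\<lambda>x. d (s * x $ i + r) * (s * axis j 1 $ i))" for j
  proof -
    have "flat_algebra (\<lambda>x::real^'n. ((c * flat c (k + 2) (s * x $ i + r))
        + (- real k) * flat c (k + 1) (s * x $ i + r)) * (s * axis j 1 $ i))"
      by (intro flat_algebra.intros flat)
    then show ?thesis by (simp add: d_def)
  qed
  ultimately show ?case by (intro exI[of _ "\<lambda>x h. d (s * x $ i + r) * (s * h $ i)"]) simp
next
  case (add f g)
  then obtain f' g' where "\<forall>x. (f has_derivative f' x) (at x)" "\<forall>i. flat_algebra (\<lambda>x. f' x (axis i 1))"
    "\<forall>x. (g has_derivative g' x) (at x)" "\<forall>i. flat_algebra (\<lambda>x. g' x (axis i 1))" by blast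
  then show ?case
    by (intro exI[of _ "\<lambda>x h. f' x h + g' x h"]) (auto intro: has_derivative_add flat_algebra.add)
next
  case (mult f g)
  then obtain f' g' where "\<forall>x. (f has_derivative f' x) (at x)" "\<forall>i. flat_algebra (\<lambda>x. f' x (axis i 1))"
    "\<forall>x. (g has_derivative g' x) (at x)" "\<forall>i. flat_algebra (\<lambda>x. g' x (axis i 1))" by blast
  then show ?case using mult.hyps
    by (intro exI[of _ "\<lambda>x h. f x * g' x h + f' x h * g x"])
      (auto intro!: has_derivative_mult flat_algebra.add flat_algebra.mult)
qed

lemma flat_algebra_prod:
  "finite I \<Longrightarrow> (\<And>i. i \<in> I \<Longrightarrow> flat_algebra (f i)) \<Longrightarrow> flat_algebra (\<lambda>x. \<Prod>i\<in>I. f i x)"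
  by (induction I rule: finite_induct) (auto intro: flat_algebra.intros)

lemma flat_algebra_smooth:
  fixes f :: "real^'n::finite \<Rightarrow> real"
  assumes "flat_algebra f"
  shows "smooth_fn f"
proof -
  have pd: "flat_algebra (pd i f)" if f: "flat_algebra f" for i and f :: "real^'n \<Rightarrow> real"
  proof -
    obtain f' where f': "\<forall>x. (f has_derivative f' x) (at x)" "\<forall>i. flat_algebra (\<lambda>x. f' x (axis i 1))"
      using flat_algebra_derivative[OF f] by blast
    then have "pd i f = (\<lambda>x. f' x (axis i 1))"
      unfolding pd_def using frechet_derivative_at by metis
    then show ?thesis using f' by simp
  qed
  have "flat_algebra (fold pd is f)" for "is"
    using assms by (induction "is" arbitrary: f) (auto simp: pd)
  then show ?thesis unfolding smooth_fn_def differentiable_def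
    using flat_algebra_derivative by blast
qed

text \<open>A product of one-variable factors, positive exactly in the open box with corners
  \<open>a\<close> and \<open>b\<close>. Boxes suit both the coordinatewise proof of smoothness and
  the differentiation theorem for averages over cubes.\<close>

definition bump :: "real \<Rightarrow> real^'n::finite \<Rightarrow> real^'n \<Rightarrow> real^'n \<Rightarrow> real" where
  "bump c a b x = (\<Prod>i\<in>UNIV. flat c 0 (x $ i - a $ i) * flat c 0 (b $ i - x $ i))"

lemma bump_outside: "x \<notin> box a b \<Longrightarrow> bump c a b x = 0"
  unfolding bump_def mem_box_cart by (intro prod_zero) (auto simp: flat_def)

lemma bump_test_fun:
  assumes "c > 0" "cbox a b \<subseteq> U"
  shows "test_fun U (bump c a b)"
  unfolding test_fun_def
proof (intro conjI exI[of _ "cbox a b"] allI impI)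
  have "flat_algebra (\<lambda>x. \<Prod>i\<in>UNIV. flat c 0 (1 * x $ i + - a $ i) * flat c 0 (- 1 * x $ i + b $ i))"
    by (intro flat_algebra_prod flat_algebra.intros assms) auto
  then show "smooth_fn (bump c a b)"
    by (intro flat_algebra_smooth) (simp add: bump_def[abs_def] algebra_simps)
  show "bump c a b x = 0" if "x \<notin> cbox a b" for x
    using bump_outside box_subset_cbox that by blast
qed (use assms in \<open>auto simp: compact_cbox\<close>)

lemma bump_bounds:
  assumes "c > 0"
  shows "0 \<le> bump c a b x" "bump c a b x \<le> 1"
  unfolding bump_def using assms
  by (auto simp: flat_def intro!: prod_nonneg prod_le_1 mult_le_one)

text \<open>Inside the box each factor exp (- c / y) tends to 1 as c tends to 0; outside, some
  factor is always 0.\<close>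

lemma bump_tendsto_indicator:
  "(\<lambda>k. bump (1 / real (Suc k)) a b x) \<longlonglongrightarrow> indicator (box a b) x"
proof (cases "x \<in> box a b")
  case True
  have f: "(\<lambda>k. flat (1 / real (Suc k)) 0 y) \<longlonglongrightarrow> 1" if "y > 0" for y
  proof -
    have "(\<lambda>k. exp (- (1 / real (Suc k)) / y)) \<longlonglongrightarrow> exp (- 0 / y)"
      by (intro tendsto_intros LIMSEQ_Suc[OF lim_1_over_n]) (use that in auto)
    then show ?thesis using that by (simp add: flat_def)
  qed
  have "(\<lambda>k. bump (1 / real (Suc k)) a b x) \<longlonglongrightarrow> (\<Prod>i\<in>(UNIV::'a set). 1 * 1)"
    unfolding bump_def by (intro tendsto_prod tendsto_mult f) (use True in \<open>auto simp: mem_box_cart\<close>)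
  then show ?thesis using True by simp
qed (simp add: bump_outside)

lemma continuous_imp_lebesgue_measurable:
  "continuous_on UNIV f \<Longrightarrow> f \<in> borel_measurable lebesgue"
  by (intro measurable_completion) (simp add: borel_measurable_continuous_onI)

text \<open>Bumps converge boundedly to the indicator of a box, so the extension \<open>G\<close> of
  \<open>g\<close> by zero has vanishing integral over every closed box inside \<open>U\<close>. At
  almost every point \<open>G\<close> is the limit of its averages over small cubes having that
  point as a corner, so \<open>g\<close> vanishes there.\<close>

lemma fundamental_lemma_of_variations:
  fixes g :: "real^'n::finite \<Rightarrow> 'b::euclidean_space"
  assumes U: "open U" and g: "integrable (lebesgue_on U) g"
    and zero: "\<And>\<phi>. test_fun U \<phi> \<Longrightarrow> (\<integral>x. \<phi> x *\<^sub>R g x \<partial>lebesgue_on U) = 0"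
  shows "AE x in lebesgue_on U. g x = 0"
proof -
  have [simp]: "U \<in> sets lebesgue" using U by simp
  define G where "G x = indicator U x *\<^sub>R g x" for x
  have G: "integrable lebesgue G" using g unfolding G_def by (simp add: integrable_restrict_space)
  then have [measurable]: "G \<in> borel_measurable lebesgue" by simp
  have box0: "integral (cbox a b) G = 0" if ab: "cbox a b \<subseteq> U" for a b
  proof -
    have "(\<lambda>k. \<integral>x. bump (1 / real (Suc k)) a b x *\<^sub>R G x \<partial>lebesgue)
        \<longlonglongrightarrow> (\<integral>x. indicator (box a b) x *\<^sub>R G x \<partial>lebesgue)"
    proof (rule integral_dominated_convergence[where w = "\<lambda>x. norm (G x)"])
      fix k
      have "continuous_on UNIV (bump (1 / real (Suc k)) a b)"
        using bump_test_fun[OF _ ab, of "1 / real (Suc k)"]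
        by (auto simp: test_fun_def smooth_fn_def continuous_on_eq_continuous_at
            intro!: differentiable_imp_continuous_within dest!: spec[of _ "[]"])
      then have [measurable]: "bump (1 / real (Suc k)) a b \<in> borel_measurable lebesgue"
        by (rule continuous_imp_lebesgue_measurable)
      show "(\<lambda>x. bump (1 / real (Suc k)) a b x *\<^sub>R G x) \<in> borel_measurable lebesgue" by measurable
      show "AE x in lebesgue. norm (bump (1 / real (Suc k)) a b x *\<^sub>R G x) \<le> norm (G x)"
        using bump_bounds[of "1 / real (Suc k)" a b] by (auto intro!: AE_I2 mult_left_le_one_le)
    next
      show "AE x in lebesgue. (\<lambda>k. bump (1 / real (Suc k)) a b x *\<^sub>R G x) \<longlonglongrightarrow> indicator (box a b) x *\<^sub>R G x"
        by (intro AE_I2 tendsto_scaleR bump_tendsto_indicator tendsto_const)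
    next
      have [measurable]: "box a b \<in> sets lebesgue" by simp
      show "(\<lambda>x. indicat_real (box a b) x *\<^sub>R G x) \<in> borel_measurable lebesgue" by measurable
    qed (use G in auto)
    moreover have "(\<integral>x. bump (1 / real (Suc k)) a b x *\<^sub>R G x \<partial>lebesgue) = 0" for k
      using zero[OF bump_test_fun[OF _ ab, of "1 / real (Suc k)"]]
      by (simp add: integral_restrict_space G_def scaleR_scaleR mult.commute)
    ultimately have "(\<integral>x. indicator (box a b) x *\<^sub>R G x \<partial>lebesgue) = 0"
      by (simp add: LIMSEQ_const_iff)
    moreover have "(\<integral>x. indicator (box a b) x *\<^sub>R G x \<partial>lebesgue) = integral (box a b) G"
      using set_lebesgue_integral_eq_integral(2)[of "box a b" G] G
      by (simp add: set_lebesgue_integral_def set_integrable_def integrable_mult_indicator)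
    ultimately show ?thesis by (simp add: integral_open_interval)
  qed
  have "G integrable_on cbox a b" for a b
    using G by (intro set_lebesgue_integral_eq_integral(1))
      (simp add: set_integrable_def integrable_mult_indicator)
  then obtain N where N: "negligible N" "\<And>x e. \<lbrakk>x \<notin> N; 0 < e\<rbrakk> \<Longrightarrow>
      \<exists>d>0. \<forall>h. 0 < h \<and> h < d \<longrightarrow>
        norm (integral (cbox x (x + h *\<^sub>R One)) G /\<^sub>R h ^ DIM(real^'n) - G x) < e"
    by (rule integrable_ccontinuous_explicit[of G]) blast
  have "g x = 0" if x: "x \<in> U" "x \<notin> N" for x
  proof (rule ccontr)
    assume "g x \<noteq> 0"
    then obtain d where d: "d > 0" "\<And>h. 0 < h \<Longrightarrow> h < d \<Longrightarrow>
        norm (integral (cbox x (x + h *\<^sub>R One)) G /\<^sub>R h ^ DIM(real^'n) - G x) < norm (g x)"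
      using N(2)[OF x(2), of "norm (g x)"] by auto
    obtain r where r: "r > 0" "ball x r \<subseteq> U" using U x(1) openE by blast
    \<comment> \<open>Halving the minimum keeps the inequalities strict; dividing \<open>r\<close>
      by the dimension puts the cube into the ball, distances being estimated by the l1
      norm.\<close>
    define h where "h = min d (r / real DIM(real^'n)) / 2"
    have h: "0 < h" "h < d" "h * DIM(real^'n) < r"
      using d r by (auto simp: h_def min_def field_simps)
    have "cbox x (x + h *\<^sub>R One) \<subseteq> U"
    proof
      fix y assume y: "y \<in> cbox x (x + h *\<^sub>R One)"
      have "norm (y - x) \<le> (\<Sum>b\<in>Basis. \<bar>(y - x) \<bullet> b\<bar>)" by (rule norm_le_l1)
      also have "\<dots> \<le> (\<Sum>b\<in>(Basis::(real^'n) set). h)"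
        by (intro sum_mono) (use y in \<open>auto simp: mem_box inner_diff_left inner_add_left algebra_simps\<close>)
      finally have "norm (y - x) < r" using h(3) by (simp add: mult.commute)
      then show "y \<in> U" using r(2) by (auto simp: dist_norm norm_minus_commute)
    qed
    then show False using d(2)[OF h(1,2)] box0 x(1) by (simp add: G_def)
  qed
  then have "AE x in lebesgue. x \<in> U \<longrightarrow> g x = 0"
    using N(1) by (intro AE_I'[of N]) (auto simp: negligible_iff_null_sets)
  then show ?thesis by (simp add: AE_restrict_space_iff)
qed

section \<open>Integration by parts and the Poincare inequality\<close>

lemma has_derivative_imp_pd: "(f has_derivative f') (at x) \<Longrightarrow> pd i f x = f' (axis i 1)"
  unfolding pd_def using frechet_derivative_at by metis

lemma smooth_fn_pd: "smooth_fn f \<Longrightarrow> smooth_fn (pd i f)"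
  unfolding smooth_fn_def by (metis fold_simps(2))

lemma smooth_fn_has_derivative:
  "smooth_fn f \<Longrightarrow> (f has_derivative frechet_derivative f (at x)) (at x)"
  unfolding smooth_fn_def by (metis fold_simps(1) frechet_derivative_works)

lemma smooth_fn_continuous: "smooth_fn f \<Longrightarrow> continuous_on UNIV f"
  by (meson continuous_at_imp_continuous_on has_derivative_continuous smooth_fn_has_derivative)

lemma pd_combination:
  assumes "smooth_fn f" "smooth_fn g"
  shows "pd i (\<lambda>x. f x + t * g x) = (\<lambda>x. pd i f x + t * pd i g x)"
proof
  fix x
  have "((\<lambda>x. f x + t * g x) has_derivative
      (\<lambda>h. frechet_derivative f (at x) h + t * frechet_derivative g (at x) h)) (at x)"
    by (intro has_derivative_add has_derivative_mult_right smooth_fn_has_derivative assms)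
  from has_derivative_imp_pd[OF this]
  show "pd i (\<lambda>x. f x + t * g x) x = pd i f x + t * pd i g x" by (simp add: pd_def)
qed

lemma smooth_fn_combination:
  fixes f g :: "real^'n::finite \<Rightarrow> real"
  assumes "smooth_fn f" "smooth_fn g"
  shows "smooth_fn (\<lambda>x. f x + t * g x)"
  unfolding smooth_fn_def
proof (intro allI)
  fix "is" :: "'n list" and x
  show "fold pd is (\<lambda>x. f x + t * g x) differentiable at x"
    using assms
  proof (induction "is" arbitrary: f g)
    case Nil
    have "((\<lambda>x. f x + t * g x) has_derivative
        (\<lambda>h. frechet_derivative f (at x) h + t * frechet_derivative g (at x) h)) (at x)"
      by (intro has_derivative_add has_derivative_mult_right smooth_fn_has_derivative Nil)
    then show ?case by (auto simp: differentiable_def)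
  next
    case (Cons i "is")
    then show ?case by (simp add: pd_combination smooth_fn_pd)
  qed
qed

lemma test_fun_smooth: "test_fun U f \<Longrightarrow> smooth_fn f"
  by (simp add: test_fun_def)

lemma test_fun_zero: "test_fun U (\<lambda>x. 0)"
proof -
  have "smooth_fn (\<lambda>x::real^'n. 0)" by (intro flat_algebra_smooth flat_algebra.const)
  then show ?thesis by (auto simp: test_fun_def intro!: exI[of _ "{}"])
qed

lemma test_fun_combination:
  assumes "test_fun U f" "test_fun U g"
  shows "test_fun U (\<lambda>x. f x + t * g x)"
proof -
  obtain K L where "compact K" "K \<subseteq> U" "\<forall>x. x \<notin> K \<longrightarrow> f x = 0"
    "compact L" "L \<subseteq> U" "\<forall>x. x \<notin> L \<longrightarrow> g x = 0"
    using assms unfolding test_fun_def by blast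
  then show ?thesis unfolding test_fun_def
    using assms by (intro conjI smooth_fn_combination test_fun_smooth exI[of _ "K \<union> L"]) auto
qed

lemma pd_eq_0:
  assumes "closed K" "\<And>x. x \<notin> K \<Longrightarrow> f x = 0" "x \<notin> K"
  shows "pd i f x = 0"
proof -
  have "(f has_derivative (\<lambda>h. 0)) (at x)"
    by (rule has_derivative_transform_within_open[of "\<lambda>x. 0" _ _ _ "- K"]) (use assms in auto)
  then show ?thesis using has_derivative_imp_pd by fastforce
qed

lemma test_fun_pd: "test_fun U f \<Longrightarrow> test_fun U (pd i f)"
  unfolding test_fun_def using smooth_fn_pd pd_eq_0 compact_imp_closed by metis

lemma continuous_compact_support_integrable:
  fixes f :: "'a::euclidean_space \<Rightarrow> 'b::euclidean_space"
  assumes "continuous_on UNIV f" "compact K" "\<And>x. x \<notin> K \<Longrightarrow> f x = 0"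
  shows "integrable lebesgue f"
proof -
  have "integrable lborel (\<lambda>x. indicator K x *\<^sub>R f x)"
    using borel_integrable_compact[OF assms(2)] assms(1) continuous_on_subset by blast
  moreover have "(\<lambda>x. indicator K x *\<^sub>R f x) = f"
    using assms(3) by (auto simp: indicator_def)
  ultimately show ?thesis by (simp add: integrable_completion)
qed

lemma lebesgue_on_support:
  fixes f :: "'a::euclidean_space \<Rightarrow> 'b::euclidean_space"
  assumes "U \<in> sets lebesgue" "\<And>x. x \<notin> U \<Longrightarrow> f x = 0"
  shows "integral\<^sup>L (lebesgue_on U) f = integral\<^sup>L lebesgue f"
    "integrable (lebesgue_on U) f \<longleftrightarrow> integrable lebesgue f"
proof -
  have "(\<lambda>x. indicator U x *\<^sub>R f x) = f" using assms(2) by (auto simp: indicator_def)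
  then show "integral\<^sup>L (lebesgue_on U) f = integral\<^sup>L lebesgue f"
    "integrable (lebesgue_on U) f \<longleftrightarrow> integrable lebesgue f"
    using assms(1) by (simp_all add: integral_restrict_space integrable_restrict_space)
qed

text \<open>The difference quotients integrate to zero by translation invariance.\<close>

lemma integral_directional_derivative_eq_0:
  fixes f g :: "'a::euclidean_space \<Rightarrow> 'b::euclidean_space"
  assumes der: "\<And>x t. ((\<lambda>t. f (x + t *\<^sub>R e)) has_vector_derivative g (x + t *\<^sub>R e)) (at t)"
    and cont: "continuous_on UNIV f" "continuous_on UNIV g"
    and K: "compact K" "\<And>x. x \<notin> K \<Longrightarrow> f x = 0" "\<And>x. x \<notin> K \<Longrightarrow> g x = 0"
  shows "(\<integral>x. g x \<partial>lebesgue) = 0"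
proof -
  have [measurable]: "f \<in> borel_measurable borel" "g \<in> borel_measurable borel"
    using cont by (simp_all add: borel_measurable_continuous_onI)
  obtain B where B: "\<And>x. norm (g x) \<le> B" "0 \<le> B"
  proof -
    have "compact (g ` K)" using K(1) cont(2) by (meson compact_continuous_image continuous_on_subset subset_UNIV)
    then obtain B where "\<And>x. x \<in> K \<Longrightarrow> norm (g x) \<le> B" using compact_imp_bounded by (fastforce simp: bounded_iff)
    then have "norm (g x) \<le> max B 0" for x using K(3)[of x] by (cases "x \<in> K") (auto simp: le_max_iff_disj)
    then show thesis using that[of "max B 0"] by auto
  qed
  \<comment> \<open>Every point with a nonzero difference quotient for a step in [0, 1] lies in this
    compact union of translates of \<open>K\<close>, so \<open>B * indicator L\<close>
    dominates.\<close>
  define L where "L = (\<lambda>(y, t). y - t *\<^sub>R e) ` (K \<times> {0..1::real})"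
  have "compact L" unfolding L_def
    by (intro compact_continuous_image compact_Times K compact_Icc) (auto intro!: continuous_intros simp: split_beta)
  have [measurable]: "L \<in> sets borel" using \<open>compact L\<close> by (simp add: borel_compact)
  define q where "q k x = real (Suc k) *\<^sub>R (f (x + (1 / real (Suc k)) *\<^sub>R e) - f x)" for k x
  have "(\<lambda>k. \<integral>x. q k x \<partial>lborel) \<longlonglongrightarrow> (\<integral>x. g x \<partial>lborel)"
  proof (rule integral_dominated_convergence[where w = "\<lambda>x. B * indicator L x"])
    show "integrable lborel (\<lambda>x. B * indicator L x)"
      using \<open>compact L\<close> emeasure_compact_finite[of L] by auto
    show "AE x in lborel. (\<lambda>k. q k x) \<longlonglongrightarrow> g x"
    proof (rule AE_I2)
      fix x
      have "((\<lambda>t. f (x + t *\<^sub>R e)) has_vector_derivative g x) (at 0)" using der[of x 0] by simp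
      then have l: "((\<lambda>h. (f (x + h *\<^sub>R e) - f x) /\<^sub>R h) \<longlongrightarrow> g x) (at 0)"
      proof -
        assume "((\<lambda>t. f (x + t *\<^sub>R e)) has_vector_derivative g x) (at 0)"
        then have *: "((\<lambda>h. norm (f (x + h *\<^sub>R e) - f x - h *\<^sub>R g x) / norm h) \<longlongrightarrow> 0) (at 0)"
          unfolding has_vector_derivative_def has_derivative_at by simp
        have "((\<lambda>h. norm ((f (x + h *\<^sub>R e) - f x) /\<^sub>R h - g x)) \<longlongrightarrow> 0) (at 0)"
        proof (rule Lim_transform_eventually[OF *], rule eventually_mono[OF eventually_neq_at_within[of 0]])
          fix h :: real assume h: "h \<noteq> 0"
          then have "(f (x + h *\<^sub>R e) - f x) /\<^sub>R h - g x = (f (x + h *\<^sub>R e) - f x - h *\<^sub>R g x) /\<^sub>R h"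
            by (simp add: scaleR_diff_right)
          then show "norm (f (x + h *\<^sub>R e) - f x - h *\<^sub>R g x) / norm h = norm ((f (x + h *\<^sub>R e) - f x) /\<^sub>R h - g x)"
            by (simp add: divide_inverse mult.commute)
        qed
        then show ?thesis by (simp add: tendsto_norm_zero_iff LIM_zero_iff)
      qed
      have "filterlim (\<lambda>k. 1 / real (Suc k)) (at 0) sequentially"
        using LIMSEQ_Suc[OF lim_1_over_n[where 'a=real]] by (simp add: filterlim_at)
      from filterlim_compose[OF l this] show "(\<lambda>k. q k x) \<longlonglongrightarrow> g x"
        by (simp add: q_def inverse_eq_divide)
    qed
    fix k
    show "AE x in lborel. norm (q k x) \<le> B * indicator L x"
    proof (rule AE_I2)
      fix x
      define s where "s = 1 / real (Suc k)"
      have s: "0 < s" "s \<le> 1" by (auto simp: s_def)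
      \<comment> \<open>The mean value inequality along the line through x makes the bound
        independent of k.\<close>
      have "norm (f (x + s *\<^sub>R e) - f (x + 0 *\<^sub>R e)) \<le> B * norm (s - 0)"
      proof (rule differentiable_bound[of UNIV])
        fix t :: real
        show "((\<lambda>t. f (x + t *\<^sub>R e)) has_derivative (\<lambda>h. h *\<^sub>R g (x + t *\<^sub>R e))) (at t within UNIV)"
          using der[of x t] by (simp add: has_vector_derivative_def)
        show "onorm (\<lambda>h. h *\<^sub>R g (x + t *\<^sub>R e)) \<le> B"
          using B by (intro onorm_le) (simp add: mult.commute[of B] mult_left_mono)
      qed auto
      then have "norm (f (x + s *\<^sub>R e) - f x) \<le> B * s" using s by simp
      then have "norm (q k x) \<le> B" using s
        by (simp add: q_def s_def[symmetric]) (simp add: s_def field_simps)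
      moreover have "q k x = 0" if "x \<notin> L"
      proof -
        have "x + t *\<^sub>R e \<notin> K" if "t \<in> {0..1}" for t
        proof
          assume "x + t *\<^sub>R e \<in> K"
          then have "(\<lambda>(y, t). y - t *\<^sub>R e) (x + t *\<^sub>R e, t) \<in> L"
            unfolding L_def using that by (intro imageI) simp
          then show False using \<open>x \<notin> L\<close> by simp
        qed
        from this[of 0] this[of s] s show ?thesis
          using K(2) unfolding q_def s_def[symmetric] by simp
      qed
      ultimately show "norm (q k x) \<le> B * indicator L x" by (cases "x \<in> L") auto
    qed
  qed (simp_all add: q_def)
  moreover have "(\<integral>x. q k x \<partial>lborel) = 0" for k
  proof -
    have fi: "integrable lborel f"
      using continuous_compact_support_integrable[OF cont(1) K(1,2)] by (simp add: integrable_completion)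
    have t: "(\<integral>x. f (c + x) \<partial>lborel) = (\<integral>x. f x \<partial>lborel)" "integrable lborel (\<lambda>x. f (c + x))" for c
    proof -
      have "(\<integral>x. f x \<partial>distr lborel borel ((+) c)) = (\<integral>x. f (c + x) \<partial>lborel)"
        by (rule integral_distr) simp_all
      then show "(\<integral>x. f (c + x) \<partial>lborel) = (\<integral>x. f x \<partial>lborel)" by (simp add: lborel_distr_plus)
      have "integrable (distr lborel borel ((+) c)) f \<longleftrightarrow> integrable lborel (\<lambda>x. f (c + x))"
        by (rule integrable_distr_eq) simp_all
      then show "integrable lborel (\<lambda>x. f (c + x))" using fi by (simp add: lborel_distr_plus)
    qed
    have "(\<integral>x. f (x + c) - f x \<partial>lborel) = 0" for c
      using t[of c] fi by (simp add: add.commute[of _ c])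
    then show ?thesis unfolding q_def by simp
  qed
  ultimately have "(\<integral>x. g x \<partial>lborel) = 0" by (simp add: LIMSEQ_const_iff)
  then show ?thesis by (simp add: integral_completion)
qed

lemma has_derivative_directional:
  assumes "\<And>x. (f has_derivative f' x) (at x)"
  shows "((\<lambda>t. f (x + t *\<^sub>R e)) has_vector_derivative f' (x + t *\<^sub>R e) e) (at t)"
proof -
  have "((\<lambda>t. x + t *\<^sub>R e) has_derivative (\<lambda>h. h *\<^sub>R e)) (at t)"
    by (auto intro!: derivative_eq_intros)
  from has_derivative_compose[OF this assms]
  have "((\<lambda>t. f (x + t *\<^sub>R e)) has_derivative (\<lambda>h. f' (x + t *\<^sub>R e) (h *\<^sub>R e))) (at t)" .
  then show ?thesis unfolding has_vector_derivative_def
    using linear_cmul[OF has_derivative_linear[OF assms]] by simp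
qed

text \<open>The product of \<open>F\<close> with the compactly supported \<phi> falls under
  \<open>integral_directional_derivative_eq_0\<close>, and the product rule splits its derivative
  into the two integrands.\<close>

lemma integral_by_parts_test_fun:
  fixes F :: "real^'n::finite \<Rightarrow> complex"
  assumes U: "open U" and F: "\<And>x. (F has_derivative F' x) (at x)"
    and F': "continuous_on UNIV (\<lambda>x. F' x (axis i 1))" and \<phi>: "test_fun U \<phi>"
  shows "(\<integral>x. F x * complex_of_real (pd i \<phi> x) \<partial>lebesgue_on U)
       = - (\<integral>x. F' x (axis i 1) * complex_of_real (\<phi> x) \<partial>lebesgue_on U)"
proof -
  obtain K where K: "compact K" "K \<subseteq> U" "\<And>x. x \<notin> K \<Longrightarrow> \<phi> x = 0"
    using \<phi> unfolding test_fun_def by blast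
  have pd0: "x \<notin> K \<Longrightarrow> pd i \<phi> x = 0" for x using pd_eq_0 K compact_imp_closed by blast
  have Um: "U \<in> sets lebesgue" using U by simp
  have cont: "continuous_on UNIV F" "continuous_on UNIV \<phi>" "continuous_on UNIV (pd i \<phi>)"
    using has_derivative_continuous[OF F] smooth_fn_continuous[OF test_fun_smooth]
      \<phi> test_fun_pd[OF \<phi>] by (blast intro: continuous_at_imp_continuous_on)+
  have D: "((\<lambda>x. F x * complex_of_real (\<phi> x)) has_derivative
      (\<lambda>h. F x * complex_of_real (frechet_derivative \<phi> (at x) h) + F' x h * complex_of_real (\<phi> x))) (at x)" for x
    by (intro has_derivative_mult F has_derivative_of_real smooth_fn_has_derivative test_fun_smooth[OF \<phi>])
  have i: "integrable lebesgue (\<lambda>x. F x * complex_of_real (pd i \<phi> x))"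
    "integrable lebesgue (\<lambda>x. F' x (axis i 1) * complex_of_real (\<phi> x))"
    by (rule continuous_compact_support_integrable[OF _ K(1)];
        use cont F' K(3) pd0 in \<open>auto intro!: continuous_intros\<close>)+
  have "(\<integral>x. F x * complex_of_real (pd i \<phi> x) + F' x (axis i 1) * complex_of_real (\<phi> x) \<partial>lebesgue) = 0"
  proof (rule integral_directional_derivative_eq_0[OF _ _ _ K(1)])
    show "((\<lambda>t. F (x + t *\<^sub>R axis i 1) * complex_of_real (\<phi> (x + t *\<^sub>R axis i 1))) has_vector_derivative
       F (x + t *\<^sub>R axis i 1) * complex_of_real (pd i \<phi> (x + t *\<^sub>R axis i 1))
       + F' (x + t *\<^sub>R axis i 1) (axis i 1) * complex_of_real (\<phi> (x + t *\<^sub>R axis i 1))) (at t)" for x t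
      using has_derivative_directional[OF D, of x "axis i 1" t] unfolding pd_def .
  qed (use cont F' K(3) pd0 in \<open>auto intro!: continuous_intros\<close>)
  then have "(\<integral>x. F x * complex_of_real (pd i \<phi> x) \<partial>lebesgue)
       = - (\<integral>x. F' x (axis i 1) * complex_of_real (\<phi> x) \<partial>lebesgue)"
    using i by (simp add: add_eq_0_iff2)
  moreover have "x \<notin> U \<Longrightarrow> \<phi> x = 0 \<and> pd i \<phi> x = 0" for x using K pd0 by blast
  ultimately show ?thesis
    using lebesgue_on_support(1)[OF Um, of "\<lambda>x. F x * complex_of_real (pd i \<phi> x)"]
      lebesgue_on_support(1)[OF Um, of "\<lambda>x. F' x (axis i 1) * complex_of_real (\<phi> x)"] by simp
qed

text \<open>The derivative of \<open>x $ i * (\<phi> x)\<^sup>2\<close> integrates to zero, which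
  expresses the integral of \<phi>^2 through
  \<open>- (2 * x $ i * \<phi> x * pd i \<phi> x)\<close>. Young's inequality gives back half of it,
  to be moved to the left; this produces the constant \<open>4 * R\<^sup>2\<close>.\<close>

lemma poincare_test_fun:
  fixes \<phi> :: "real^'n::finite \<Rightarrow> real"
  assumes U: "open U" "\<And>x. x \<in> U \<Longrightarrow> \<bar>x $ i\<bar> \<le> R" and \<phi>: "test_fun U \<phi>"
  shows "(\<integral>x. (\<phi> x)\<^sup>2 \<partial>lebesgue_on U) \<le> 4 * R\<^sup>2 * (\<integral>x. (pd i \<phi> x)\<^sup>2 \<partial>lebesgue_on U)"
proof -
  obtain K where K: "compact K" "K \<subseteq> U" "\<And>x. x \<notin> K \<Longrightarrow> \<phi> x = 0"
    using \<phi> unfolding test_fun_def by blast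
  have pd0: "x \<notin> K \<Longrightarrow> pd i \<phi> x = 0" for x using pd_eq_0 K compact_imp_closed by blast
  have Um: "U \<in> sets lebesgue" using U by simp
  have cont: "continuous_on UNIV \<phi>" "continuous_on UNIV (pd i \<phi>)"
    using smooth_fn_continuous[OF test_fun_smooth] \<phi> test_fun_pd[OF \<phi>] by blast+
  have i: "integrable lebesgue (\<lambda>x. (\<phi> x)\<^sup>2)" "integrable lebesgue (\<lambda>x. (pd i \<phi> x)\<^sup>2)"
    "integrable lebesgue (\<lambda>x. 2 * x $ i * \<phi> x * pd i \<phi> x)"
    by (rule continuous_compact_support_integrable[OF _ K(1)];
        use cont K(3) pd0 in \<open>auto intro!: continuous_intros\<close>)+
  have D: "((\<lambda>x. x $ i * (\<phi> x)\<^sup>2) has_derivative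
      (\<lambda>h. x $ i * (2 * frechet_derivative \<phi> (at x) h * \<phi> x) + h $ i * (\<phi> x)\<^sup>2)) (at x)" for x
  proof -
    have 1: "((\<lambda>x::real^'n. x $ i) has_derivative (\<lambda>h. h $ i)) (at x)"
      by (intro bounded_linear_imp_has_derivative bounded_linear_vec_nth)
    have 2: "((\<lambda>x. (\<phi> x)\<^sup>2) has_derivative (\<lambda>h. 2 * frechet_derivative \<phi> (at x) h * \<phi> x)) (at x)"
      using has_derivative_power[OF smooth_fn_has_derivative[OF test_fun_smooth[OF \<phi>]], where n=2]
      by (simp add: mult.assoc)
    show ?thesis using has_derivative_mult[OF 1 2] by simp
  qed
  have "(\<integral>x. 2 * x $ i * \<phi> x * pd i \<phi> x + (\<phi> x)\<^sup>2 \<partial>lebesgue) = 0"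
  proof (rule integral_directional_derivative_eq_0[OF _ _ _ K(1)])
    show "((\<lambda>t. (x + t *\<^sub>R axis i 1) $ i * (\<phi> (x + t *\<^sub>R axis i 1))\<^sup>2) has_vector_derivative
       2 * (x + t *\<^sub>R axis i 1) $ i * \<phi> (x + t *\<^sub>R axis i 1) * pd i \<phi> (x + t *\<^sub>R axis i 1)
         + (\<phi> (x + t *\<^sub>R axis i 1))\<^sup>2) (at t)" for x t
      using has_derivative_directional[OF D, of x "axis i 1" t]
      by (simp add: pd_def axis_def algebra_simps)
  qed (use cont K(3) pd0 in \<open>auto intro!: continuous_intros\<close>)
  then have "(\<integral>x. (\<phi> x)\<^sup>2 \<partial>lebesgue) = (\<integral>x. - (2 * x $ i * \<phi> x * pd i \<phi> x) \<partial>lebesgue)"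
    using i by (simp add: add_eq_0_iff)
  also have "\<dots> \<le> (\<integral>x. (\<phi> x)\<^sup>2 / 2 + 2 * R\<^sup>2 * (pd i \<phi> x)\<^sup>2 \<partial>lebesgue)"
  proof (rule integral_mono)
    fix x
    show "- (2 * x $ i * \<phi> x * pd i \<phi> x) \<le> (\<phi> x)\<^sup>2 / 2 + 2 * R\<^sup>2 * (pd i \<phi> x)\<^sup>2"
    proof (cases "x \<in> U")
      case True
      have "0 \<le> (\<phi> x + 2 * x $ i * pd i \<phi> x)\<^sup>2 / 2" by simp
      then have "- (2 * x $ i * \<phi> x * pd i \<phi> x) \<le> (\<phi> x)\<^sup>2 / 2 + 2 * (x $ i)\<^sup>2 * (pd i \<phi> x)\<^sup>2"
        by (simp add: power2_eq_square algebra_simps)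
      also have "(x $ i)\<^sup>2 \<le> R\<^sup>2" using power_mono[OF U(2)[OF True], of 2] by simp
      finally show ?thesis by (simp add: mult_right_mono)
    next
      case False
      then have "\<phi> x = 0" using K(2,3) by blast
      then show ?thesis by simp
    qed
  qed (use i in auto)
  also have "\<dots> = (\<integral>x. (\<phi> x)\<^sup>2 \<partial>lebesgue) / 2 + 2 * R\<^sup>2 * (\<integral>x. (pd i \<phi> x)\<^sup>2 \<partial>lebesgue)"
    using i by simp
  finally have "(\<integral>x. (\<phi> x)\<^sup>2 \<partial>lebesgue) \<le> 4 * R\<^sup>2 * (\<integral>x. (pd i \<phi> x)\<^sup>2 \<partial>lebesgue)" by simp
  moreover have "x \<notin> U \<Longrightarrow> \<phi> x = 0 \<and> pd i \<phi> x = 0" for x using K pd0 by blast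
  ultimately show ?thesis
    using lebesgue_on_support(1)[OF Um, of "\<lambda>x. (\<phi> x)\<^sup>2"]
      lebesgue_on_support(1)[OF Um, of "\<lambda>x. (pd i \<phi> x)\<^sup>2"] by simp
qed

section \<open>Weak gradients\<close>

lemma l2norm_mono_AE:
  fixes f :: "'a \<Rightarrow> 'b::euclidean_space" and g :: "'a \<Rightarrow> 'c::euclidean_space"
  assumes f: "f \<in> borel_measurable M" and g: "square_integrable M g"
    and b: "AE x in M. norm (f x) \<le> K * norm (g x)" and "0 \<le> K"
  shows "l2norm M f \<le> K * l2norm M g"
proof -
  have "(\<integral>x. (norm (f x))\<^sup>2 \<partial>M) \<le> (\<integral>x. K\<^sup>2 * (norm (g x))\<^sup>2 \<partial>M)"
  proof (rule integral_mono_AE)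
    show "integrable M (\<lambda>x. (norm (f x))\<^sup>2)"
      using square_integrable_bounded_image[OF g f b] by (simp add: square_integrable_def)
    show "AE x in M. (norm (f x))\<^sup>2 \<le> K\<^sup>2 * (norm (g x))\<^sup>2"
      using b by eventually_elim (simp add: power_mono flip: power_mult_distrib)
  qed (use g in \<open>simp add: square_integrable_def\<close>)
  then have "l2norm M f \<le> sqrt (K\<^sup>2 * (\<integral>x. (norm (g x))\<^sup>2 \<partial>M))"
    unfolding l2norm_def by (intro real_sqrt_le_mono) simp
  then show ?thesis using \<open>0 \<le> K\<close> by (simp add: l2norm_def real_sqrt_mult)
qed

text \<open>A complex test function is encoded as the pair of its real and imaginary parts.\<close>

definition pfun :: "(real^'n::finite \<Rightarrow> real) \<times> (real^'n \<Rightarrow> real) \<Rightarrow> real^'n \<Rightarrow> complex" where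
  "pfun p x = complex_of_real (fst p x) + \<i> * complex_of_real (snd p x)"

definition pgrad :: "(real^'n::finite \<Rightarrow> real) \<times> (real^'n \<Rightarrow> real) \<Rightarrow> real^'n \<Rightarrow> complex^'n" where
  "pgrad p x = (\<chi> i. complex_of_real (pd i (fst p) x) + \<i> * complex_of_real (pd i (snd p) x))"

definition ptest :: "(real^'n::finite) set \<Rightarrow> ((real^'n \<Rightarrow> real) \<times> (real^'n \<Rightarrow> real)) set" where
  "ptest U = {p. test_fun U (fst p) \<and> test_fun U (snd p)}"

text \<open>Serves as \<open>comb\<close> in \<open>semi_inner_space\<close>; the scalar is real
  because all forms are taken as real bilinear.\<close>

definition pcomb :: "('a \<Rightarrow> real) \<times> ('a \<Rightarrow> real) \<Rightarrow> real \<Rightarrow> ('a \<Rightarrow> real) \<times> ('a \<Rightarrow> real)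
    \<Rightarrow> ('a \<Rightarrow> real) \<times> ('a \<Rightarrow> real)" where
  "pcomb p t q = ((\<lambda>x. fst p x + t * fst q x), (\<lambda>x. snd p x + t * snd q x))"

lemma ptest_pcomb: "p \<in> ptest U \<Longrightarrow> q \<in> ptest U \<Longrightarrow> pcomb p t q \<in> ptest U"
  by (simp add: ptest_def pcomb_def test_fun_combination)

lemma pfun_pcomb: "pfun (pcomb p t q) x = pfun p x + t *\<^sub>R pfun q x"
  by (simp add: pfun_def pcomb_def complex_eq_iff)

lemma pgrad_pcomb:
  "p \<in> ptest U \<Longrightarrow> q \<in> ptest U \<Longrightarrow> pgrad (pcomb p t q) x = pgrad p x + t *\<^sub>R pgrad q x"
  using test_fun_smooth[of U "fst p"] test_fun_smooth[of U "snd p"]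
    test_fun_smooth[of U "fst q"] test_fun_smooth[of U "snd q"]
  by (simp add: pgrad_def pcomb_def vec_eq_iff ptest_def pd_combination complex_eq_iff)

lemma test_fun_square_integrable:
  fixes f :: "real^'n::finite \<Rightarrow> real"
  assumes "test_fun U f" "open U"
  shows "square_integrable (lebesgue_on U) f"
proof -
  obtain K where K: "compact K" "K \<subseteq> U" "\<And>x. x \<notin> K \<Longrightarrow> f x = 0"
    using assms unfolding test_fun_def by blast
  have c: "continuous_on UNIV f" using assms smooth_fn_continuous test_fun_smooth by blast
  have "integrable lebesgue (\<lambda>x. (f x)\<^sup>2)"
    by (rule continuous_compact_support_integrable[OF _ K(1)]) (use c K in \<open>auto intro!: continuous_intros\<close>)
  then have "integrable (lebesgue_on U) (\<lambda>x. (f x)\<^sup>2)"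
    using K assms by (subst lebesgue_on_support(2)) auto
  moreover have "f \<in> borel_measurable (lebesgue_on U)"
    using continuous_imp_lebesgue_measurable[OF c] by (rule measurable_restrict_space1)
  ultimately show ?thesis by (simp add: square_integrable_def)
qed

lemma square_integrable_of_real:
  "square_integrable M f \<Longrightarrow> square_integrable M (\<lambda>x. complex_of_real (f x))"
  by (auto simp: square_integrable_def)

lemma square_integrable_ii_of_real:
  "square_integrable M f \<Longrightarrow> square_integrable M (\<lambda>x. \<i> * complex_of_real (f x))"
  by (auto simp: square_integrable_def norm_mult)

lemma ptest_square_integrable:
  assumes "p \<in> ptest U" "open U"
  shows "square_integrable (lebesgue_on U) (pfun p)" "square_integrable (lebesgue_on U) (pgrad p)"
  using assms
  by (auto simp: pfun_def[abs_def] pgrad_def[abs_def] square_integrable_component ptest_def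
      intro!: square_integrable_add square_integrable_of_real square_integrable_ii_of_real
        test_fun_square_integrable test_fun_pd)

text \<open>For real \<phi> the real and imaginary parts of the complex pairing are the real inner
  products with \<phi> and with i \<phi>. Integrability and convergence of complex integrals thereby
  reduce to \<open>square_integrable_inner\<close> and \<open>l2_tendsto_inner\<close>.\<close>

lemma square_integrable_mult_of_real:
  fixes f :: "'a \<Rightarrow> complex"
  assumes "square_integrable M f" "square_integrable M \<phi>"
  shows "integrable M (\<lambda>x. f x * complex_of_real (\<phi> x))"
    "Re (\<integral>x. f x * complex_of_real (\<phi> x) \<partial>M) = (\<integral>x. f x \<bullet> complex_of_real (\<phi> x) \<partial>M)"
    "Im (\<integral>x. f x * complex_of_real (\<phi> x) \<partial>M) = (\<integral>x. f x \<bullet> (\<i> * complex_of_real (\<phi> x)) \<partial>M)"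
proof -
  have r: "integrable M (\<lambda>x. f x \<bullet> complex_of_real (\<phi> x))"
    and i: "integrable M (\<lambda>x. f x \<bullet> (\<i> * complex_of_real (\<phi> x)))"
    using assms square_integrable_inner square_integrable_of_real square_integrable_ii_of_real by blast+
  have e: "f x * complex_of_real (\<phi> x) = complex_of_real (f x \<bullet> complex_of_real (\<phi> x))
      + \<i> * complex_of_real (f x \<bullet> (\<i> * complex_of_real (\<phi> x)))" for x
    by (simp add: complex_eq_iff inner_complex_def)
  show "integrable M (\<lambda>x. f x * complex_of_real (\<phi> x))"
    unfolding e by (intro Bochner_Integration.integrable_add integrable_mult_right integrable_of_real r i)
  have "(\<integral>x. f x * complex_of_real (\<phi> x) \<partial>M) = complex_of_real (\<integral>x. f x \<bullet> complex_of_real (\<phi> x) \<partial>M)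
      + \<i> * complex_of_real (\<integral>x. f x \<bullet> (\<i> * complex_of_real (\<phi> x)) \<partial>M)"
    unfolding e using r i by simp
  then show "Re (\<integral>x. f x * complex_of_real (\<phi> x) \<partial>M) = (\<integral>x. f x \<bullet> complex_of_real (\<phi> x) \<partial>M)"
    "Im (\<integral>x. f x * complex_of_real (\<phi> x) \<partial>M) = (\<integral>x. f x \<bullet> (\<i> * complex_of_real (\<phi> x)) \<partial>M)"
    by simp_all
qed

lemma l2_tendsto_mult_of_real:
  fixes f :: "nat \<Rightarrow> 'a \<Rightarrow> complex"
  assumes f: "\<And>k. square_integrable M (f k)" "square_integrable M h" and \<phi>: "square_integrable M \<phi>"
    and lim: "(\<lambda>k. l2norm M (\<lambda>x. f k x - h x)) \<longlonglongrightarrow> 0"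
  shows "(\<lambda>k. \<integral>x. f k x * complex_of_real (\<phi> x) \<partial>M) \<longlonglongrightarrow> (\<integral>x. h x * complex_of_real (\<phi> x) \<partial>M)"
  unfolding tendsto_complex_iff square_integrable_mult_of_real(2,3)[OF f(1) \<phi>]
    square_integrable_mult_of_real(2,3)[OF f(2) \<phi>]
  using l2_tendsto_inner[OF f square_integrable_of_real[OF \<phi>] lim]
    l2_tendsto_inner[OF f square_integrable_ii_of_real[OF \<phi>] lim] by blast

lemma H1_iff:
  "H1 U u Du \<longleftrightarrow> square_integrable (lebesgue_on U) u \<and> square_integrable (lebesgue_on U) Du \<and>
     (\<forall>\<phi> i. test_fun U \<phi> \<longrightarrow>
        (\<integral>x. u x * complex_of_real (pd i \<phi> x) \<partial>lebesgue_on U)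
          = - (\<integral>x. Du x $ i * complex_of_real (\<phi> x) \<partial>lebesgue_on U))"
  unfolding H1_def L2_def square_integrable_component[of _ Du]
  by (simp add: square_integrable_def)

lemma H1_combination:
  assumes U: "open U" and u: "H1 U u Du" and v: "H1 U v Dv"
  shows "H1 U (\<lambda>x. u x + t *\<^sub>R v x) (\<lambda>x. Du x + t *\<^sub>R Dv x)"
  unfolding H1_iff
proof (intro conjI allI impI)
  fix \<phi> i assume \<phi>: "test_fun U \<phi>"
  let ?M = "lebesgue_on U"
  note s = test_fun_square_integrable[OF \<phi> U] test_fun_square_integrable[OF test_fun_pd[OF \<phi>] U, of i]
  have c: "square_integrable ?M (\<lambda>x. Du x $ i)" "square_integrable ?M (\<lambda>x. Dv x $ i)"
    using u v by (auto simp: H1_iff square_integrable_component)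
  have "(\<integral>x. (u x + t *\<^sub>R v x) * complex_of_real (pd i \<phi> x) \<partial>?M)
      = (\<integral>x. u x * complex_of_real (pd i \<phi> x) \<partial>?M) + t *\<^sub>R (\<integral>x. v x * complex_of_real (pd i \<phi> x) \<partial>?M)"
    using u v s by (simp add: H1_iff square_integrable_mult_of_real(1) distrib_right)
  moreover have "(\<integral>x. (Du x + t *\<^sub>R Dv x) $ i * complex_of_real (\<phi> x) \<partial>?M)
      = (\<integral>x. Du x $ i * complex_of_real (\<phi> x) \<partial>?M) + t *\<^sub>R (\<integral>x. Dv x $ i * complex_of_real (\<phi> x) \<partial>?M)"
    using c s by (simp add: square_integrable_mult_of_real(1) distrib_right)
  ultimately show "(\<integral>x. (u x + t *\<^sub>R v x) * complex_of_real (pd i \<phi> x) \<partial>?M)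
      = - (\<integral>x. (Du x + t *\<^sub>R Dv x) $ i * complex_of_real (\<phi> x) \<partial>?M)"
    using u v \<phi> by (simp add: H1_iff)
qed (use u v in \<open>auto simp: H1_iff intro: square_integrable_combination\<close>)

text \<open>The difference of two weak gradients integrates to zero against every test function.
  This reconciles the gradient hidden in \<open>H10\<close> with the one carried by a weak
  solution.\<close>

lemma weak_gradient_unique:
  fixes u :: "real^'n::finite \<Rightarrow> complex"
  assumes U: "open U" "finite_measure (lebesgue_on U)" and u: "H1 U u D1" "H1 U u D2"
  shows "AE x in lebesgue_on U. D1 x = D2 x"
proof -
  let ?M = "lebesgue_on U"
  have "AE x in ?M. (D1 x - D2 x) $ i = 0" for i
  proof (rule fundamental_lemma_of_variations[OF U(1)])
    have c: "square_integrable ?M (\<lambda>x. D1 x $ i)" "square_integrable ?M (\<lambda>x. D2 x $ i)"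
      using u by (auto simp: H1_iff square_integrable_component)
    then show "integrable ?M (\<lambda>x. (D1 x - D2 x) $ i)"
      using finite_measure.square_integrable_imp_integrable(1)[OF U(2) square_integrable_diff[OF c]] by simp
    fix \<phi> assume \<phi>: "test_fun U \<phi>"
    have "(\<integral>x. D1 x $ i * complex_of_real (\<phi> x) \<partial>?M) = (\<integral>x. D2 x $ i * complex_of_real (\<phi> x) \<partial>?M)"
    proof -
      have "(\<integral>x. u x * complex_of_real (pd i \<phi> x) \<partial>?M) = - (\<integral>x. D1 x $ i * complex_of_real (\<phi> x) \<partial>?M)"
        "(\<integral>x. u x * complex_of_real (pd i \<phi> x) \<partial>?M) = - (\<integral>x. D2 x $ i * complex_of_real (\<phi> x) \<partial>?M)"
        using u \<phi> unfolding H1_iff by blast+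
      then show ?thesis by simp
    qed
    then show "(\<integral>x. \<phi> x *\<^sub>R (D1 x - D2 x) $ i \<partial>?M) = 0"
      using square_integrable_mult_of_real(1)[OF _ test_fun_square_integrable[OF \<phi> U(1)]] c
      by (simp add: scaleR_conv_of_real mult.commute[of "complex_of_real _"] left_diff_distrib)
  qed
  then have "AE x in ?M. \<forall>i. (D1 x - D2 x) $ i = 0" by (simp add: AE_all_countable)
  then show ?thesis by eventually_elim (simp add: vec_eq_iff)
qed

text \<open>The integrand in \<open>H10\<close> is a sum of two squared norms, so its single limit
  splits into an L2 limit of functions and one of gradients.\<close>

lemma H10_iff:
  fixes U :: "(real^'n::finite) set"
  assumes "open U"
  shows "H10 U w \<longleftrightarrow> (\<exists>Dw p. H1 U w Dw \<and> (\<forall>k. p k \<in> ptest U) \<and>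
     (\<lambda>k. l2norm (lebesgue_on U) (\<lambda>x. pfun (p k) x - w x)) \<longlonglongrightarrow> 0 \<and>
     (\<lambda>k. l2norm (lebesgue_on U) (\<lambda>x. pgrad (p k) x - Dw x)) \<longlonglongrightarrow> 0)"
proof -
  let ?M = "lebesgue_on U"
  have split: "(\<integral>x. (norm (w x - (complex_of_real (a x) + \<i> * complex_of_real (b x))))\<^sup>2
                 + (\<Sum>i\<in>UNIV. (norm (Dw x $ i - (complex_of_real (pd i a x)
                                  + \<i> * complex_of_real (pd i b x))))\<^sup>2) \<partial>?M)
     = (l2norm ?M (\<lambda>x. pfun (a, b) x - w x))\<^sup>2 + (l2norm ?M (\<lambda>x. pgrad (a, b) x - Dw x))\<^sup>2"
    if H: "H1 U w Dw" and ab: "(a, b) \<in> ptest U" for Dw a b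
  proof -
    have "square_integrable ?M (\<lambda>x. pfun (a, b) x - w x)" "square_integrable ?M (\<lambda>x. pgrad (a, b) x - Dw x)"
      using H ptest_square_integrable[OF ab assms] by (auto simp: H1_iff intro!: square_integrable_diff)
    then have i: "integrable ?M (\<lambda>x. (norm (pfun (a, b) x - w x))\<^sup>2)"
      "integrable ?M (\<lambda>x. (norm (pgrad (a, b) x - Dw x))\<^sup>2)" by (auto simp: square_integrable_def)
    have "(norm (w x - (complex_of_real (a x) + \<i> * complex_of_real (b x))))\<^sup>2
                 + (\<Sum>i\<in>UNIV. (norm (Dw x $ i - (complex_of_real (pd i a x)
                                  + \<i> * complex_of_real (pd i b x))))\<^sup>2)
      = (norm (pfun (a, b) x - w x))\<^sup>2 + (norm (pgrad (a, b) x - Dw x))\<^sup>2" for x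
      by (simp add: pfun_def pgrad_def norm_vec_def L2_set_def sum_nonneg norm_minus_commute)
    then show ?thesis using i by (simp add: l2norm_square)
  qed
  have squeeze: "(\<lambda>k. (f k)\<^sup>2 + (g k)\<^sup>2) \<longlonglongrightarrow> 0 \<longleftrightarrow> f \<longlonglongrightarrow> 0 \<and> g \<longlonglongrightarrow> 0"
    for f g :: "nat \<Rightarrow> real"
  proof
    assume l: "(\<lambda>k. (f k)\<^sup>2 + (g k)\<^sup>2) \<longlonglongrightarrow> 0"
    have "(\<lambda>k. sqrt ((f k)\<^sup>2 + (g k)\<^sup>2)) \<longlonglongrightarrow> 0" using tendsto_real_sqrt[OF l] by simp
    then show "f \<longlonglongrightarrow> 0 \<and> g \<longlonglongrightarrow> 0"
      by (intro conjI; rule Lim_null_comparison[rotated]) (auto intro!: always_eventually)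
  next
    assume "f \<longlonglongrightarrow> 0 \<and> g \<longlonglongrightarrow> 0"
    then have "(\<lambda>k. (f k)\<^sup>2 + (g k)\<^sup>2) \<longlonglongrightarrow> 0\<^sup>2 + 0\<^sup>2" by (intro tendsto_intros) auto
    then show "(\<lambda>k. (f k)\<^sup>2 + (g k)\<^sup>2) \<longlonglongrightarrow> 0" by simp
  qed
  show ?thesis
  proof
    assume "H10 U w"
    then obtain Dw a b where H: "H1 U w Dw" and ab: "\<And>k. (a k, b k) \<in> ptest U"
      and l: "(\<lambda>k. (\<integral>x. (norm (w x - (complex_of_real (a k x) + \<i> * complex_of_real (b k x))))\<^sup>2
                 + (\<Sum>i\<in>UNIV. (norm (Dw x $ i - (complex_of_real (pd i (a k) x)
                                  + \<i> * complex_of_real (pd i (b k) x))))\<^sup>2) \<partial>?M)) \<longlonglongrightarrow> 0"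
      unfolding H10_def ptest_def by auto
    show "\<exists>Dw p. H1 U w Dw \<and> (\<forall>k. p k \<in> ptest U) \<and>
     (\<lambda>k. l2norm ?M (\<lambda>x. pfun (p k) x - w x)) \<longlonglongrightarrow> 0 \<and> (\<lambda>k. l2norm ?M (\<lambda>x. pgrad (p k) x - Dw x)) \<longlonglongrightarrow> 0"
      by (rule exI[of _ Dw], rule exI[of _ "\<lambda>k. (a k, b k)"])
        (use H ab l[unfolded split[OF H ab] squeeze] in simp)
  next
    assume "\<exists>Dw p. H1 U w Dw \<and> (\<forall>k. p k \<in> ptest U) \<and>
     (\<lambda>k. l2norm ?M (\<lambda>x. pfun (p k) x - w x)) \<longlonglongrightarrow> 0 \<and> (\<lambda>k. l2norm ?M (\<lambda>x. pgrad (p k) x - Dw x)) \<longlonglongrightarrow> 0"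
    then obtain Dw p where H: "H1 U w Dw" and p: "\<And>k. p k \<in> ptest U"
     and l: "(\<lambda>k. l2norm ?M (\<lambda>x. pfun (p k) x - w x)) \<longlonglongrightarrow> 0" "(\<lambda>k. l2norm ?M (\<lambda>x. pgrad (p k) x - Dw x)) \<longlonglongrightarrow> 0"
      by blast
    have p': "(fst (p k), snd (p k)) \<in> ptest U" for k using p by simp
    show "H10 U w" unfolding H10_def
      by (rule exI[of _ Dw], rule exI[of _ "\<lambda>k. fst (p k)"], rule exI[of _ "\<lambda>k. snd (p k)"])
        (use H p in \<open>simp add: split[OF H p'] squeeze l\<close>, simp add: ptest_def)
  qed
qed

section \<open>Weak solutions of elliptic equations\<close>

text \<open>In the real inner product, pairing Z with the gradient of a + i b picks the real part of
  Z tested with a and the imaginary part of Z tested with b.\<close>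

lemma ptest_weak_form:
  fixes Z :: "real^'n::finite \<Rightarrow> complex^'n"
  assumes U: "open U" and Z: "square_integrable (lebesgue_on U) Z" and p: "p \<in> ptest U"
  shows "(\<integral>x. Z x \<bullet> pgrad p x \<partial>lebesgue_on U)
    = Re (\<integral>x. (\<Sum>i\<in>UNIV. Z x $ i * complex_of_real (pd i (fst p) x)) \<partial>lebesgue_on U)
      + Im (\<integral>x. (\<Sum>i\<in>UNIV. Z x $ i * complex_of_real (pd i (snd p) x)) \<partial>lebesgue_on U)"
proof -
  let ?M = "lebesgue_on U"
  have z: "square_integrable ?M (\<lambda>x. Z x $ i)" for i using Z by (simp add: square_integrable_component)
  have ab: "square_integrable ?M (pd i (fst p))" "square_integrable ?M (pd i (snd p))" for i
    using p by (auto simp: ptest_def intro!: test_fun_square_integrable test_fun_pd U)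
  have i: "integrable ?M (\<lambda>x. Z x $ i \<bullet> complex_of_real (pd i (fst p) x))"
    "integrable ?M (\<lambda>x. Z x $ i \<bullet> (\<i> * complex_of_real (pd i (snd p) x)))" for i
    by (intro square_integrable_inner z square_integrable_of_real square_integrable_ii_of_real ab)+
  have "(\<integral>x. Z x \<bullet> pgrad p x \<partial>?M) = (\<integral>x. (\<Sum>i\<in>UNIV. Z x $ i \<bullet> complex_of_real (pd i (fst p) x)
      + Z x $ i \<bullet> (\<i> * complex_of_real (pd i (snd p) x))) \<partial>?M)"
    by (simp add: inner_vec_def pgrad_def inner_add_right)
  also have "\<dots> = (\<Sum>i\<in>UNIV. (\<integral>x. Z x $ i \<bullet> complex_of_real (pd i (fst p) x) \<partial>?M))
      + (\<Sum>i\<in>UNIV. (\<integral>x. Z x $ i \<bullet> (\<i> * complex_of_real (pd i (snd p) x)) \<partial>?M))"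
    using i by (simp add: sum.distrib)
  finally show ?thesis
    using square_integrable_mult_of_real[OF z ab(1)] square_integrable_mult_of_real[OF z ab(2)]
    by simp
qed

text \<open>A complex equation with real test functions is traded for a real one with complex test
  functions; the pairs (\<phi>, 0) and (0, \<phi>) recover the real and the imaginary part.\<close>

lemma weak_equation_iff:
  fixes Z :: "real^'n::finite \<Rightarrow> complex^'n"
  assumes U: "open U" and Z: "square_integrable (lebesgue_on U) Z"
  shows "(\<forall>\<phi>. test_fun U \<phi> \<longrightarrow>
      (\<integral>x. (\<Sum>i\<in>UNIV. Z x $ i * complex_of_real (pd i \<phi> x)) \<partial>lebesgue_on U) = 0)
    \<longleftrightarrow> (\<forall>p\<in>ptest U. (\<integral>x. Z x \<bullet> pgrad p x \<partial>lebesgue_on U) = 0)"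
proof (intro iffI ballI allI impI)
  fix p assume "\<forall>\<phi>. test_fun U \<phi> \<longrightarrow>
      (\<integral>x. (\<Sum>i\<in>UNIV. Z x $ i * complex_of_real (pd i \<phi> x)) \<partial>lebesgue_on U) = 0" "p \<in> ptest U"
  then show "(\<integral>x. Z x \<bullet> pgrad p x \<partial>lebesgue_on U) = 0"
    by (subst ptest_weak_form[OF U Z]) (auto simp: ptest_def)
next
  fix \<phi> assume a: "\<forall>p\<in>ptest U. (\<integral>x. Z x \<bullet> pgrad p x \<partial>lebesgue_on U) = 0" and \<phi>: "test_fun U \<phi>"
  have p: "(\<phi>, \<lambda>x. 0) \<in> ptest U" "(\<lambda>x. 0, \<phi>) \<in> ptest U" using \<phi> by (auto simp: ptest_def test_fun_zero)
  have "pd i (\<lambda>x. 0) = (\<lambda>x::real^'n. 0::real)" for i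
    by (rule ext) (rule has_derivative_imp_pd[OF has_derivative_const])
  then show "(\<integral>x. (\<Sum>i\<in>UNIV. Z x $ i * complex_of_real (pd i \<phi> x)) \<partial>lebesgue_on U) = 0"
    using ptest_weak_form[OF U Z p(1)] ptest_weak_form[OF U Z p(2)] a p
    by (simp add: complex_eq_iff)
qed

lemma poincare_ptest:
  fixes U :: "(real^'n::finite) set"
  assumes "open U" "bounded U"
  obtains C where "0 \<le> C" "\<And>p. p \<in> ptest U \<Longrightarrow>
    l2norm (lebesgue_on U) (pfun p) \<le> C * l2norm (lebesgue_on U) (pgrad p)"
proof -
  let ?M = "lebesgue_on U"
  \<comment> \<open>Any coordinate serves, as the set is bounded in each direction.\<close>
  fix i :: 'n
  obtain R where R: "\<And>x. x \<in> U \<Longrightarrow> norm x \<le> R" "0 < R" using assms(2) bounded_pos by metis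
  have R': "\<bar>x $ i\<bar> \<le> R" if "x \<in> U" for x using R(1)[OF that] component_le_norm_cart[of x i] by linarith
  have "l2norm ?M (pfun p) \<le> (2 * R) * l2norm ?M (pgrad p)" if p: "p \<in> ptest U" for p
  proof -
    have t: "test_fun U (fst p)" "test_fun U (snd p)" using p by (auto simp: ptest_def)
    have si: "integrable ?M (\<lambda>x. (f x)\<^sup>2)" if "test_fun U f" for f
      using test_fun_square_integrable[OF that assms(1)] by (simp add: square_integrable_def)
    note i = si[OF t(1)] si[OF t(2)] si[OF test_fun_pd[OF t(1)], of i] si[OF test_fun_pd[OF t(2)], of i]
    have nrm: "(norm (complex_of_real a + \<i> * complex_of_real b))\<^sup>2 = a\<^sup>2 + b\<^sup>2" for a b
      by (simp add: cmod_def)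
    have "(\<integral>x. (norm (pfun p x))\<^sup>2 \<partial>?M) = (\<integral>x. (fst p x)\<^sup>2 \<partial>?M) + (\<integral>x. (snd p x)\<^sup>2 \<partial>?M)"
      using i by (simp add: pfun_def nrm)
    also have "\<dots> \<le> 4 * R\<^sup>2 * (\<integral>x. (pd i (fst p) x)\<^sup>2 \<partial>?M) + 4 * R\<^sup>2 * (\<integral>x. (pd i (snd p) x)\<^sup>2 \<partial>?M)"
      by (intro add_mono poincare_test_fun assms t R')
    also have "\<dots> = 4 * R\<^sup>2 * (\<integral>x. (pd i (fst p) x)\<^sup>2 + (pd i (snd p) x)\<^sup>2 \<partial>?M)"
      using i by (simp add: distrib_left)
    also have "\<dots> \<le> 4 * R\<^sup>2 * (\<integral>x. (norm (pgrad p x))\<^sup>2 \<partial>?M)"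
    proof (intro mult_left_mono integral_mono)
      fix x
      have "(pd i (fst p) x)\<^sup>2 + (pd i (snd p) x)\<^sup>2 = (norm (pgrad p x $ i))\<^sup>2"
        by (simp add: pgrad_def nrm)
      also have "\<dots> \<le> (norm (pgrad p x))\<^sup>2" by (intro power_mono Finite_Cartesian_Product.norm_nth_le) simp
      finally show "(pd i (fst p) x)\<^sup>2 + (pd i (snd p) x)\<^sup>2 \<le> (norm (pgrad p x))\<^sup>2" .
    qed (use i ptest_square_integrable[OF p assms(1)] in \<open>auto simp: square_integrable_def\<close>)
    finally have "l2norm ?M (pfun p) \<le> sqrt (4 * R\<^sup>2 * (\<integral>x. (norm (pgrad p x))\<^sup>2 \<partial>?M))"
      unfolding l2norm_def by simp
    then show ?thesis using R(2) by (simp add: l2norm_def real_sqrt_mult)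
  qed
  then show thesis using that[of "2 * R"] R(2) by auto
qed

lemma H1_pfun:
  assumes "open U" "p \<in> ptest U"
  shows "H1 U (pfun p) (pgrad p)"
  unfolding H1_iff
proof (intro conjI allI impI ptest_square_integrable assms)
  fix \<phi> i assume \<phi>: "test_fun U \<phi>"
  have s: "smooth_fn (fst p)" "smooth_fn (snd p)" using assms(2) test_fun_smooth by (auto simp: ptest_def)
  define F' where "F' x h = complex_of_real (frechet_derivative (fst p) (at x) h)
      + \<i> * complex_of_real (frechet_derivative (snd p) (at x) h)" for x h
  have F': "F' x (axis i 1) = pgrad p x $ i" for x by (simp add: F'_def pgrad_def pd_def)
  have "(pfun p has_derivative F' x) (at x)" for x
    unfolding pfun_def[abs_def] F'_def
    by (intro has_derivative_add has_derivative_mult_right has_derivative_of_real smooth_fn_has_derivative s)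
  moreover have "continuous_on UNIV (\<lambda>x. F' x (axis i 1))"
    unfolding F'
    by (auto simp: pgrad_def intro!: continuous_intros smooth_fn_continuous[OF smooth_fn_pd] s)
  ultimately show "(\<integral>x. pfun p x * complex_of_real (pd i \<phi> x) \<partial>lebesgue_on U)
      = - (\<integral>x. pgrad p x $ i * complex_of_real (\<phi> x) \<partial>lebesgue_on U)"
    using integral_by_parts_test_fun[OF assms(1) _ _ \<phi>, of "pfun p" F' i] by (simp add: F')
qed

text \<open>Weak differentiation is a closed operation: for a fixed test function both sides of the
  defining identity are continuous in the L2 norm.\<close>

lemma H1_limit:
  assumes U: "open U" and H: "\<And>k. H1 U (f k) (Df k)"
    and w: "square_integrable (lebesgue_on U) w" "square_integrable (lebesgue_on U) Dw"
    and lim: "(\<lambda>k. l2norm (lebesgue_on U) (\<lambda>x. f k x - w x)) \<longlonglongrightarrow> 0"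
      "(\<lambda>k. l2norm (lebesgue_on U) (\<lambda>x. Df k x - Dw x)) \<longlonglongrightarrow> 0"
  shows "H1 U w Dw"
  unfolding H1_iff
proof (intro conjI allI impI w)
  let ?M = "lebesgue_on U"
  fix \<phi> i assume \<phi>: "test_fun U \<phi>"
  have s: "square_integrable ?M (f k)" "square_integrable ?M (Df k)" "square_integrable ?M (\<lambda>x. Df k x $ i)"
    "square_integrable ?M (\<lambda>x. Dw x $ i)" for k
    using H w(2) by (auto simp: H1_iff square_integrable_component)
  have l: "(\<lambda>k. l2norm ?M (\<lambda>x. Df k x $ i - Dw x $ i)) \<longlonglongrightarrow> 0"
  proof (rule Lim_null_comparison[OF always_eventually lim(2)], rule allI)
    fix k
    have "l2norm ?M (\<lambda>x. Df k x $ i - Dw x $ i) \<le> 1 * l2norm ?M (\<lambda>x. Df k x - Dw x)"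
    proof (rule l2norm_mono_AE)
      show "(\<lambda>x. Df k x $ i - Dw x $ i) \<in> borel_measurable ?M"
        using square_integrable_diff[OF s(3,4)] by (simp add: square_integrable_def)
      show "AE x in ?M. norm (Df k x $ i - Dw x $ i) \<le> 1 * norm (Df k x - Dw x)"
        using Finite_Cartesian_Product.norm_nth_le[of "Df k _ - Dw _" i] by simp
    qed (use square_integrable_diff[OF s(2) w(2)] in auto)
    then show "norm (l2norm ?M (\<lambda>x. Df k x $ i - Dw x $ i)) \<le> l2norm ?M (\<lambda>x. Df k x - Dw x)"
      by (simp add: l2norm_nonneg)
  qed
  have "(\<lambda>k. - (\<integral>x. Df k x $ i * complex_of_real (\<phi> x) \<partial>?M))
      \<longlonglongrightarrow> - (\<integral>x. Dw x $ i * complex_of_real (\<phi> x) \<partial>?M)"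
    by (intro tendsto_minus l2_tendsto_mult_of_real s l test_fun_square_integrable[OF \<phi> U])
  moreover have "(\<lambda>k. \<integral>x. f k x * complex_of_real (pd i \<phi> x) \<partial>?M)
      \<longlonglongrightarrow> (\<integral>x. w x * complex_of_real (pd i \<phi> x) \<partial>?M)"
    by (intro l2_tendsto_mult_of_real s w lim test_fun_square_integrable[OF test_fun_pd[OF \<phi>] U])
  moreover have "(\<integral>x. f k x * complex_of_real (pd i \<phi> x) \<partial>?M)
      = - (\<integral>x. Df k x $ i * complex_of_real (\<phi> x) \<partial>?M)" for k
    using H[of k] \<phi> unfolding H1_iff by blast
  ultimately show "(\<integral>x. w x * complex_of_real (pd i \<phi> x) \<partial>?M) = - (\<integral>x. Dw x $ i * complex_of_real (\<phi> x) \<partial>?M)"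
    using LIMSEQ_unique by fastforce
qed

lemma finite_measure_lebesgue_on_bounded:
  fixes U :: "'a::euclidean_space set"
  assumes "open U" "bounded U"
  shows "finite_measure (lebesgue_on U)"
  by (intro finite_measure_lebesgue_on lmeasurable_open assms)

text \<open>Orthogonality passes to the limit along test functions approximating \<open>w\<close>.
  The gradient supplied by \<open>H10\<close> agrees with \<open>Dw\<close> almost everywhere, and
  the integral sees no more than that.\<close>

lemma H10_gradient_orthogonal:
  assumes U: "open U" "bounded U" and "H10 U w" "H1 U w Dw" and P: "square_integrable (lebesgue_on U) P"
    and orth: "\<And>p. p \<in> ptest U \<Longrightarrow> (\<integral>x. P x \<bullet> pgrad p x \<partial>lebesgue_on U) = 0"
  shows "(\<integral>x. P x \<bullet> Dw x \<partial>lebesgue_on U) = 0"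
proof -
  let ?M = "lebesgue_on U"
  obtain Dw' p where H: "H1 U w Dw'" "\<And>k. p k \<in> ptest U"
      "(\<lambda>k. l2norm ?M (\<lambda>x. pgrad (p k) x - Dw' x)) \<longlonglongrightarrow> 0"
    using \<open>H10 U w\<close> H10_iff[OF U(1)] by blast
  have "(\<lambda>k. \<integral>x. pgrad (p k) x \<bullet> P x \<partial>?M) \<longlonglongrightarrow> (\<integral>x. Dw' x \<bullet> P x \<partial>?M)"
    by (rule l2_tendsto_inner[OF _ _ P H(3)])
      (use H ptest_square_integrable[OF H(2) U(1)] in \<open>auto simp: H1_iff\<close>)
  moreover have "(\<integral>x. pgrad (p k) x \<bullet> P x \<partial>?M) = 0" for k
    using orth[OF H(2)] by (simp add: inner_commute)
  ultimately have "(\<integral>x. Dw' x \<bullet> P x \<partial>?M) = 0" by (simp add: LIMSEQ_const_iff)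
  moreover have "(\<integral>x. P x \<bullet> Dw x \<partial>?M) = (\<integral>x. Dw' x \<bullet> P x \<partial>?M)"
  proof (rule integral_cong_AE)
    show "(\<lambda>x. P x \<bullet> Dw x) \<in> borel_measurable ?M" "(\<lambda>x. Dw' x \<bullet> P x) \<in> borel_measurable ?M"
      using P H(1) \<open>H1 U w Dw\<close> by (auto simp: H1_iff square_integrable_def intro!: borel_measurable_inner)
    show "AE x in ?M. P x \<bullet> Dw x = Dw' x \<bullet> P x"
      using weak_gradient_unique[OF U(1) finite_measure_lebesgue_on_bounded[OF U] \<open>H1 U w Dw\<close> H(1)]
      by eventually_elim (simp add: inner_commute)
  qed
  ultimately show ?thesis by simp
qed

text \<open>With the real inner product on complex vectors, \<open>coercive\<close> speaks of the
  real part of the sesquilinear form. The inequality \<open>c \<le> K\<close> keeps the radicand of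
  the contraction factor in \<open>scaled_contraction\<close> nonnegative.\<close>

locale elliptic =
  fixes U :: "(real^'n::finite) set" and A :: "real^'n \<Rightarrow> complex^'n^'n" and K c :: real
  assumes U: "open U" "bounded U"
    and meas: "\<And>i j. (\<lambda>x. A x $ i $ j) \<in> borel_measurable (lebesgue_on U)"
    and bound: "AE x in lebesgue_on U. \<forall>z. norm (A x *v z) \<le> K * norm z"
    and coercive: "AE x in lebesgue_on U. \<forall>z. c * (norm z)\<^sup>2 \<le> (A x *v z) \<bullet> z"
    and cK: "0 < c" "c \<le> K"
begin

abbreviation \<mu> where "\<mu> \<equiv> lebesgue_on U"

lemma square_integrable_A:
  assumes "square_integrable \<mu> f"
  shows "square_integrable \<mu> (\<lambda>x. A x *v f x)" "l2norm \<mu> (\<lambda>x. A x *v f x) \<le> K * l2norm \<mu> f"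
proof -
  have f: "(\<lambda>x. f x $ j) \<in> borel_measurable \<mu>" for j
    using assms by (simp add: square_integrable_def borel_measurable_vec_iff[of f])
  have m: "(\<lambda>x. A x *v f x) \<in> borel_measurable \<mu>"
    unfolding borel_measurable_vec_iff matrix_vector_mult_def
    using meas f by (auto intro!: borel_measurable_sum borel_measurable_times)
  have b: "AE x in \<mu>. norm (A x *v f x) \<le> K * norm (f x)" using bound by eventually_elim simp
  show "square_integrable \<mu> (\<lambda>x. A x *v f x)" by (rule square_integrable_bounded_image[OF assms m b])
  show "l2norm \<mu> (\<lambda>x. A x *v f x) \<le> K * l2norm \<mu> f"
    by (rule l2norm_mono_AE[OF m assms b]) (use cK in simp)
qed

lemma weak_sol_iff:
  "weak_sol U A F u Du \<longleftrightarrow> H1 U u Du \<and> H10 U (\<lambda>x. u x - F x) \<and>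
     (\<forall>p\<in>ptest U. (\<integral>x. (A x *v Du x) \<bullet> pgrad p x \<partial>\<mu>) = 0)"
proof -
  have "square_integrable \<mu> (\<lambda>x. A x *v Du x)" if "H1 U u Du"
    using that square_integrable_A by (simp add: H1_iff)
  from weak_equation_iff[OF U(1) this] show ?thesis
    unfolding weak_sol_def by (auto simp: matrix_vector_mult_def)
qed

text \<open>The difference u - F lies in \<open>H10\<close>, whose gradients are limits of test
  gradients. With A Du in the role of \<open>P\<close> this is the equation tested with the
  corrector.\<close>

lemma weak_sol_orthogonal:
  assumes "weak_sol U A F u Du" "H1 U F DF" "square_integrable \<mu> P"
    "\<And>p. p \<in> ptest U \<Longrightarrow> (\<integral>x. P x \<bullet> pgrad p x \<partial>\<mu>) = 0"
  shows "(\<integral>x. P x \<bullet> (Du x - DF x) \<partial>\<mu>) = 0"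
proof (rule H10_gradient_orthogonal[OF U _ _ assms(3,4)])
  show "H10 U (\<lambda>x. u x - F x)" using assms(1) by (simp add: weak_sol_iff)
  show "H1 U (\<lambda>x. u x - F x) (\<lambda>x. Du x - DF x)"
    using H1_combination[OF U(1) _ assms(2), of u Du "-1"] assms(1) by (simp add: weak_sol_iff)
qed

text \<open>The field A (Du - Du') is orthogonal to test gradients, hence to Du - DF and to Du' -
  DF, hence to their difference; coercivity makes this difference vanish.\<close>

lemma weak_sol_gradient_unique:
  assumes "weak_sol U A F u Du" "weak_sol U A F u' Du'" "H1 U F DF"
  shows "AE x in \<mu>. Du x = Du' x"
proof -
  define P where "P x = A x *v (Du x - Du' x)" for x
  have s: "square_integrable \<mu> Du" "square_integrable \<mu> Du'" "square_integrable \<mu> DF"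
    using assms by (auto simp: weak_sol_iff H1_iff)
  have P: "square_integrable \<mu> P"
    unfolding P_def by (intro square_integrable_A square_integrable_diff s)
  have o: "(\<integral>x. P x \<bullet> pgrad p x \<partial>\<mu>) = 0" if p: "p \<in> ptest U" for p
  proof -
    have "(\<integral>x. P x \<bullet> pgrad p x \<partial>\<mu>)
        = (\<integral>x. (A x *v Du x) \<bullet> pgrad p x \<partial>\<mu>) - (\<integral>x. (A x *v Du' x) \<bullet> pgrad p x \<partial>\<mu>)"
      using square_integrable_inner[OF square_integrable_A(1)[OF s(1)] ptest_square_integrable(2)[OF p U(1)]]
        square_integrable_inner[OF square_integrable_A(1)[OF s(2)] ptest_square_integrable(2)[OF p U(1)]]
      by (simp add: P_def matrix_vector_mult_diff_distrib inner_diff_left)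
    then show ?thesis using assms(1,2) p by (simp add: weak_sol_iff)
  qed
  have "(\<integral>x. P x \<bullet> (Du x - DF x) - P x \<bullet> (Du' x - DF x) \<partial>\<mu>) = 0"
    using weak_sol_orthogonal[OF assms(1,3) P o] weak_sol_orthogonal[OF assms(2,3) P o]
      square_integrable_inner[OF P square_integrable_diff[OF s(1,3)]]
      square_integrable_inner[OF P square_integrable_diff[OF s(2,3)]] by simp
  then have z: "(\<integral>x. P x \<bullet> (Du x - Du' x) \<partial>\<mu>) = 0" by (simp flip: inner_diff_right)
  have i: "integrable \<mu> (\<lambda>x. (norm (Du x - Du' x))\<^sup>2)"
    using square_integrable_diff[OF s(1,2)] by (simp add: square_integrable_def)
  have "(\<integral>x. c * (norm (Du x - Du' x))\<^sup>2 \<partial>\<mu>) \<le> (\<integral>x. P x \<bullet> (Du x - Du' x) \<partial>\<mu>)"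
  proof (rule integral_mono_AE)
    show "AE x in \<mu>. c * (norm (Du x - Du' x))\<^sup>2 \<le> P x \<bullet> (Du x - Du' x)"
      using coercive unfolding P_def by eventually_elim simp
  qed (use i square_integrable_inner[OF P square_integrable_diff[OF s(1,2)]] in auto)
  then have "c * (\<integral>x. (norm (Du x - Du' x))\<^sup>2 \<partial>\<mu>) \<le> 0" using z by simp
  then have "(\<integral>x. (norm (Du x - Du' x))\<^sup>2 \<partial>\<mu>) \<le> 0" using cK by (simp add: mult_le_0_iff)
  moreover have "0 \<le> (\<integral>x. (norm (Du x - Du' x))\<^sup>2 \<partial>\<mu>)" by simp
  ultimately have "(\<integral>x. (norm (Du x - Du' x))\<^sup>2 \<partial>\<mu>) = 0" by linarith
  then have "AE x in \<mu>. (norm (Du x - Du' x))\<^sup>2 = 0"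
    using integral_nonneg_eq_0_iff_AE[OF i] by simp
  then show ?thesis by eventually_elim simp
qed

text \<open>Discharges the definite description: any two weak solutions have the same gradient
  almost everywhere, so all of them yield one value.\<close>

lemma dn_pair_eq:
  assumes "weak_sol U A F u Du" "H1 U F DF" and v: "\<And>i. (\<lambda>x. cgrad v x $ i) \<in> borel_measurable \<mu>"
  shows "dn_pair U A F v = (\<integral>x. (\<Sum>i\<in>UNIV. (A x *v Du x) $ i * cgrad v x $ i) \<partial>\<mu>)"
  unfolding dn_pair_def
proof (rule the_equality)
  show "\<exists>u' Du'. weak_sol U A F u' Du' \<and> (\<integral>x. (\<Sum>i\<in>UNIV. (A x *v Du x) $ i * cgrad v x $ i) \<partial>\<mu>)
      = (\<integral>x. (\<Sum>i\<in>UNIV. (\<Sum>j\<in>UNIV. A x $ i $ j * Du' x $ j) * cgrad v x $ i) \<partial>\<mu>)"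
    using assms(1) by (auto simp: matrix_vector_mult_def)
next
  fix r
  assume "\<exists>u Du. weak_sol U A F u Du \<and>
      r = (\<integral>x. (\<Sum>i\<in>UNIV. (\<Sum>j\<in>UNIV. A x $ i $ j * Du x $ j) * cgrad v x $ i) \<partial>\<mu>)"
  then obtain u' Du' where w: "weak_sol U A F u' Du'"
    and r: "r = (\<integral>x. (\<Sum>i\<in>UNIV. (A x *v Du' x) $ i * cgrad v x $ i) \<partial>\<mu>)"
    by (auto simp: matrix_vector_mult_def)
  have m: "(\<lambda>x. (\<Sum>i\<in>UNIV. (A x *v D x) $ i * cgrad v x $ i)) \<in> borel_measurable \<mu>"
    if "square_integrable \<mu> D" for D
    using v square_integrable_A(1)[OF that] unfolding square_integrable_component[of _ "\<lambda>x. A x *v D x"]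
    by (auto simp: square_integrable_def intro!: borel_measurable_sum borel_measurable_times)
  show "r = (\<integral>x. (\<Sum>i\<in>UNIV. (A x *v Du x) $ i * cgrad v x $ i) \<partial>\<mu>)"
    unfolding r
  proof (rule integral_cong_AE)
    show "AE x in \<mu>. (\<Sum>i\<in>UNIV. (A x *v Du' x) $ i * cgrad v x $ i) = (\<Sum>i\<in>UNIV. (A x *v Du x) $ i * cgrad v x $ i)"
      using weak_sol_gradient_unique[OF assms(1) w assms(2)] by eventually_elim simp
  qed (use m w assms(1) in \<open>auto simp: weak_sol_iff H1_iff\<close>)
qed

end

lemma matrix_vector_mult_scaleR_right:
  fixes A :: "'a::real_algebra_1^'n^'m"
  shows "A *v (t *\<^sub>R z) = t *\<^sub>R (A *v z)"
  by (simp add: vec_eq_iff matrix_vector_mult_def scaleR_sum_right)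

context elliptic
begin

text \<open>The choice \<open>s = c / K\<^sup>2\<close> minimises
  \<open>1 - 2 * s * c + s\<^sup>2 * K\<^sup>2\<close>, the bound for the squared contraction
  factor, with minimum \<open>1 - c\<^sup>2 / K\<^sup>2\<close>. It turns the coercive coefficient
  into the perturbation of the identity that \<open>approximate_lax_milgram\<close> handles.\<close>

lemma scaled_contraction:
  obtains s q where "0 < s" "0 \<le> q" "q < 1"
    "AE x in \<mu>. \<forall>z. norm (z - s *\<^sub>R (A x *v z)) \<le> q * norm z"
proof
  define s where "s = c / K\<^sup>2"
  define q where "q = sqrt (1 - c\<^sup>2 / K\<^sup>2)"
  have K: "0 < K" using cK by simp
  have "c\<^sup>2 / K\<^sup>2 \<le> 1" using cK K by (simp add: power_mono)
  moreover have "0 < c\<^sup>2 / K\<^sup>2" using cK K by simp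
  ultimately have r: "0 \<le> 1 - c\<^sup>2 / K\<^sup>2" "1 - c\<^sup>2 / K\<^sup>2 < 1" by auto
  show "0 < s" "0 \<le> q" "q < 1" using cK K r by (auto simp: s_def q_def)
  show "AE x in \<mu>. \<forall>z. norm (z - s *\<^sub>R (A x *v z)) \<le> q * norm z"
    using bound coercive
  proof eventually_elim
    case (elim x)
    show ?case
    proof
      fix z
      have "(norm (z - s *\<^sub>R (A x *v z)))\<^sup>2 = (norm z)\<^sup>2 - 2 * s * ((A x *v z) \<bullet> z) + s\<^sup>2 * (norm (A x *v z))\<^sup>2"
        using norm_combination_square[of z "- s" "A x *v z"] by (simp add: inner_commute)
      also have "\<dots> \<le> (norm z)\<^sup>2 - 2 * s * (c * (norm z)\<^sup>2) + s\<^sup>2 * (K\<^sup>2 * (norm z)\<^sup>2)"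
      proof -
        have "2 * s * (c * (norm z)\<^sup>2) \<le> 2 * s * ((A x *v z) \<bullet> z)"
          using elim(2) \<open>0 < s\<close> by (intro mult_left_mono) auto
        moreover have "s\<^sup>2 * (norm (A x *v z))\<^sup>2 \<le> s\<^sup>2 * (K * norm z)\<^sup>2"
          using elim(1) by (intro mult_left_mono power_mono) auto
        ultimately show ?thesis unfolding power_mult_distrib by linarith
      qed
      also have "\<dots> = (1 - c\<^sup>2 / K\<^sup>2) * (norm z)\<^sup>2"
        using K by (simp add: s_def field_simps power2_eq_square)
      finally have "norm (z - s *\<^sub>R (A x *v z)) \<le> sqrt ((1 - c\<^sup>2 / K\<^sup>2) * (norm z)\<^sup>2)"
        by (rule real_le_rsqrt)
      then show "norm (z - s *\<^sub>R (A x *v z)) \<le> q * norm z" by (simp add: q_def real_sqrt_mult)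
    qed
  qed
qed

lemma semi_inner_space_ptest:
  "semi_inner_space (ptest U) pcomb (\<lambda>p r. \<integral>x. pgrad p x \<bullet> pgrad r x \<partial>\<mu>)"
proof
  have "((\<lambda>x. 0), (\<lambda>x. 0)) \<in> ptest U" by (simp add: ptest_def test_fun_zero)
  then show "ptest U \<noteq> {}" by blast
next
  fix x y z t assume x: "x \<in> ptest U" and y: "y \<in> ptest U" and z: "z \<in> ptest U"
  show "(\<integral>w. pgrad (pcomb x t y) w \<bullet> pgrad z w \<partial>\<mu>)
      = (\<integral>w. pgrad x w \<bullet> pgrad z w \<partial>\<mu>) + t * (\<integral>w. pgrad y w \<bullet> pgrad z w \<partial>\<mu>)"
    using square_integrable_inner[OF ptest_square_integrable(2)[OF x U(1)] ptest_square_integrable(2)[OF z U(1)]]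
      square_integrable_inner[OF ptest_square_integrable(2)[OF y U(1)] ptest_square_integrable(2)[OF z U(1)]]
    by (simp add: pgrad_pcomb[OF x y] inner_add_left)
qed (auto simp: ptest_pcomb inner_commute)

text \<open>The solution is F + w, with w a limit of test pairs solving the scaled equation up to a
  residual 1 / (k + 1). Coercivity makes their gradients Cauchy, the Poincare inequality the
  functions themselves.\<close>

lemma weak_sol_exists:
  assumes F: "H1 U F DF"
  shows "\<exists>u Du. weak_sol U A F u Du"
proof -
  interpret finite_measure \<mu> by (rule finite_measure_lebesgue_on_bounded[OF U])
  interpret S: semi_inner_space "ptest U" pcomb "\<lambda>p r. \<integral>x. pgrad p x \<bullet> pgrad r x \<partial>\<mu>"
    by (rule semi_inner_space_ptest)
  have nrm: "S.seminorm p = l2norm \<mu> (pgrad p)" for p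
    by (simp add: S.seminorm_def l2norm_def power2_norm_eq_inner)
  obtain s q where s: "0 < s" and q: "0 \<le> q" "q < 1"
    and con: "AE x in \<mu>. \<forall>z. norm (z - s *\<^sub>R (A x *v z)) \<le> q * norm z"
    by (rule scaled_contraction)
  \<comment> \<open>Multiplying the equation by \<open>s\<close> keeps its solutions and brings its
    form within the factor \<open>q\<close> of the Dirichlet form.\<close>
  define a where "a p r = (\<integral>x. (s *\<^sub>R (A x *v pgrad p x)) \<bullet> pgrad r x \<partial>\<mu>)" for p r
  define l where "l r = - (\<integral>x. (s *\<^sub>R (A x *v DF x)) \<bullet> pgrad r x \<partial>\<mu>)" for r
  have g: "square_integrable \<mu> (pgrad p)" if "p \<in> ptest U" for p using that ptest_square_integrable U by blast
  have sA: "square_integrable \<mu> (\<lambda>x. s *\<^sub>R (A x *v f x))" if "square_integrable \<mu> f" for f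
    using square_integrable_A(1)[OF that] by (auto simp: square_integrable_def power_mult_distrib)
  have DF: "square_integrable \<mu> DF" using F by (simp add: H1_iff)
  note [simp] = matrix_vector_right_distrib
  have ac: "\<bar>(\<integral>x. pgrad x' x \<bullet> pgrad y x \<partial>\<mu>) - a x' y\<bar> \<le> q * S.seminorm x' * S.seminorm y"
    if x: "x' \<in> ptest U" and y: "y \<in> ptest U" for x' y
  proof -
    note d = square_integrable_diff[OF g[OF x] sA[OF g[OF x]]]
    have "(\<integral>x. pgrad x' x \<bullet> pgrad y x \<partial>\<mu>) - a x' y
        = (\<integral>x. (pgrad x' x - s *\<^sub>R (A x *v pgrad x' x)) \<bullet> pgrad y x \<partial>\<mu>)"
      unfolding a_def inner_diff_left
      by (intro Bochner_Integration.integral_diff[symmetric] square_integrable_inner g sA x y)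
    also have "\<bar>\<dots>\<bar> \<le> l2norm \<mu> (\<lambda>x. pgrad x' x - s *\<^sub>R (A x *v pgrad x' x)) * l2norm \<mu> (pgrad y)"
      by (rule l2_Cauchy_Schwarz[OF d g[OF y]])
    also have "l2norm \<mu> (\<lambda>x. pgrad x' x - s *\<^sub>R (A x *v pgrad x' x)) \<le> q * l2norm \<mu> (pgrad x')"
    proof (rule l2norm_mono_AE[OF _ g[OF x] _ q(1)])
      show "AE x in \<mu>. norm (pgrad x' x - s *\<^sub>R (A x *v pgrad x' x)) \<le> q * norm (pgrad x' x)"
        using con by eventually_elim simp
    qed (use d in \<open>simp add: square_integrable_def\<close>)
    finally show ?thesis by (simp add: nrm mult_right_mono l2norm_nonneg)
  qed
  have a1: "a (pcomb x t y) z = a x z + t * a y z" if "x \<in> ptest U" "y \<in> ptest U" "z \<in> ptest U" for x y z t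
  proof -
    have "a (pcomb x t y) z = (\<integral>w. (s *\<^sub>R (A w *v pgrad x w)) \<bullet> pgrad z w
        + t * ((s *\<^sub>R (A w *v pgrad y w)) \<bullet> pgrad z w) \<partial>\<mu>)"
      unfolding a_def pgrad_pcomb[OF that(1,2)]
      by (simp add: matrix_vector_mult_scaleR_right inner_add_left algebra_simps)
    also have "\<dots> = a x z + t * a y z"
      unfolding a_def using square_integrable_inner[OF sA[OF g] g] that by simp
    finally show ?thesis .
  qed
  have r: "(\<integral>w. Z w \<bullet> pgrad (pcomb x t y) w \<partial>\<mu>) = (\<integral>w. Z w \<bullet> pgrad x w \<partial>\<mu>) + t * (\<integral>w. Z w \<bullet> pgrad y w \<partial>\<mu>)"
    if "square_integrable \<mu> Z" "x \<in> ptest U" "y \<in> ptest U" for x y t Z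
    using square_integrable_inner[OF that(1) g[OF that(2)]] square_integrable_inner[OF that(1) g[OF that(3)]]
    by (simp add: pgrad_pcomb[OF that(2,3)] inner_add_right)
  have a2: "a z (pcomb x t y) = a z x + t * a z y" if "x \<in> ptest U" "y \<in> ptest U" "z \<in> ptest U" for x y z t
    unfolding a_def using that by (intro r sA g)
  have l1: "l (pcomb x t y) = l x + t * l y" if "x \<in> ptest U" "y \<in> ptest U" for x y t
    unfolding l_def using r[OF sA[OF DF] that] by (simp add: algebra_simps)
  have lB: "\<bar>l x\<bar> \<le> l2norm \<mu> (\<lambda>x. s *\<^sub>R (A x *v DF x)) * S.seminorm x" if "x \<in> ptest U" for x
    using l2_Cauchy_Schwarz[OF sA[OF DF] g[OF that]] by (simp add: l_def nrm)
  have "\<exists>p. p \<in> ptest U \<and> (\<forall>y\<in>ptest U. \<bar>a p y - l y\<bar> \<le> 1 / real (Suc k) * S.seminorm y)" for k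
  proof (rule S.approximate_lax_milgram[OF a1 a2 ac q l1 lB, of "1 / real (Suc k)"])
    fix p' assume "p' \<in> ptest U"
      "\<And>y. y \<in> ptest U \<Longrightarrow> \<bar>a p' y - l y\<bar> \<le> 1 / real (Suc k) * S.seminorm y"
    then show ?thesis by (intro exI[of _ p'] conjI ballI)
  qed simp_all
  then have "\<forall>k. \<exists>p. p \<in> ptest U \<and> (\<forall>y\<in>ptest U. \<bar>a p y - l y\<bar> \<le> 1 / real (Suc k) * S.seminorm y)"
    by (rule allI)
  from choice[OF this] obtain p where pr: "\<forall>k. p k \<in> ptest U \<and>
      (\<forall>y\<in>ptest U. \<bar>a (p k) y - l y\<bar> \<le> 1 / real (Suc k) * S.seminorm y)" by (elim exE)
  have p: "p k \<in> ptest U" for k using pr by simp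
  have res: "\<bar>a (p k) y - l y\<bar> \<le> 1 / real (Suc k) * S.seminorm y" if "y \<in> ptest U" for k y
    using pr that by simp
  have gd: "pgrad (pcomb (p i) (-1) (p j)) = (\<lambda>x. pgrad (p i) x - pgrad (p j) x)" for i j
    by (rule ext) (simp add: pgrad_pcomb[OF p p])
  have fd: "pfun (pcomb (p i) (-1) (p j)) = (\<lambda>x. pfun (p i) x - pfun (p j) x)" for i j
    by (rule ext) (simp add: pfun_pcomb)
  \<comment> \<open>The difference of two approximations is tested with itself: \<open>a\<close>
    dominates \<open>1 - q\<close> times its squared norm, while both residuals are small.\<close>
  have dist: "l2norm \<mu> (\<lambda>x. pgrad (p i) x - pgrad (p j) x) \<le> (1 / real (Suc i) + 1 / real (Suc j)) / (1 - q)" for i j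
  proof -
    define d where "d = pcomb (p i) (-1) (p j)"
    have d: "d \<in> ptest U" unfolding d_def by (intro ptest_pcomb p)
    have N: "0 \<le> S.seminorm d" by (simp add: nrm l2norm_nonneg)
    have "(1 - q) * S.seminorm d * S.seminorm d \<le> a d d"
      using ac[OF d d] S.seminorm_square[OF d] by (simp add: algebra_simps)
    also have "a d d = a (p i) d - a (p j) d" using a1[OF p p d, of i "-1" j] by (simp add: d_def)
    also have "\<dots> \<le> (1 / real (Suc i) + 1 / real (Suc j)) * S.seminorm d"
      using res[OF d, of i] res[OF d, of j] unfolding distrib_right by linarith
    finally have "(1 - q) * S.seminorm d \<le> 1 / real (Suc i) + 1 / real (Suc j)"
      using N by (cases "S.seminorm d = 0") (auto simp: less_le)
    moreover have "S.seminorm d = l2norm \<mu> (\<lambda>x. pgrad (p i) x - pgrad (p j) x)"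
      by (simp add: nrm d_def gd)
    ultimately show ?thesis using q by (simp add: pos_le_divide_eq mult.commute)
  qed
  obtain C where C: "0 \<le> C" "\<And>p. p \<in> ptest U \<Longrightarrow> l2norm \<mu> (pfun p) \<le> C * l2norm \<mu> (pgrad p)"
    using poincare_ptest[OF U] by blast
  have dist': "l2norm \<mu> (\<lambda>x. pfun (p i) x - pfun (p j) x) \<le> C * l2norm \<mu> (\<lambda>x. pgrad (p i) x - pgrad (p j) x)" for i j
    using C(2)[OF ptest_pcomb[OF p p], of i "-1" j] by (simp add: fd gd)
  \<comment> \<open>Used with \<open>B = 1\<close> for the gradients and with \<open>B = C\<close>
    for the functions.\<close>
  have small: "\<exists>N. \<forall>i\<ge>N. \<forall>j\<ge>N. f i j < e"
    if "e > 0" "B \<ge> 0" and f: "\<And>i j. f i j \<le> B * ((1 / real (Suc i) + 1 / real (Suc j)) / (1 - q))"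
    for e B and f :: "nat \<Rightarrow> nat \<Rightarrow> real"
  proof -
    have "(\<lambda>k. B * ((1 / real (Suc k) + 1 / real (Suc k)) / (1 - q))) \<longlonglongrightarrow> B * ((0 + 0) / (1 - q))"
      by (intro tendsto_intros LIMSEQ_Suc[OF lim_1_over_n]) (use q in auto)
    then have "\<forall>\<^sub>F k in sequentially. B * ((1 / real (Suc k) + 1 / real (Suc k)) / (1 - q)) < e"
      using \<open>e > 0\<close> by (intro order_tendstoD) auto
    then obtain N where N: "B * ((1 / real (Suc N) + 1 / real (Suc N)) / (1 - q)) < e"
      by (auto simp: eventually_sequentially)
    have "f i j < e" if "i \<ge> N" "j \<ge> N" for i j
    proof -
      have "B * ((1 / real (Suc i) + 1 / real (Suc j)) / (1 - q)) \<le> B * ((1 / real (Suc N) + 1 / real (Suc N)) / (1 - q))"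
        using that q \<open>B \<ge> 0\<close> by (intro mult_left_mono divide_right_mono add_mono divide_left_mono) auto
      then show ?thesis using N f[of i j] by linarith
    qed
    then show ?thesis by (intro exI[of _ N] allI impI)
  qed
  obtain Dw where Dw: "square_integrable \<mu> Dw" "(\<lambda>k. l2norm \<mu> (\<lambda>x. pgrad (p k) x - Dw x)) \<longlonglongrightarrow> 0"
  proof (rule square_integrable_complete[of "\<lambda>k. pgrad (p k)"])
    show "\<exists>N. \<forall>i\<ge>N. \<forall>j\<ge>N. l2norm \<mu> (\<lambda>x. pgrad (p i) x - pgrad (p j) x) < e" if "e > 0" for e
      by (rule small[OF that zero_le_one]) (use dist in simp)
  qed (rule g[OF p])
  obtain w where w: "square_integrable \<mu> w" "(\<lambda>k. l2norm \<mu> (\<lambda>x. pfun (p k) x - w x)) \<longlonglongrightarrow> 0"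
  proof (rule square_integrable_complete[of "\<lambda>k. pfun (p k)"])
    show "\<exists>N. \<forall>i\<ge>N. \<forall>j\<ge>N. l2norm \<mu> (\<lambda>x. pfun (p i) x - pfun (p j) x) < e" if "e > 0" for e
      by (rule small[OF that C(1)]) (rule order_trans[OF dist' mult_left_mono[OF dist C(1)]])
  qed (rule ptest_square_integrable(1)[OF p U(1)])
  have H: "H1 U w Dw" by (rule H1_limit[OF U(1) H1_pfun[OF U(1) p] w(1) Dw(1) w(2) Dw(2)])
  then have "H10 U w" unfolding H10_iff[OF U(1)]
    by (intro exI[of _ Dw] exI[of _ p] conjI allI p w(2) Dw(2))
  have "(\<integral>x. (A x *v (DF x + Dw x)) \<bullet> pgrad y x \<partial>\<mu>) = 0" if y: "y \<in> ptest U" for y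
  proof -
    have "(\<lambda>k. l2norm \<mu> (\<lambda>x. (A x *v pgrad (p k) x) - (A x *v Dw x))) \<longlonglongrightarrow> 0"
    proof (rule Lim_null_comparison[OF always_eventually], rule allI)
      fix k
      show "norm (l2norm \<mu> (\<lambda>x. (A x *v pgrad (p k) x) - (A x *v Dw x))) \<le> K * l2norm \<mu> (\<lambda>x. pgrad (p k) x - Dw x)"
        using square_integrable_A(2)[OF square_integrable_diff[OF g[OF p] Dw(1)]]
        by (simp add: l2norm_nonneg matrix_vector_mult_diff_distrib)
      show "(\<lambda>k. K * l2norm \<mu> (\<lambda>x. pgrad (p k) x - Dw x)) \<longlonglongrightarrow> 0" by (rule tendsto_mult_right_zero[OF Dw(2)])
    qed
    from l2_tendsto_inner[OF square_integrable_A(1)[OF g[OF p]] square_integrable_A(1)[OF Dw(1)] g[OF y] this]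
    have "(\<lambda>k. s * (\<integral>x. (A x *v pgrad (p k) x) \<bullet> pgrad y x \<partial>\<mu>) - l y)
        \<longlonglongrightarrow> s * (\<integral>x. (A x *v Dw x) \<bullet> pgrad y x \<partial>\<mu>) - l y" by (intro tendsto_intros)
    then have 1: "(\<lambda>k. a (p k) y - l y) \<longlonglongrightarrow> s * (\<integral>x. (A x *v Dw x) \<bullet> pgrad y x \<partial>\<mu>) - l y"
      by (simp add: a_def)
    have "(\<lambda>k. a (p k) y - l y) \<longlonglongrightarrow> 0"
    proof (rule Lim_null_comparison[OF always_eventually], rule allI)
      show "norm (a (p k) y - l y) \<le> 1 / real (Suc k) * S.seminorm y" for k using res[OF y] by simp
      show "(\<lambda>k. 1 / real (Suc k) * S.seminorm y) \<longlonglongrightarrow> 0"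
        by (rule tendsto_mult_left_zero[OF LIMSEQ_Suc[OF lim_1_over_n]])
    qed
    from LIMSEQ_unique[OF 1 this]
    have "s * (\<integral>x. (A x *v Dw x) \<bullet> pgrad y x \<partial>\<mu>) + s * (\<integral>x. (A x *v DF x) \<bullet> pgrad y x \<partial>\<mu>) = 0"
      by (simp add: l_def)
    then have "(\<integral>x. (A x *v Dw x) \<bullet> pgrad y x \<partial>\<mu>) + (\<integral>x. (A x *v DF x) \<bullet> pgrad y x \<partial>\<mu>) = 0"
      using s by (simp flip: distrib_left)
    then show ?thesis
      using square_integrable_inner[OF square_integrable_A(1)[OF DF] g[OF y]]
        square_integrable_inner[OF square_integrable_A(1)[OF Dw(1)] g[OF y]]
      by (simp add: inner_add_left add.commute)
  qed
  moreover have "H1 U (\<lambda>x. F x + w x) (\<lambda>x. DF x + Dw x)"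
    using H1_combination[OF U(1) F H, of 1] by simp
  ultimately have "weak_sol U A F (\<lambda>x. F x + w x) (\<lambda>x. DF x + Dw x)"
    using \<open>H10 U w\<close> by (simp add: weak_sol_iff)
  then show ?thesis by blast
qed

end

section \<open>Volume near a supporting boundary point\<close>

lemma support_fn_upper:
  fixes D :: "(real^'n::finite) set"
  assumes "bounded D" "x \<in> D"
  shows "x \<bullet> \<theta> \<le> support_fn D \<theta>"
  unfolding support_fn_def
proof (rule cSUP_upper[OF assms(2)])
  obtain B where "\<And>x. x \<in> D \<Longrightarrow> norm x \<le> B" using assms(1) bounded_iff by metis
  then have "x \<bullet> \<theta> \<le> B * norm \<theta>" if "x \<in> D" for x
    using norm_cauchy_schwarz[of x \<theta>] mult_right_mono[of "norm x" B "norm \<theta>"] that by fastforce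
  then show "bdd_above ((\<lambda>x. x \<bullet> \<theta>) ` D)" by (auto simp: bdd_above_def)
qed

text \<open>A maximiser over the compact closure cannot lie in the open set \<open>D\<close>, since
  a short step in direction \<theta> would increase the height.\<close>

lemma support_fn_attained:
  fixes D :: "(real^'n::finite) set"
  assumes "open D" "bounded D" "D \<noteq> {}" "norm \<theta> = 1"
  obtains p where "p \<in> frontier D" "p \<bullet> \<theta> = support_fn D \<theta>"
proof -
  obtain p where p: "p \<in> closure D" "\<And>y. y \<in> closure D \<Longrightarrow> y \<bullet> \<theta> \<le> p \<bullet> \<theta>"
  proof -
    have "\<exists>x\<in>closure D. \<forall>y\<in>closure D. y \<bullet> \<theta> \<le> x \<bullet> \<theta>"
      using assms(2,3) by (intro continuous_attains_sup continuous_intros) (auto simp: compact_closure)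
    then show thesis using that by blast
  qed
  have "support_fn D \<theta> \<le> p \<bullet> \<theta>"
    unfolding support_fn_def using p(2) assms(3) closure_subset by (intro cSUP_least) auto
  moreover have "p \<bullet> \<theta> \<le> support_fn D \<theta>"
  proof -
    have "closure D \<subseteq> {x. x \<bullet> \<theta> \<le> support_fn D \<theta>}"
      using support_fn_upper[OF assms(2)]
      by (intro closure_minimal closed_Collect_le continuous_intros) auto
    then show ?thesis using p(1) by blast
  qed
  moreover have "p \<notin> D"
  proof
    assume "p \<in> D"
    then obtain r where r: "r > 0" "ball p r \<subseteq> D" using assms(1) openE by blast
    then have "p + (r / 2) *\<^sub>R \<theta> \<in> D" using assms(4) by (auto simp: dist_norm)
    then have "(p + (r / 2) *\<^sub>R \<theta>) \<bullet> \<theta> \<le> p \<bullet> \<theta>" using p(2) closure_subset by blast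
    then show False using r assms(4) by (simp add: inner_add_left flip: power2_norm_eq_inner)
  qed
  ultimately show thesis using that[of p] p(1) assms(1) by (simp add: frontier_def interior_open)
qed

text \<open>A frontier point is outside the open set \<open>D\<close>, so it is not below the graph;
  strictly above the graph it would have a neighbourhood free of \<open>D\<close>.\<close>

lemma graph_boundary_point:
  fixes D :: "'a::euclidean_space set"
  assumes "open D" "p \<in> frontier D" "r > 0" "continuous_on UNIV h"
    and D: "D \<inter> ball p r = {x \<in> ball p r. x \<bullet> e < h x}"
  shows "p \<bullet> e = h p"
proof -
  have "p \<notin> D" using assms(1,2) by (simp add: frontier_def interior_open)
  moreover have "p \<in> ball p r" using \<open>r > 0\<close> by simp
  ultimately have "\<not> p \<bullet> e < h p" using D by blast
  moreover have "\<not> h p < p \<bullet> e"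
  proof
    assume lt: "h p < p \<bullet> e"
    have "open ({x. h x < x \<bullet> e} \<inter> ball p r)"
      by (intro open_Int open_Collect_less assms(4) continuous_intros) auto
    moreover have "p \<in> {x. h x < x \<bullet> e} \<inter> ball p r" using lt \<open>r > 0\<close> by simp
    moreover have "p \<in> closure D" using assms(2) by (simp add: frontier_def)
    ultimately obtain x where x: "x \<in> D" "h x < x \<bullet> e" "x \<in> ball p r"
      using open_Int_closure_eq_empty[of "{x. h x < x \<bullet> e} \<inter> ball p r" D] by blast
    then have "x \<in> {x \<in> ball p r. x \<bullet> e < h x}" using D by blast
    then show False using x by simp
  qed
  ultimately show ?thesis by simp
qed

text \<open>Under a Lipschitz graph a cone with axis -e fits at \<open>p\<close>, and the ball of
  radius \<open>\<kappa> * s\<close> around \<open>p - s *\<^sub>R e\<close> lies in it. In the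
  plane its area is of order s^2, and its depth stays within 2 s whatever the angle between e and
  \<theta>.\<close>

lemma lipschitz_boundary_strip_volume:
  fixes D :: "(real^'n::finite) set"
  assumes n: "CARD('n) = 2" and D: "open D" "lipschitz_boundary D" and \<theta>: "norm \<theta> = 1"
    and p: "p \<in> frontier D"
  shows "\<exists>c>0. \<exists>s0>0. \<forall>s. 0 < s \<and> s \<le> s0 \<longrightarrow> (\<exists>S\<in>lmeasurable. S \<subseteq> D \<and>
    (\<forall>x\<in>S. p \<bullet> \<theta> - 2 * s \<le> x \<bullet> \<theta>) \<and> c * s\<^sup>2 \<le> measure lebesgue S)"
proof -
  obtain r e h L where r: "r > 0" and e: "norm e = 1" and h: "\<And>x s. h (x + s *\<^sub>R e) = h x"
    and L: "\<And>x y. \<bar>h x - h y\<bar> \<le> L * norm (x - y)" and Dr: "D \<inter> ball p r = {x \<in> ball p r. x \<bullet> e < h x}"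
    using D(2)[unfolded lipschitz_boundary_def, rule_format, OF p] by blast
  \<comment> \<open>The Lipschitz constant comes without a sign, hence the absolute value.\<close>
  have L': "\<bar>h x - h y\<bar> \<le> \<bar>L\<bar> * norm (x - y)" for x y
    using L[of x y] mult_right_mono[of L "\<bar>L\<bar>" "norm (x - y)"] by fastforce
  have "\<bar>L\<bar>-lipschitz_on UNIV h" using L' by (intro lipschitz_onI) (auto simp: dist_norm)
  then have "continuous_on UNIV h" by (rule lipschitz_on_continuous_on)
  then have pe: "p \<bullet> e = h p" by (rule graph_boundary_point[OF D(1) p r _ Dr])
  \<comment> \<open>The bound \<open>\<kappa> * (1 + \<bar>L\<bar>) \<le> 1\<close> keeps the ball
    below the graph, and \<open>\<kappa> \<le> 1\<close> keeps its radius within s.\<close>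
  define \<kappa> where "\<kappa> = 1 / (2 + \<bar>L\<bar>)"
  have \<kappa>: "0 < \<kappa>" "\<kappa> \<le> 1" "\<kappa> * (1 + \<bar>L\<bar>) \<le> 1" by (auto simp: \<kappa>_def field_simps)
  define c where "c = \<kappa>\<^sup>2 * measure lebesgue (ball (0::real^'n) 1)"
  have "0 < measure lebesgue (ball (0::real^'n) 1)" using content_ball_pos[of 1 "0::real^'n"] by simp
  then have c: "c > 0" using \<kappa> by (simp add: c_def)
  have "\<exists>S\<in>lmeasurable. S \<subseteq> D \<and> (\<forall>x\<in>S. p \<bullet> \<theta> - 2 * s \<le> x \<bullet> \<theta>) \<and> c * s\<^sup>2 \<le> measure lebesgue S"
    if s: "0 < s" "s \<le> r / 2" for s
  proof (intro bexI conjI ballI subsetI)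
    let ?S = "ball (p - s *\<^sub>R e) (\<kappa> * s)"
    show "?S \<in> lmeasurable" by simp
    have "measure lborel ?S = (\<kappa> * s) ^ DIM(real^'n) * measure lborel (ball (0::real^'n) 1)"
      using s \<kappa> by (intro content_ball_conv_unit_ball) simp
    then show "c * s\<^sup>2 \<le> measure lebesgue ?S" by (simp add: n c_def power_mult_distrib)
    fix x assume "x \<in> ?S"
    define y where "y = x - (p - s *\<^sub>R e)"
    have x: "x = p + y - s *\<^sub>R e" by (simp add: y_def)
    have y: "norm y < \<kappa> * s" using \<open>x \<in> ?S\<close> by (simp add: y_def dist_norm norm_minus_commute)
    have \<kappa>s: "\<kappa> * s \<le> s" using \<kappa>(2) s by simp
    have ye: "\<bar>y \<bullet> e\<bar> \<le> norm y" "\<bar>y \<bullet> \<theta>\<bar> \<le> norm y" "\<bar>e \<bullet> \<theta>\<bar> \<le> 1"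
      using Cauchy_Schwarz_ineq2[of y e] Cauchy_Schwarz_ineq2[of y \<theta>] Cauchy_Schwarz_ineq2[of e \<theta>] e \<theta> by auto
    have "norm (x - p) \<le> norm y + norm (s *\<^sub>R e)"
      unfolding x using norm_triangle_ineq4[of y "s *\<^sub>R e"] by (simp add: algebra_simps)
    also have "\<dots> < r" unfolding norm_scaleR e using y \<kappa>s s by linarith
    finally have "x \<in> ball p r" by (simp add: dist_norm norm_minus_commute)
    moreover have "x \<bullet> e < h x"
    proof -
      have "h x = h (p + y)" using h[of "p + y" "- s"] by (simp add: x)
      also have "\<dots> \<ge> h p - \<bar>L\<bar> * norm y" using L'[of p "p + y"] by simp
      finally have 1: "h p - \<bar>L\<bar> * norm y \<le> h x" .
      have "x \<bullet> e = h p + y \<bullet> e - s"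
        using e pe by (simp add: x inner_diff_left inner_add_left flip: power2_norm_eq_inner)
      moreover have "(1 + \<bar>L\<bar>) * norm y < s"
      proof -
        have "(1 + \<bar>L\<bar>) * norm y < (1 + \<bar>L\<bar>) * (\<kappa> * s)" using y by (intro mult_strict_left_mono) auto
        also have "\<dots> \<le> 1 * s" using \<kappa>(3) s mult_right_mono[of "\<kappa> * (1 + \<bar>L\<bar>)" 1 s] by (simp add: algebra_simps)
        finally show ?thesis by simp
      qed
      ultimately show ?thesis using 1 ye(1) by (simp add: algebra_simps)
    qed
    ultimately show "x \<in> D" using Dr by blast
    have "s * (e \<bullet> \<theta>) \<le> s" using ye(3) s by simp
    then show "p \<bullet> \<theta> - 2 * s \<le> x \<bullet> \<theta>"
      using ye(2) y \<kappa>s by (simp add: x inner_diff_left inner_add_left)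
  qed
  then show ?thesis using c r by (intro exI[of _ c] exI[of _ "r / 2"] conjI allI impI) simp_all
qed

text \<open>The Hessian is bounded on the compact unit ball around p, so the gradient is Lipschitz
  at p there; the mean value inequality for \<open>h\<close> minus its linear part gives the
  quadratic remainder.\<close>

lemma C2_fn_taylor:
  fixes h :: "real^'n::finite \<Rightarrow> real"
  assumes "C2_fn h"
  obtains g B where "(h has_derivative (\<lambda>v. g \<bullet> v)) (at p)" "B \<ge> 1"
    "\<And>z. norm z \<le> 1 \<Longrightarrow> \<bar>h (p + z) - h p - g \<bullet> z\<bar> \<le> B * (norm z)\<^sup>2"
proof -
  obtain G H where G: "\<And>x. (h has_derivative (\<lambda>v. G x \<bullet> v)) (at x)"
    and H: "\<And>x. (G has_derivative (\<lambda>v. H x *v v)) (at x)" "continuous_on UNIV H"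
    using assms unfolding C2_fn_def by blast
  have "compact (H ` cball p 1)" using H(2) by (intro compact_continuous_image) (auto intro: continuous_on_subset)
  then obtain b where b: "\<And>x. x \<in> cball p 1 \<Longrightarrow> norm (H x) \<le> b"
    using compact_imp_bounded by (fastforce simp: bounded_iff)
  define B where "B = max 1 (real CARD('n) * real CARD('n) * b)"
  have Hb: "onorm ((*v) (H x)) \<le> B" if "x \<in> cball p 1" for x
  proof -
    have "\<bar>H x $ i $ j\<bar> \<le> b" for i j
      using b[OF that] component_le_norm_cart[of "H x $ i" j] Finite_Cartesian_Product.norm_nth_le[of "H x" i]
      by linarith
    then have "onorm ((*v) (H x)) \<le> real CARD('n) * real CARD('n) * b" by (rule onorm_le_matrix_component)
    then show ?thesis by (simp add: B_def)
  qed
  have GL: "norm (G y - G p) \<le> B * norm (y - p)" if "y \<in> cball p 1" for y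
    by (rule differentiable_bound[of "cball p 1" G "\<lambda>x. (*v) (H x)"])
      (use that Hb H(1) in \<open>auto intro: has_derivative_at_withinI\<close>)
  show thesis
  proof (rule that[OF G, of B])
    show "B \<ge> 1" by (simp add: B_def)
    fix z :: "real^'n" assume z: "norm z \<le> 1"
    have "norm ((h (p + z) - G p \<bullet> (p + z)) - (h p - G p \<bullet> p)) \<le> (B * norm z) * norm (p + z - p)"
    proof (rule differentiable_bound[of "cball p (norm z)" "\<lambda>x. h x - G p \<bullet> x" "\<lambda>x v. G x \<bullet> v - G p \<bullet> v"])
      fix x assume x: "x \<in> cball p (norm z)"
      show "((\<lambda>x. h x - G p \<bullet> x) has_derivative (\<lambda>v. G x \<bullet> v - G p \<bullet> v)) (at x within cball p (norm z))"
        by (intro has_derivative_diff has_derivative_at_withinI[OF G] has_derivative_inner_right has_derivative_ident)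
      have "norm (G x - G p) \<le> B * norm z"
      proof -
        have "norm (G x - G p) \<le> B * norm (x - p)" by (rule GL) (use x z in auto)
        also have "\<dots> \<le> B * norm z" using x by (intro mult_left_mono) (auto simp: B_def dist_norm norm_minus_commute)
        finally show ?thesis .
      qed
      then show "onorm (\<lambda>v. G x \<bullet> v - G p \<bullet> v) \<le> B * norm z"
        by (intro onorm_le) (use Cauchy_Schwarz_ineq2 mult_right_mono order_trans norm_ge_zero in
            \<open>metis inner_diff_left real_norm_def\<close>)
    qed (auto simp: dist_norm)
    then show "\<bar>h (p + z) - h p - G p \<bullet> z\<bar> \<le> B * (norm z)\<^sup>2"
      by (simp add: inner_add_right power2_eq_square algebra_simps)
  qed
qed

text \<open>Translates of a slab along its normal cover the ball.\<close>

lemma slab_volume: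
  fixes \<theta> :: "'a::euclidean_space"
  assumes \<theta>: "norm \<theta> = 1" and s: "0 < s" and R: "0 < R"
  defines "T \<equiv> {z. - 2 * s \<le> z \<bullet> \<theta> \<and> z \<bullet> \<theta> \<le> - s \<and> (norm z)\<^sup>2 \<le> R\<^sup>2 + 4 * s\<^sup>2}"
  shows "T \<in> lmeasurable" "measure lebesgue (ball (0::'a) R) \<le> (2 * R / s + 3) * measure lebesgue T"
proof -
  have "closed T" unfolding T_def
    by (intro closed_Collect_conj closed_Collect_le continuous_intros)
  moreover have "bounded T" unfolding bounded_iff
  proof (intro exI ballI)
    fix z assume "z \<in> T"
    then show "norm z \<le> sqrt (R\<^sup>2 + 4 * s\<^sup>2)" by (auto simp: T_def intro: real_le_rsqrt)
  qed
  ultimately show T: "T \<in> lmeasurable" by (simp add: lmeasurable_compact compact_eq_bounded_closed)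
  define N where "N = \<lceil>R / s\<rceil>"
  \<comment> \<open>With j the floor of (z \<bullet> \<theta>) / s, a shift by j + 2 steps moves the
    normal component into the interval from -2 s to -s. The term \<open>4 * s\<^sup>2\<close> in
    \<open>T\<close> pays for this new component, and j takes at most 2 N + 1 values.\<close>
  define F where "F j = (+) ((of_int (j + 2) * s) *\<^sub>R \<theta>) ` T" for j :: int
  have F: "F j \<in> lmeasurable" "measure lebesgue (F j) = measure lebesgue T" for j
    using T by (simp_all add: F_def measurable_translation measure_translation)
  have N: "R / s \<le> of_int N" "of_int N < R / s + 1" "0 \<le> N"
    unfolding N_def using ceiling_correct[of "R / s"] divide_pos_pos[OF R s] by linarith+
  have cover: "ball 0 R \<subseteq> (\<Union>j\<in>{- N..N}. F j)"
  proof
    fix z :: 'a assume "z \<in> ball 0 R"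
    then have z: "norm z < R" by simp
    have zt: "\<bar>z \<bullet> \<theta>\<bar> < R" using Cauchy_Schwarz_ineq2[of z \<theta>] z \<theta> by simp
    define j where "j = \<lfloor>(z \<bullet> \<theta>) / s\<rfloor>"
    define a where "a = of_int (j + 2) * s"
    have j: "of_int j * s \<le> z \<bullet> \<theta>" "z \<bullet> \<theta> < of_int j * s + s"
      using floor_divide_lower[OF s, of "z \<bullet> \<theta>"] floor_divide_upper[OF s, of "z \<bullet> \<theta>"]
      by (auto simp: j_def algebra_simps)
    have "\<bar>(z \<bullet> \<theta>) / s\<bar> \<le> of_int N"
      using N(1) zt s divide_strict_right_mono[OF zt s] by (simp add: abs_divide)
    then have "- of_int N \<le> (z \<bullet> \<theta>) / s" "(z \<bullet> \<theta>) / s < of_int N + 1" by linarith+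
    then have "j \<in> {- N..N}" unfolding j_def by (auto simp: floor_le_iff le_floor_iff)
    moreover have "z - a *\<^sub>R \<theta> \<in> T"
    proof -
      have d: "(z - a *\<^sub>R \<theta>) \<bullet> \<theta> = z \<bullet> \<theta> - a"
        using \<theta> by (simp add: inner_diff_left flip: power2_norm_eq_inner)
      have r: "- 2 * s \<le> z \<bullet> \<theta> - a" "z \<bullet> \<theta> - a \<le> - s" using j by (auto simp: a_def algebra_simps)
      have "(norm (z - a *\<^sub>R \<theta>))\<^sup>2 = (norm z)\<^sup>2 - 2 * a * (z \<bullet> \<theta>) + a\<^sup>2"
        using norm_combination_square[of z "- a" \<theta>] \<theta> by simp
      also have "\<dots> \<le> (norm z)\<^sup>2 + (z \<bullet> \<theta> - a)\<^sup>2" by (simp add: power2_diff algebra_simps)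
      also have "\<dots> \<le> R\<^sup>2 + (2 * s)\<^sup>2"
        using z r s by (intro add_mono power_mono abs_le_square_iff[THEN iffD1]) auto
      finally show ?thesis using d r by (simp add: T_def power_mult_distrib)
    qed
    moreover have "z = a *\<^sub>R \<theta> + (z - a *\<^sub>R \<theta>)" by simp
    ultimately show "z \<in> (\<Union>j\<in>{- N..N}. F j)" unfolding F_def a_def by blast
  qed
  have "measure lebesgue (ball (0::'a) R) \<le> measure lebesgue (\<Union>j\<in>{- N..N}. F j)"
    by (intro measure_mono_fmeasurable cover fmeasurable.finite_UN) (auto simp: F)
  also have "\<dots> \<le> (\<Sum>j\<in>{- N..N}. measure lebesgue (F j))"
    using F(1) by (intro measure_UNION_le) (auto simp: fmeasurableD)
  also have "\<dots> = (2 * of_int N + 1) * measure lebesgue T" using N(3) by (simp add: F(2))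
  also have "\<dots> \<le> (2 * R / s + 3) * measure lebesgue T" using N(2) by (intro mult_right_mono) auto
  finally show "measure lebesgue (ball (0::'a) R) \<le> (2 * R / s + 3) * measure lebesgue T" .
qed

text \<open>At a highest point the graph normal \<open>\<gamma> = e - g\<close> must be a positive
  multiple of \<theta>. Near \<open>p\<close> the set then contains all p + z with
  \<open>\<gamma> \<bullet> z + B * (norm z)\<^sup>2 < 0\<close>, in particular a slab at depth
  between s and 2 s with radius of order sqrt s; in dimension three its volume is of order s times
  (sqrt s)^2.\<close>

lemma C2_boundary_strip_volume:
  fixes D :: "(real^'n::finite) set"
  assumes n: "CARD('n) = 3" and D: "open D" "C2_boundary D" and \<theta>: "norm \<theta> = 1"
    and p: "p \<in> frontier D" and top: "\<And>x. x \<in> D \<Longrightarrow> x \<bullet> \<theta> \<le> p \<bullet> \<theta>"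
  shows "\<exists>c>0. \<exists>s0>0. \<forall>s. 0 < s \<and> s \<le> s0 \<longrightarrow> (\<exists>S\<in>lmeasurable. S \<subseteq> D \<and>
    (\<forall>x\<in>S. p \<bullet> \<theta> - 2 * s \<le> x \<bullet> \<theta>) \<and> c * s\<^sup>2 \<le> measure lebesgue S)"
proof -
  obtain r e h where r: "r > 0" and e: "norm e = 1" and h: "\<And>x s. h (x + s *\<^sub>R e) = h x"
    and C2: "C2_fn h" and Dr: "D \<inter> ball p r = {x \<in> ball p r. x \<bullet> e < h x}"
    using D(2)[unfolded C2_boundary_def, rule_format, OF p] by blast
  obtain g B where g: "(h has_derivative (\<lambda>v. g \<bullet> v)) (at p)" and B: "B \<ge> 1"
    and taylor: "\<And>z. norm z \<le> 1 \<Longrightarrow> \<bar>h (p + z) - h p - g \<bullet> z\<bar> \<le> B * (norm z)\<^sup>2"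
    using C2_fn_taylor[OF C2] by blast
  have "continuous_on UNIV h"
    using C2 unfolding C2_fn_def by (meson continuous_at_imp_continuous_on has_derivative_continuous)
  then have pe: "p \<bullet> e = h p" by (rule graph_boundary_point[OF D(1) p r _ Dr])
  define \<gamma> where "\<gamma> = e - g"
  \<comment> \<open>The Taylor remainder of \<open>h\<close> is replaced by its worst case; \<gamma>
    collects the linear part of x \<bullet> e - h x.\<close>
  have inD: "p + z \<in> D" if z: "norm z \<le> 1" "norm z < r" "\<gamma> \<bullet> z + B * (norm z)\<^sup>2 < 0" for z
  proof -
    have "(p + z) \<bullet> e < h (p + z)"
      using taylor[OF z(1)] z(3) pe by (simp add: \<gamma>_def inner_diff_left inner_add_left inner_commute[of e z])
    moreover have "p + z \<in> ball p r" using z(2) by (simp add: dist_norm)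
    ultimately show ?thesis using Dr by blast
  qed
  \<comment> \<open>\<open>h\<close> is constant along e, so its gradient is orthogonal to e; this
    gives \<open>\<gamma> \<bullet> e = 1\<close> and hence
    \<open>norm \<gamma> \<ge> 1\<close>.\<close>
  have "g \<bullet> e = 0"
  proof -
    have "((\<lambda>t. p + t *\<^sub>R e) has_derivative (\<lambda>t. t *\<^sub>R e)) (at 0)" by (auto intro!: derivative_eq_intros)
    from has_derivative_compose[OF this, of h "\<lambda>v. g \<bullet> v"] g
    have "((\<lambda>t. h (p + t *\<^sub>R e)) has_derivative (\<lambda>t. g \<bullet> (t *\<^sub>R e))) (at 0)" by simp
    then have "((\<lambda>t::real. h p) has_derivative (\<lambda>t. g \<bullet> (t *\<^sub>R e))) (at 0)" by (simp add: h)
    from has_derivative_unique[OF this has_derivative_const] have "g \<bullet> (1 *\<^sub>R e) = 0" by meson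
    then show ?thesis by simp
  qed
  then have "\<gamma> \<bullet> e = 1" using e by (simp add: \<gamma>_def inner_diff_left flip: power2_norm_eq_inner)
  then have \<gamma>1: "1 \<le> norm \<gamma>" using norm_cauchy_schwarz[of \<gamma> e] e by simp
  \<comment> \<open>A direction pointing strictly below the linearised graph enters \<open>D\<close>
    after a short step, so by maximality of \<open>p\<close> it cannot increase the height.\<close>
  have dir: "z \<bullet> \<theta> \<le> 0" if z: "\<gamma> \<bullet> z < 0" for z
  proof -
    have "z \<noteq> 0" using z by auto
    define t where "t = min (min (1 / norm z) (r / (2 * norm z))) (- (\<gamma> \<bullet> z) / (2 * B * (norm z)\<^sup>2))"
    have "0 < - (\<gamma> \<bullet> z) / (2 * B * (norm z)\<^sup>2)" using z B \<open>z \<noteq> 0\<close> by (intro divide_pos_pos) auto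
    then have t: "t > 0" using r \<open>z \<noteq> 0\<close> by (auto simp: t_def)
    have "t \<le> 1 / norm z" "t \<le> r / (2 * norm z)" "t \<le> - (\<gamma> \<bullet> z) / (2 * B * (norm z)\<^sup>2)" by (auto simp: t_def)
    then have t': "t * norm z \<le> 1" "t * norm z \<le> r / 2" "t * (B * (norm z)\<^sup>2) \<le> - (\<gamma> \<bullet> z) / 2"
      using \<open>z \<noteq> 0\<close> B by (simp_all add: field_simps)
    have "p + t *\<^sub>R z \<in> D"
    proof (rule inD)
      show "norm (t *\<^sub>R z) \<le> 1" "norm (t *\<^sub>R z) < r" using t t' r by auto
      have "\<gamma> \<bullet> (t *\<^sub>R z) + B * (norm (t *\<^sub>R z))\<^sup>2 = t * (\<gamma> \<bullet> z + t * (B * (norm z)\<^sup>2))"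
        using t by (simp add: power_mult_distrib power2_eq_square algebra_simps)
      also have "\<dots> < 0" using t t'(3) z by (intro mult_pos_neg) auto
      finally show "\<gamma> \<bullet> (t *\<^sub>R z) + B * (norm (t *\<^sub>R z))\<^sup>2 < 0" .
    qed
    from top[OF this] show ?thesis using t by (simp add: inner_add_left mult_le_0_iff)
  qed
  have \<gamma>: "\<gamma> = norm \<gamma> *\<^sub>R \<theta>"
  proof (rule ccontr)
    assume "\<gamma> \<noteq> norm \<gamma> *\<^sub>R \<theta>"
    then have "\<gamma> \<bullet> \<theta> \<noteq> norm \<gamma> * norm \<theta>" unfolding norm_cauchy_schwarz_eq using \<theta> by simp
    then have lt: "\<gamma> \<bullet> \<theta> < norm \<gamma>" using norm_cauchy_schwarz[of \<gamma> \<theta>] \<theta> by simp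
    \<comment> \<open>Were \<gamma> not a positive multiple of \<theta>, this difference would be
      such a direction and yet have positive inner product with \<theta>.\<close>
    have "\<gamma> \<bullet> (norm \<gamma> *\<^sub>R \<theta> - \<gamma>) = norm \<gamma> * (\<gamma> \<bullet> \<theta> - norm \<gamma>)"
      by (simp add: inner_diff_right right_diff_distrib power2_eq_square flip: power2_norm_eq_inner)
    also have "\<dots> < 0" using lt \<gamma>1 by (intro mult_pos_neg) auto
    finally have "(norm \<gamma> *\<^sub>R \<theta> - \<gamma>) \<bullet> \<theta> \<le> 0" by (rule dir)
    then show False using lt \<theta> by (simp add: inner_diff_left flip: power2_norm_eq_inner)
  qed
  \<comment> \<open>With \<open>\<kappa>\<^sup>2 = 1 / (8 * B)\<close> and
    \<open>s \<le> 1 / (64 * B)\<close> the quadratic term is at most s / 8 + s / 16, below the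
    linear gain s. On the slab the squared norm is at most 5 s, so the other two bounds in
    \<open>s0\<close> place it in the unit ball and in the ball of radius r.\<close>
  define \<kappa> where "\<kappa> = sqrt (1 / (8 * B))"
  have \<kappa>: "\<kappa> > 0" "\<kappa>\<^sup>2 = 1 / (8 * B)" using B by (auto simp: \<kappa>_def)
  define s0 where "s0 = min (1 / (64 * B)) (min (1 / 5) (r\<^sup>2 / 6))"
  have s0: "s0 > 0" using B r by (auto simp: s0_def)
  define V where "V = measure lebesgue (ball (0::real^'n) 1)"
  have V: "0 < V" using content_ball_pos[of 1 "0::real^'n"] by (simp add: V_def)
  define c where "c = \<kappa> ^ 3 * V / (2 * \<kappa> + 3)"
  have c: "c > 0" using V \<kappa>(1) by (simp add: c_def)
  have "\<exists>S\<in>lmeasurable. S \<subseteq> D \<and> (\<forall>x\<in>S. p \<bullet> \<theta> - 2 * s \<le> x \<bullet> \<theta>) \<and> c * s\<^sup>2 \<le> measure lebesgue S"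
    if s: "0 < s" "s \<le> s0" for s
  proof -
    define T where "T = {z. - 2 * s \<le> z \<bullet> \<theta> \<and> z \<bullet> \<theta> \<le> - s \<and> (norm z)\<^sup>2 \<le> (\<kappa> * sqrt s)\<^sup>2 + 4 * s\<^sup>2}"
    have s': "s \<le> 1 / (64 * B)" "s \<le> 1 / 5" "s \<le> r\<^sup>2 / 6" using s by (auto simp: s0_def)
    have sub: "p + z \<in> D" if z: "z \<in> T" for z
    proof (rule inD)
      have nz: "(norm z)\<^sup>2 \<le> \<kappa>\<^sup>2 * s + 4 * s\<^sup>2" using z s by (simp add: T_def power_mult_distrib)
      have "s\<^sup>2 \<le> s" using s s'(2) mult_left_le[of s s] by (simp add: power2_eq_square)
      moreover have "\<kappa>\<^sup>2 \<le> 1" unfolding \<kappa>(2) using B by simp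
      then have "\<kappa>\<^sup>2 * s \<le> s" using s by simp
      ultimately have n5: "(norm z)\<^sup>2 \<le> 5 * s" using nz by linarith
      then have "(norm z)\<^sup>2 \<le> 1\<^sup>2" using s'(2) by simp
      then show "norm z \<le> 1" by (rule power2_le_imp_le) simp
      have "5 * s < r\<^sup>2" using s'(3) r s by simp
      then have "(norm z)\<^sup>2 < r\<^sup>2" using n5 by linarith
      then show "norm z < r" by (rule power2_less_imp_less) (use r in simp)
      have "\<gamma> \<bullet> z = norm \<gamma> * (z \<bullet> \<theta>)" by (subst \<gamma>) (simp add: inner_commute)
      also have "\<dots> \<le> 1 * (z \<bullet> \<theta>)" using z s \<gamma>1 by (intro mult_right_mono_neg) (auto simp: T_def)
      finally have 1: "\<gamma> \<bullet> z \<le> - s" using z by (simp add: T_def)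
      have "B * (norm z)\<^sup>2 \<le> B * (\<kappa>\<^sup>2 * s + 4 * s\<^sup>2)" using nz B by (intro mult_left_mono) auto
      also have "\<dots> = s / 8 + 4 * (B * s) * s" using B \<kappa>(2) by (simp add: field_simps power2_eq_square)
      also have "\<dots> \<le> s / 8 + 4 * (1 / 64) * s"
        using s'(1) s B by (intro add_left_mono mult_right_mono mult_left_mono) (auto simp: field_simps)
      finally show "\<gamma> \<bullet> z + B * (norm z)\<^sup>2 < 0" using 1 s by simp
    qed
    have R: "0 < \<kappa> * sqrt s" using \<kappa>(1) s by simp
    have meas: "T \<in> lmeasurable"
      "measure lebesgue (ball (0::real^'n) (\<kappa> * sqrt s)) \<le> (2 * (\<kappa> * sqrt s) / s + 3) * measure lebesgue T"
      unfolding T_def by (rule slab_volume[OF \<theta> s(1) R])+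
    have "measure lborel (ball (0::real^'n) (\<kappa> * sqrt s)) = (\<kappa> * sqrt s) ^ DIM(real^'n) * measure lborel (ball (0::real^'n) 1)"
      using R by (intro content_ball_conv_unit_ball) simp
    then have "(\<kappa> * sqrt s) ^ 3 * V \<le> (2 * (\<kappa> * sqrt s) / s + 3) * measure lebesgue T"
      using meas(2) n by (simp add: V_def)
    \<comment> \<open>A ball of volume of order s^(3/2) is covered by a number of slabs of order
      s^(-1/2), so one slab has volume of order s^2.\<close>
    also have "\<dots> \<le> ((2 * \<kappa> + 3) / sqrt s) * measure lebesgue T"
    proof (rule mult_right_mono)
      have "sqrt s \<le> 1" using s'(2) by simp
      moreover have "sqrt s / s = 1 / sqrt s" using s by (simp add: field_simps)
      then have "2 * (\<kappa> * sqrt s) / s = 2 * \<kappa> / sqrt s"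
        by (metis mult.assoc mult.right_neutral times_divide_eq_right)
      moreover have "3 \<le> 3 / sqrt s" using \<open>sqrt s \<le> 1\<close> s by (simp add: pos_le_divide_eq)
      ultimately show "2 * (\<kappa> * sqrt s) / s + 3 \<le> (2 * \<kappa> + 3) / sqrt s"
        by (simp add: add_divide_distrib)
    qed simp
    finally have "(\<kappa> * sqrt s) ^ 3 * V * sqrt s \<le> (2 * \<kappa> + 3) * measure lebesgue T"
      using s by (simp add: field_simps)
    moreover have "(\<kappa> * sqrt s) ^ 3 * V * sqrt s = \<kappa> ^ 3 * V * s\<^sup>2"
    proof -
      have "sqrt s ^ 3 * sqrt s = (sqrt s * sqrt s) * (sqrt s * sqrt s)" by (simp only: power3_eq_cube mult.assoc)
      also have "\<dots> = s\<^sup>2" using s by (simp add: power2_eq_square)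
      finally show ?thesis by (simp add: power_mult_distrib algebra_simps)
    qed
    ultimately have "\<kappa> ^ 3 * V * s\<^sup>2 \<le> (2 * \<kappa> + 3) * measure lebesgue T" by (simp only:)
    then have vol: "c * s\<^sup>2 \<le> measure lebesgue T"
      using \<kappa>(1) by (simp add: c_def pos_divide_le_eq mult.commute)
    show ?thesis
    proof (intro bexI conjI)
      show "(+) p ` T \<in> lmeasurable" using meas(1) by (simp add: measurable_translation)
      show "(+) p ` T \<subseteq> D" using sub by auto
      show "\<forall>x\<in>(+) p ` T. p \<bullet> \<theta> - 2 * s \<le> x \<bullet> \<theta>" by (auto simp: inner_add_left T_def)
      show "c * s\<^sup>2 \<le> measure lebesgue ((+) p ` T)" using vol by (simp add: measure_translation)
    qed
  qed
  then show ?thesis using s0 c by (intro exI[of _ c] exI[of _ s0] conjI allI impI) simp_all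
qed

lemma strip_volume:
  fixes D :: "(real^'n::finite) set"
  assumes dim: "CARD('n) = 2 \<or> CARD('n) = 3" and D: "open D" "bounded D" "D \<noteq> {}" and \<theta>: "norm \<theta> = 1"
    and Dbd: "if CARD('n) = 2 then lipschitz_boundary D else C2_boundary D"
  obtains c s0 where "c > 0" "s0 > 0" "\<And>s. 0 < s \<Longrightarrow> s \<le> s0 \<Longrightarrow> \<exists>S\<in>lmeasurable. S \<subseteq> D \<and>
    (\<forall>x\<in>S. support_fn D \<theta> - 2 * s \<le> x \<bullet> \<theta>) \<and> c * s\<^sup>2 \<le> measure lebesgue S"
proof -
  obtain p where p: "p \<in> frontier D" "p \<bullet> \<theta> = support_fn D \<theta>" using support_fn_attained[OF D \<theta>] by blast
  have "\<exists>c>0. \<exists>s0>0. \<forall>s. 0 < s \<and> s \<le> s0 \<longrightarrow> (\<exists>S\<in>lmeasurable. S \<subseteq> D \<and>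
    (\<forall>x\<in>S. p \<bullet> \<theta> - 2 * s \<le> x \<bullet> \<theta>) \<and> c * s\<^sup>2 \<le> measure lebesgue S)"
  proof (cases "CARD('n) = 2")
    case True
    then show ?thesis using Dbd by (intro lipschitz_boundary_strip_volume D \<theta> p) auto
  next
    case False
    then show ?thesis
      using Dbd dim support_fn_upper[OF D(2)] p(2) by (intro C2_boundary_strip_volume D \<theta> p) auto
  qed
  then show thesis using that unfolding p(2) by blast
qed

section \<open>The energy gap\<close>

definition re_vec :: "complex^'n \<Rightarrow> real^'n" where "re_vec z = (\<chi> i. Re (z $ i))"
definition im_vec :: "complex^'n \<Rightarrow> real^'n" where "im_vec z = (\<chi> i. Im (z $ i))"

lemma inner_complex_vec:
  fixes z y :: "complex^'n::finite"
  shows "z \<bullet> y = re_vec z \<bullet> re_vec y + im_vec z \<bullet> im_vec y"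
  by (simp add: inner_vec_def re_vec_def im_vec_def inner_complex_def sum.distrib)

lemma norm_complex_vec:
  fixes z :: "complex^'n::finite"
  shows "(norm z)\<^sup>2 = (norm (re_vec z))\<^sup>2 + (norm (im_vec z))\<^sup>2"
  by (simp add: power2_norm_eq_inner inner_complex_vec)

text \<open>Lagrange's identity: the two squares differ by \<open>(a * d - b * c)\<^sup>2\<close>.
  It recombines real and imaginary parts without losing a factor, so that
  \<open>abs_kform_le\<close> keeps the exact operator bound on which the frequency threshold
  depends.\<close>

lemma two_dim_Cauchy_Schwarz:
  fixes a b c d :: real
  assumes "0 \<le> n" "0 \<le> n'" "a\<^sup>2 + b\<^sup>2 = n\<^sup>2" "c\<^sup>2 + d\<^sup>2 = n'\<^sup>2"
  shows "a * c + b * d \<le> n * n'"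
proof (rule power2_le_imp_le)
  have "(n * n')\<^sup>2 - (a * c + b * d)\<^sup>2 = (a * d - b * c)\<^sup>2"
    unfolding power_mult_distrib assms(3,4)[symmetric] by (simp add: power2_eq_square algebra_simps)
  then show "(a * c + b * d)\<^sup>2 \<le> (n * n')\<^sup>2" by (metis diff_ge_0_iff_ge zero_le_power2)
qed (use assms in simp)

text \<open>With \<open>A = G - i \<omega> E\<close> the real form \<open>Re (A z \<cdot> cnj y)\<close> splits into \<open>sform G z y - \<omega> kform E z y\<close>,
  symmetric respectively antisymmetric in \<open>z\<close> and \<open>y\<close> for symmetric \<open>G\<close> and \<open>E\<close>.\<close>

definition sform :: "real^'n^'n \<Rightarrow> complex^'n::finite \<Rightarrow> complex^'n \<Rightarrow> real" where
  "sform G z y = (G *v re_vec z) \<bullet> re_vec y + (G *v im_vec z) \<bullet> im_vec y"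

definition kform :: "real^'n^'n \<Rightarrow> complex^'n::finite \<Rightarrow> complex^'n \<Rightarrow> real" where
  "kform E z y = (E *v re_vec z) \<bullet> im_vec y - (E *v im_vec z) \<bullet> re_vec y"

lemma coef_form:
  fixes z y :: "complex^'n::finite"
  shows "(coef G E \<omega> x *v z) \<bullet> y = sform (G x) z y - \<omega> * kform (E x) z y"
proof -
  have re: "re_vec (coef G E \<omega> x *v z) = G x *v re_vec z + \<omega> *\<^sub>R (E x *v im_vec z)"
    by (simp add: vec_eq_iff re_vec_def im_vec_def matrix_vector_mult_def coef_def sum.distrib
        sum_distrib_left algebra_simps)
  have im: "im_vec (coef G E \<omega> x *v z) = G x *v im_vec z - \<omega> *\<^sub>R (E x *v re_vec z)"
    by (simp add: vec_eq_iff re_vec_def im_vec_def matrix_vector_mult_def coef_def sum_subtractf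
        sum_distrib_left algebra_simps)
  show ?thesis unfolding inner_complex_vec re im
    by (simp add: sform_def kform_def inner_add_left inner_diff_left algebra_simps)
qed

lemma symmetric_matrix_inner:
  fixes A :: "real^'n^'n"
  assumes "transpose A = A"
  shows "(A *v x) \<bullet> y = (A *v y) \<bullet> x"
  by (metis assms dot_lmul_matrix inner_commute transpose_matrix_vector)

lemma sform_commute: "transpose G = G \<Longrightarrow> sform G z y = sform G y z"
  unfolding sform_def by (metis symmetric_matrix_inner)

lemma kform_anticommute:
  assumes "transpose E = E"
  shows "kform E z y = - kform E y z"
  unfolding kform_def
  using symmetric_matrix_inner[OF assms, of "re_vec z" "im_vec y"]
    symmetric_matrix_inner[OF assms, of "im_vec z" "re_vec y"] by linarith

lemma re_im_vec_add:
  "re_vec (z + y) = re_vec z + re_vec y" "im_vec (z + y) = im_vec z + im_vec y"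
  by (simp_all add: re_vec_def im_vec_def vec_eq_iff)

lemma sform_add: "sform G (z + z') y = sform G z y + sform G z' y"
  by (simp add: sform_def re_im_vec_add matrix_vector_right_distrib inner_add_left)

lemma kform_add: "kform E (z + z') y = kform E z y + kform E z' y"
  by (simp add: kform_def re_im_vec_add matrix_vector_right_distrib inner_add_left)

lemma sform_ge:
  assumes "\<And>\<xi>. m * (norm \<xi>)\<^sup>2 \<le> (G *v \<xi>) \<bullet> \<xi>"
  shows "m * (norm z)\<^sup>2 \<le> sform G z z"
  using assms[of "re_vec z"] assms[of "im_vec z"]
  by (simp add: sform_def norm_complex_vec distrib_left)

lemma sform_le:
  assumes "\<And>\<xi>. (G *v \<xi>) \<bullet> \<xi> \<le> m * (norm \<xi>)\<^sup>2"
  shows "sform G z z \<le> m * (norm z)\<^sup>2"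
  using assms[of "re_vec z"] assms[of "im_vec z"]
  by (simp add: sform_def norm_complex_vec distrib_left)

lemma abs_sform_le:
  fixes z y :: "complex^'n::finite"
  assumes "\<And>\<xi>. norm (G *v \<xi>) \<le> K * norm \<xi>" "0 \<le> K"
  shows "\<bar>sform G z y\<bar> \<le> K * norm z * norm y"
proof -
  have b: "\<bar>(G *v a) \<bullet> c\<bar> \<le> K * (norm a * norm c)" for a c
    using Cauchy_Schwarz_ineq2[of "G *v a" c] mult_right_mono[OF assms(1)[of a] norm_ge_zero[of c]]
    by (simp add: mult.assoc)
  have "\<bar>sform G z y\<bar> \<le> K * (norm (re_vec z) * norm (re_vec y) + norm (im_vec z) * norm (im_vec y))"
    unfolding sform_def distrib_left using b[of "re_vec z" "re_vec y"] b[of "im_vec z" "im_vec y"] by linarith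
  also have "\<dots> \<le> K * (norm z * norm y)"
    by (intro mult_left_mono two_dim_Cauchy_Schwarz assms(2)) (simp_all add: norm_complex_vec)
  finally show ?thesis by (simp add: mult.assoc)
qed

lemma abs_kform_le:
  fixes z y :: "complex^'n::finite"
  assumes "\<And>\<xi>. norm (E *v \<xi>) \<le> K * norm \<xi>" "0 \<le> K"
  shows "\<bar>kform E z y\<bar> \<le> K * norm z * norm y"
proof -
  have b: "\<bar>(E *v a) \<bullet> c\<bar> \<le> K * (norm a * norm c)" for a c
    using Cauchy_Schwarz_ineq2[of "E *v a" c] mult_right_mono[OF assms(1)[of a] norm_ge_zero[of c]]
    by (simp add: mult.assoc)
  have "\<bar>kform E z y\<bar> \<le> K * (norm (re_vec z) * norm (im_vec y) + norm (im_vec z) * norm (re_vec y))"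
    unfolding kform_def distrib_left using b[of "re_vec z" "im_vec y"] b[of "im_vec z" "re_vec y"] by linarith
  also have "\<dots> \<le> K * (norm z * norm y)"
    by (intro mult_left_mono two_dim_Cauchy_Schwarz assms(2)) (simp_all add: norm_complex_vec)
  finally show ?thesis by (simp add: mult.assoc)
qed

lemma sform_mat_1: "sform (mat 1) z y = z \<bullet> y"
  by (simp add: sform_def inner_complex_vec)

lemma kform_0: "kform 0 z y = 0"
  by (simp add: kform_def)

lemma weighted_am_gm:
  fixes a b m k :: real
  assumes "m > 0"
  shows "2 * k * a * b \<le> m * b\<^sup>2 + k\<^sup>2 / m * a\<^sup>2"
proof -
  have "0 \<le> (m * b - k * a)\<^sup>2 / m" using assms by simp
  also have "\<dots> = m * b\<^sup>2 + k\<^sup>2 / m * a\<^sup>2 - 2 * k * a * b"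
    using assms by (simp add: power2_eq_square field_simps)
  finally show ?thesis by simp
qed

text \<open>The data after division by the background admittivity, which makes the coefficient the
  identity off \<open>D\<close>. Here \<open>strip\<close> is the jump condition rewritten for
  \<open>G\<close> itself and \<open>small\<close> is the frequency threshold squared. The bounds
  hold for every \<xi> off one null set, so they can be applied to gradients that vary with
  x.\<close>

locale inclusion =
  fixes U D T :: "(real^'n::finite) set" and G E :: "real^'n \<Rightarrow> real^'n^'n" and K m M C \<omega> :: real
  assumes U: "open U" "bounded U" and sets: "D \<in> sets lebesgue" "T \<in> sets lebesgue" "D \<subseteq> U" "T \<subseteq> D"
    and measG: "\<And>i j. (\<lambda>x. G x $ i $ j) \<in> borel_measurable (lebesgue_on U)"
    and measE: "\<And>i j. (\<lambda>x. E x $ i $ j) \<in> borel_measurable (lebesgue_on U)"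
    and symm: "AE x in lebesgue_on U. transpose (G x) = G x \<and> transpose (E x) = E x"
    and outside: "AE x in lebesgue_on U. x \<notin> D \<longrightarrow> G x = mat 1 \<and> E x = 0"
    and inside: "AE x in lebesgue_on U. x \<in> D \<longrightarrow> (\<forall>\<xi>. m * (norm \<xi>)\<^sup>2 \<le> (G x *v \<xi>) \<bullet> \<xi> \<and>
        norm (G x *v \<xi>) \<le> K * norm \<xi> \<and> norm (E x *v \<xi>) \<le> M * norm \<xi>)"
    and strip: "AE x in lebesgue_on U. x \<in> T \<longrightarrow> (\<forall>\<xi>. (G x *v \<xi>) \<bullet> \<xi> \<le> (1 - C) * (norm \<xi>)\<^sup>2)"
    and pos: "0 < m" "0 < M" "0 \<le> \<omega>" "1 \<le> K" "m \<le> K" and small: "\<omega>\<^sup>2 * M\<^sup>2 < m * C"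
begin

abbreviation A where "A \<equiv> coef G E \<omega>"

text \<open>Bundles the almost-everywhere assumptions at one point, so that the estimates on the
  forms become algebra at a fixed x.\<close>

definition good :: "real^'n \<Rightarrow> bool" where
  "good x \<longleftrightarrow> (transpose (G x) = G x \<and> transpose (E x) = E x) \<and>
     (x \<notin> D \<longrightarrow> G x = mat 1 \<and> E x = 0) \<and>
     (x \<in> D \<longrightarrow> (\<forall>\<xi>. m * (norm \<xi>)\<^sup>2 \<le> (G x *v \<xi>) \<bullet> \<xi> \<and>
        norm (G x *v \<xi>) \<le> K * norm \<xi> \<and> norm (E x *v \<xi>) \<le> M * norm \<xi>)) \<and>
     (x \<in> T \<longrightarrow> (\<forall>\<xi>. (G x *v \<xi>) \<bullet> \<xi> \<le> (1 - C) * (norm \<xi>)\<^sup>2))"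

lemma AE_good: "AE x in lebesgue_on U. good x"
  using symm outside inside strip by eventually_elim (simp add: good_def)

lemma form_bounds:
  assumes "good x" "x \<in> D"
  shows "m * (norm z)\<^sup>2 \<le> sform (G x) z z" "\<bar>sform (G x) z y\<bar> \<le> K * norm z * norm y"
    "\<bar>kform (E x) z y\<bar> \<le> M * norm z * norm y"
  using assms pos by (auto simp: good_def intro!: sform_ge abs_sform_le abs_kform_le)

lemma kform_self: "good x \<Longrightarrow> kform (E x) z z = 0"
  using kform_anticommute[of "E x" z z] by (simp add: good_def)

lemma abs_form_le:
  assumes "good x"
  shows "\<bar>(A x *v z) \<bullet> y\<bar> \<le> (K + \<omega> * M) * norm z * norm y"
proof (cases "x \<in> D")
  case True
  have "\<bar>\<omega> * kform (E x) z y\<bar> = \<omega> * \<bar>kform (E x) z y\<bar>" using pos(3) by (simp add: abs_mult)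
  then have "\<bar>(A x *v z) \<bullet> y\<bar> \<le> \<bar>sform (G x) z y\<bar> + \<omega> * \<bar>kform (E x) z y\<bar>"
    unfolding coef_form by linarith
  also have "\<dots> \<le> K * norm z * norm y + \<omega> * (M * norm z * norm y)"
    by (intro add_mono mult_left_mono form_bounds assms True pos)
  finally show ?thesis by (simp add: algebra_simps)
next
  case False
  then have "(A x *v z) \<bullet> y = z \<bullet> y"
    using assms by (simp add: coef_form good_def sform_mat_1 kform_0)
  also have "\<bar>\<dots>\<bar> \<le> 1 * (norm z * norm y)" using Cauchy_Schwarz_ineq2 by simp
  also have "\<dots> \<le> (K + \<omega> * M) * (norm z * norm y)"
    using pos by (intro mult_right_mono) (auto simp: add_increasing2)
  finally show ?thesis by (simp add: mult.assoc)
qed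

text \<open>On the diagonal \<open>E\<close> drops out by antisymmetry, so coercivity on complex
  vectors is that of \<open>G\<close>: constant m in \<open>D\<close> and 1 outside.\<close>

sublocale elliptic U A "K + \<omega> * M" "min 1 m"
proof
  show "(\<lambda>x. A x $ i $ j) \<in> borel_measurable (lebesgue_on U)" for i j
  proof -
    have [measurable]: "(\<lambda>x. G x $ i $ j) \<in> borel_measurable (lebesgue_on U)" "(\<lambda>x. E x $ i $ j) \<in> borel_measurable (lebesgue_on U)"
      using measG measE by auto
    show ?thesis unfolding coef_def by simp
  qed
  show "AE x in lebesgue_on U. \<forall>z. norm (A x *v z) \<le> (K + \<omega> * M) * norm z"
    using AE_good
  proof eventually_elim
    case (elim x)
    show ?case
    proof
      fix z
      have "norm (A x *v z) * norm (A x *v z) \<le> (K + \<omega> * M) * norm z * norm (A x *v z)"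
        using abs_form_le[OF elim, of z "A x *v z"] by (simp add: power2_eq_square flip: power2_norm_eq_inner)
      then show "norm (A x *v z) \<le> (K + \<omega> * M) * norm z"
        using pos by (cases "norm (A x *v z) = 0") (auto simp: mult_le_cancel_right)
    qed
  qed
  show "AE x in lebesgue_on U. \<forall>z. min 1 m * (norm z)\<^sup>2 \<le> (A x *v z) \<bullet> z"
    using AE_good
  proof eventually_elim
    case (elim x)
    show ?case
    proof
      fix z
      have "min 1 m * (norm z)\<^sup>2 \<le> sform (G x) z z"
      proof (cases "x \<in> D")
        case True
        have "min 1 m * (norm z)\<^sup>2 \<le> m * (norm z)\<^sup>2" by (intro mult_right_mono) auto
        then show ?thesis using form_bounds(1)[OF elim True, of z] by linarith
      next
        case False
        have "min 1 m * (norm z)\<^sup>2 \<le> 1 * (norm z)\<^sup>2" by (intro mult_right_mono) auto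
        then show ?thesis using False elim by (simp add: good_def sform_mat_1 power2_norm_eq_inner)
      qed
      then show "min 1 m * (norm z)\<^sup>2 \<le> (A x *v z) \<bullet> z" by (simp add: coef_form kform_self[OF elim])
    qed
  qed
  show "0 < min 1 m" "min 1 m \<le> K + \<omega> * M" using pos by (auto simp: min_le_iff_disj add_increasing2)
qed (use U in auto)

text \<open>The term paired with q vanishes after integration, so it may be subtracted freely; this
  sign cancels the symmetric cross terms and leaves \<open>- sform (G x) q q\<close> to absorb the
  antisymmetric one.\<close>

lemma form_difference:
  assumes "good x"
  shows "(A x *v (p + q)) \<bullet> p - (A x *v (p + q)) \<bullet> q
    = sform (G x) p p - sform (G x) q q + 2 * \<omega> * kform (E x) p q"
  using sform_commute[of "G x" p q] kform_anticommute[of "E x" q p] kform_self[OF assms] assms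
  by (simp add: coef_form sform_add kform_add good_def algebra_simps)

definition energy :: "(real^'n) set \<Rightarrow> (real^'n \<Rightarrow> complex^'n) \<Rightarrow> real" where
  "energy S P = (\<integral>x. indicator S x * (norm (P x))\<^sup>2 \<partial>\<mu>)"

lemma indicator_integrable:
  assumes "square_integrable \<mu> P" "S \<in> sets lebesgue" "S \<subseteq> U"
  shows "integrable \<mu> (\<lambda>x. indicator S x * (norm (P x))\<^sup>2)"
proof -
  have "S \<in> sets \<mu>" using assms U by (auto simp: sets_restrict_space_iff)
  then show ?thesis using assms(1) integrable_mult_indicator[of S \<mu> "\<lambda>x. (norm (P x))\<^sup>2"]
    by (simp add: square_integrable_def)
qed

text \<open>Off \<open>D\<close> only \<open>- (norm q)\<^sup>2\<close> remains. In \<open>D\<close>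
  the cross term costs \<omega>^2 M^2 / m times the square of \<open>norm p\<close>; in the strip
  the jump gains C against this, while on \<open>D - T\<close> a crude K will do because the
  exponentials are much smaller there.\<close>

lemma difference_upper:
  assumes "good x"
  shows "sform (G x) p p - sform (G x) q q + 2 * \<omega> * kform (E x) p q - (norm p)\<^sup>2
    \<le> (K + \<omega>\<^sup>2 * M\<^sup>2 / m) * (indicator (D - T) x * (norm p)\<^sup>2)
      - (C - \<omega>\<^sup>2 * M\<^sup>2 / m) * (indicator T x * (norm p)\<^sup>2)"
proof (cases "x \<in> D")
  case False
  then have "x \<notin> T" using sets by blast
  then show ?thesis using False assms by (simp add: good_def sform_mat_1 kform_0 power2_norm_eq_inner)
next
  case True
  have "2 * \<omega> * kform (E x) p q \<le> 2 * \<omega> * (M * norm p * norm q)"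
    using form_bounds(3)[OF assms True, of p q] pos(3) by (intro mult_left_mono) auto
  also have "\<dots> \<le> m * (norm q)\<^sup>2 + (\<omega> * M)\<^sup>2 / m * (norm p)\<^sup>2"
    using weighted_am_gm[OF pos(1), of "\<omega> * M" "norm p" "norm q"] by (simp add: algebra_simps)
  also have "\<dots> \<le> sform (G x) q q + \<omega>\<^sup>2 * M\<^sup>2 / m * (norm p)\<^sup>2"
    using form_bounds(1)[OF assms True, of q] by (simp add: power_mult_distrib)
  finally have *: "sform (G x) p p - sform (G x) q q + 2 * \<omega> * kform (E x) p q - (norm p)\<^sup>2
      \<le> sform (G x) p p - (norm p)\<^sup>2 + \<omega>\<^sup>2 * M\<^sup>2 / m * (norm p)\<^sup>2" by simp
  show ?thesis
  proof (cases "x \<in> T")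
    case T: True
    have "sform (G x) p p \<le> (1 - C) * (norm p)\<^sup>2" using assms T by (auto simp: good_def intro!: sform_le)
    then show ?thesis using * T by (simp add: algebra_simps)
  next
    case False
    have "sform (G x) p p \<le> K * (norm p)\<^sup>2"
      using form_bounds(2)[OF assms True, of p p] by (simp add: power2_eq_square)
    moreover have "0 \<le> (norm p)\<^sup>2" by simp
    ultimately have "sform (G x) p p - sform (G x) q q + 2 * \<omega> * kform (E x) p q - (norm p)\<^sup>2
        \<le> K * (norm p)\<^sup>2 + \<omega>\<^sup>2 * M\<^sup>2 / m * (norm p)\<^sup>2" using * by linarith
    then show ?thesis using False True by (simp add: distrib_right)
  qed
qed

text \<open>The cross term is split evenly by \<open>2 * a * b \<le> a\<^sup>2 + b\<^sup>2\<close>;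
  the energy of q that this leaves is controlled through \<open>corrector_pointwise\<close>.\<close>

lemma difference_lower:
  assumes "good x"
  shows "- (1 + \<omega> * M) * (indicator D x * (norm p)\<^sup>2) - (K + \<omega> * M) * (norm q)\<^sup>2
    \<le> sform (G x) p p - sform (G x) q q + 2 * \<omega> * kform (E x) p q - (norm p)\<^sup>2"
proof (cases "x \<in> D")
  case False
  have "(norm q)\<^sup>2 \<le> (K + \<omega> * M) * (norm q)\<^sup>2"
    using pos mult_right_mono[of 1 "K + \<omega> * M" "(norm q)\<^sup>2"] by (simp add: add_increasing2)
  then show ?thesis using False assms by (simp add: good_def sform_mat_1 kform_0 power2_norm_eq_inner)
next
  case True
  have "- kform (E x) p q \<le> M * norm p * norm q" using form_bounds(3)[OF assms True, of p q] by linarith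
  then have "(2 * \<omega>) * (- kform (E x) p q) \<le> (2 * \<omega>) * (M * norm p * norm q)"
    by (rule mult_left_mono) (use pos(3) in simp)
  then have "- (2 * \<omega> * kform (E x) p q) \<le> 2 * \<omega> * (M * norm p * norm q)"
    by (simp only: mult_minus_right)
  also have "2 * \<omega> * (M * norm p * norm q) = (\<omega> * M) * (2 * norm p * norm q)" by simp
  also have "\<dots> \<le> (\<omega> * M) * ((norm p)\<^sup>2 + (norm q)\<^sup>2)"
    by (intro mult_left_mono sum_squares_bound) (use pos in simp)
  also have "\<dots> = \<omega> * M * (norm p)\<^sup>2 + \<omega> * M * (norm q)\<^sup>2" by (simp only: distrib_left)
  finally have "- (2 * \<omega> * kform (E x) p q) \<le> \<omega> * M * (norm p)\<^sup>2 + \<omega> * M * (norm q)\<^sup>2" .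
  moreover have "sform (G x) q q \<le> K * (norm q)\<^sup>2"
    using form_bounds(2)[OF assms True, of q q] by (simp add: power2_eq_square)
  moreover have "0 \<le> sform (G x) p p"
    by (rule order_trans[OF _ form_bounds(1)[OF assms True, of p]]) (use pos in simp)
  ultimately show ?thesis using True by (simp add: algebra_simps)
qed

text \<open>For the true corrector the right side integrates to zero, so this bounds the energy of q
  by that of p inside \<open>D\<close> alone, the only place where \<open>A\<close> differs from the
  identity. The factor \<open>K + \<omega> * M + 1\<close> bounds that difference, and half of m
  survives Young's inequality.\<close>

lemma corrector_pointwise:
  assumes "good x"
  shows "min 1 (m / 2) * (norm q)\<^sup>2 - (K + \<omega> * M + 1)\<^sup>2 / (2 * m) * (indicator D x * (norm p)\<^sup>2)
    \<le> (A x *v (p + q)) \<bullet> q - p \<bullet> q"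
proof (cases "x \<in> D")
  case False
  have "min 1 (m / 2) * (norm q)\<^sup>2 \<le> 1 * (norm q)\<^sup>2" by (intro mult_right_mono) auto
  then show ?thesis using False assms
    by (simp add: good_def coef_form sform_mat_1 kform_0 power2_norm_eq_inner inner_add_left)
next
  case True
  have "min 1 (m / 2) * (norm q)\<^sup>2 \<le> m / 2 * (norm q)\<^sup>2" by (intro mult_right_mono) auto
  moreover have "m * (norm q)\<^sup>2 \<le> (A x *v q) \<bullet> q"
    using form_bounds(1)[OF assms True, of q] by (simp add: coef_form kform_self[OF assms])
  moreover have "- ((A x *v p) \<bullet> q - p \<bullet> q) \<le> m / 2 * (norm q)\<^sup>2 + (K + \<omega> * M + 1)\<^sup>2 / (2 * m) * (norm p)\<^sup>2"
  proof -
    have "- ((A x *v p) \<bullet> q - p \<bullet> q) \<le> (K + \<omega> * M) * norm p * norm q + norm p * norm q"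
      using abs_form_le[OF assms, of p q] Cauchy_Schwarz_ineq2[of p q] by linarith
    also have "\<dots> = (2 * (K + \<omega> * M + 1) * norm p * norm q) / 2" by (simp add: algebra_simps)
    also have "\<dots> \<le> (m * (norm q)\<^sup>2 + (K + \<omega> * M + 1)\<^sup>2 / m * (norm p)\<^sup>2) / 2"
      by (intro divide_right_mono weighted_am_gm pos) simp
    finally show ?thesis by (simp add: field_simps)
  qed
  ultimately show ?thesis using True by (simp add: matrix_vector_right_distrib inner_add_left)
qed

lemma energy_gap:
  assumes F: "H1 U F P" and harmonic: "\<And>r. r \<in> ptest U \<Longrightarrow> (\<integral>x. P x \<bullet> pgrad r x \<partial>\<mu>) = 0"
    and sol: "weak_sol U A F u Du"
  defines "J \<equiv> (\<integral>x. (A x *v Du x) \<bullet> P x \<partial>\<mu>) - (\<integral>x. P x \<bullet> P x \<partial>\<mu>)"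
  shows "J \<le> (K + \<omega>\<^sup>2 * M\<^sup>2 / m) * energy (D - T) P - (C - \<omega>\<^sup>2 * M\<^sup>2 / m) * energy T P"
    and "- (1 + \<omega> * M + (K + \<omega> * M) * ((K + \<omega> * M + 1)\<^sup>2 / (2 * m) / min 1 (m / 2))) * energy D P \<le> J"
proof -
  define Q where "Q x = Du x - P x" for x
  have Du: "Du x = P x + Q x" for x by (simp add: Q_def)
  have P: "square_integrable \<mu> P" using F by (simp add: H1_iff)
  have sDu: "square_integrable \<mu> Du" using sol by (simp add: weak_sol_iff H1_iff)
  have Q: "square_integrable \<mu> Q" unfolding Q_def by (intro square_integrable_diff P sDu)
  note AD = square_integrable_A(1)[OF sDu]
  note i = square_integrable_inner[OF AD P] square_integrable_inner[OF AD Q]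
    square_integrable_inner[OF P P] square_integrable_inner[OF P Q] square_integrable_inner[OF Q Q]
  \<comment> \<open>Both A Du and the harmonic gradient \<open>P\<close> annihilate test gradients,
    hence also \<open>Q\<close>, the gradient of an element of \<open>H10\<close>.\<close>
  have o1: "(\<integral>x. (A x *v Du x) \<bullet> Q x \<partial>\<mu>) = 0"
    unfolding Q_def by (rule weak_sol_orthogonal[OF sol F AD]) (use sol in \<open>auto simp: weak_sol_iff\<close>)
  have o2: "(\<integral>x. P x \<bullet> Q x \<partial>\<mu>) = 0"
    unfolding Q_def by (rule weak_sol_orthogonal[OF sol F P harmonic])
  define f where "f x = (A x *v Du x) \<bullet> P x - (A x *v Du x) \<bullet> Q x - P x \<bullet> P x" for x
  have fi: "integrable \<mu> f" unfolding f_def using i by simp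
  have J: "J = (\<integral>x. f x \<partial>\<mu>)" unfolding J_def f_def using i o1 by simp
  have f: "AE x in \<mu>. f x = sform (G x) (P x) (P x) - sform (G x) (Q x) (Q x)
      + 2 * \<omega> * kform (E x) (P x) (Q x) - (norm (P x))\<^sup>2"
    using AE_good
    by eventually_elim (simp add: f_def Du form_difference power2_norm_eq_inner)
  have ind: "integrable \<mu> (\<lambda>x. indicator D x * (norm (P x))\<^sup>2)" "integrable \<mu> (\<lambda>x. indicator T x * (norm (P x))\<^sup>2)"
    "integrable \<mu> (\<lambda>x. indicator (D - T) x * (norm (P x))\<^sup>2)" "integrable \<mu> (\<lambda>x. (norm (Q x))\<^sup>2)"
    using sets P Q by (auto intro!: indicator_integrable simp: square_integrable_def)
  have "J \<le> (\<integral>x. (K + \<omega>\<^sup>2 * M\<^sup>2 / m) * (indicator (D - T) x * (norm (P x))\<^sup>2)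
      - (C - \<omega>\<^sup>2 * M\<^sup>2 / m) * (indicator T x * (norm (P x))\<^sup>2) \<partial>\<mu>)"
    unfolding J
  proof (rule integral_mono_AE[OF fi])
    show "AE x in \<mu>. f x \<le> (K + \<omega>\<^sup>2 * M\<^sup>2 / m) * (indicator (D - T) x * (norm (P x))\<^sup>2)
      - (C - \<omega>\<^sup>2 * M\<^sup>2 / m) * (indicator T x * (norm (P x))\<^sup>2)"
      using f AE_good by eventually_elim (simp only: difference_upper)
  qed (use ind in auto)
  then show "J \<le> (K + \<omega>\<^sup>2 * M\<^sup>2 / m) * energy (D - T) P - (C - \<omega>\<^sup>2 * M\<^sup>2 / m) * energy T P"
    unfolding energy_def using ind by simp
  define a where "a = min 1 (m / 2)"
  define b where "b = (K + \<omega> * M + 1)\<^sup>2 / (2 * m)"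
  have "(\<integral>x. a * (norm (Q x))\<^sup>2 - b * (indicator D x * (norm (P x))\<^sup>2) \<partial>\<mu>)
      \<le> (\<integral>x. (A x *v Du x) \<bullet> Q x - P x \<bullet> Q x \<partial>\<mu>)"
  proof (rule integral_mono_AE)
    show "AE x in \<mu>. a * (norm (Q x))\<^sup>2 - b * (indicator D x * (norm (P x))\<^sup>2) \<le> (A x *v Du x) \<bullet> Q x - P x \<bullet> Q x"
      using AE_good unfolding Du a_def b_def by eventually_elim (rule corrector_pointwise)
  qed (use ind i in auto)
  then have "a * (\<integral>x. (norm (Q x))\<^sup>2 \<partial>\<mu>) \<le> b * energy D P"
    using ind i o1 o2 by (simp add: energy_def)
  moreover have "a > 0" using pos by (simp add: a_def)
  ultimately have q: "(\<integral>x. (norm (Q x))\<^sup>2 \<partial>\<mu>) \<le> b / a * energy D P" by (simp add: field_simps)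
  have "(\<integral>x. - (1 + \<omega> * M) * (indicator D x * (norm (P x))\<^sup>2) - (K + \<omega> * M) * (norm (Q x))\<^sup>2 \<partial>\<mu>) \<le> J"
    unfolding J
  proof (rule integral_mono_AE[OF _ fi])
    show "AE x in \<mu>. - (1 + \<omega> * M) * (indicator D x * (norm (P x))\<^sup>2) - (K + \<omega> * M) * (norm (Q x))\<^sup>2 \<le> f x"
      using f AE_good by eventually_elim (simp only: difference_lower)
  qed (use ind in auto)
  then have "- ((1 + \<omega> * M) * energy D P) - (K + \<omega> * M) * (\<integral>x. (norm (Q x))\<^sup>2 \<partial>\<mu>) \<le> J"
    unfolding energy_def using ind by (simp add: left_diff_distrib distrib_right)
  moreover have "(K + \<omega> * M) * (\<integral>x. (norm (Q x))\<^sup>2 \<partial>\<mu>) \<le> (K + \<omega> * M) * (b / a * energy D P)"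
    using q pos by (intro mult_left_mono) auto
  ultimately have "- ((1 + \<omega> * M) * energy D P + (K + \<omega> * M) * (b / a * energy D P)) \<le> J" by linarith
  moreover have "(1 + \<omega> * M) * energy D P + (K + \<omega> * M) * (b / a * energy D P)
      = (1 + \<omega> * M + (K + \<omega> * M) * (b / a)) * energy D P"
    by (simp only: distrib_right mult.assoc)
  ultimately show "- (1 + \<omega> * M + (K + \<omega> * M) * ((K + \<omega> * M + 1)\<^sup>2 / (2 * m) / min 1 (m / 2))) * energy D P \<le> J"
    unfolding a_def[symmetric] b_def[symmetric] by (simp only: mult_minus_left)
qed

end

section \<open>Exponential harmonic functions\<close>

lemma continuous_square_integrable:
  fixes f :: "'a::euclidean_space \<Rightarrow> 'b::euclidean_space"
  assumes "continuous_on UNIV f" "open U" "bounded U"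
  shows "square_integrable (lebesgue_on U) f"
proof -
  interpret finite_measure "lebesgue_on U" by (rule finite_measure_lebesgue_on_bounded[OF assms(2,3)])
  have m: "f \<in> borel_measurable (lebesgue_on U)"
    using continuous_imp_lebesgue_measurable[OF assms(1)] by (rule measurable_restrict_space1)
  have "compact (f ` closure U)"
    using assms by (intro compact_continuous_image) (auto intro: continuous_on_subset simp: compact_closure)
  then obtain B where B: "\<And>x. x \<in> closure U \<Longrightarrow> norm (f x) \<le> B"
    using compact_imp_bounded by (fastforce simp: bounded_iff)
  have "norm ((norm (f x))\<^sup>2) \<le> B\<^sup>2" if "x \<in> U" for x
    using B[of x] that closure_subset[of U] by (auto intro!: power_mono)
  then have "AE x in lebesgue_on U. norm ((norm (f x))\<^sup>2) \<le> B\<^sup>2" by (intro AE_I2) simp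
  then have "integrable (lebesgue_on U) (\<lambda>x. (norm (f x))\<^sup>2)"
    using m by (intro integrable_const_bound) auto
  then show ?thesis using m by (simp add: square_integrable_def)
qed

definition cgo_grad :: "real^'n::finite \<Rightarrow> real^'n \<Rightarrow> real \<Rightarrow> real^'n \<Rightarrow> complex^'n" where
  "cgo_grad \<theta> \<theta>p \<tau> x = (\<chi> i. complex_of_real \<tau> * (complex_of_real (\<theta> $ i) + \<i> * complex_of_real (\<theta>p $ i)) * cgo \<theta> \<theta>p \<tau> x)"

lemma cgo_has_derivative:
  "(cgo \<theta> \<theta>p \<tau> has_derivative (\<lambda>h. complex_of_real \<tau> * (complex_of_real (h \<bullet> \<theta>) + \<i> * complex_of_real (h \<bullet> \<theta>p))
    * cgo \<theta> \<theta>p \<tau> x)) (at x)"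
proof -
  have "((\<lambda>x. complex_of_real \<tau> * (complex_of_real (x \<bullet> \<theta>) + \<i> * complex_of_real (x \<bullet> \<theta>p))) has_derivative
     (\<lambda>h. complex_of_real \<tau> * (complex_of_real (h \<bullet> \<theta>) + \<i> * complex_of_real (h \<bullet> \<theta>p)))) (at x)"
    by (intro has_derivative_mult_right has_derivative_add has_derivative_of_real
        has_derivative_inner_left has_derivative_ident)
  moreover have "(exp has_derivative (*) (cgo \<theta> \<theta>p \<tau> x))
      (at (complex_of_real \<tau> * (complex_of_real (x \<bullet> \<theta>) + \<i> * complex_of_real (x \<bullet> \<theta>p))))"
    unfolding cgo_def using DERIV_exp by (simp add: has_field_derivative_def)
  ultimately show ?thesis
    unfolding cgo_def[abs_def] using has_derivative_compose by (fastforce simp: mult.commute)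
qed

lemma continuous_cgo: "continuous_on UNIV (cgo \<theta> \<theta>p \<tau>)"
  by (meson cgo_has_derivative continuous_at_imp_continuous_on has_derivative_continuous)

lemma continuous_cgo_grad: "continuous_on UNIV (\<lambda>x. cgo_grad \<theta> \<theta>p \<tau> x $ i)"
  unfolding cgo_grad_def by (auto intro!: continuous_intros continuous_cgo)

lemma H1_cgo:
  fixes U :: "(real^'n::finite) set"
  assumes "open U" "bounded U"
  shows "H1 U (cgo \<theta> \<theta>p \<tau>) (cgo_grad \<theta> \<theta>p \<tau>)"
  unfolding H1_iff
proof (intro conjI allI impI)
  show "square_integrable (lebesgue_on U) (cgo \<theta> \<theta>p \<tau>)"
    by (intro continuous_square_integrable continuous_cgo assms)
  show "square_integrable (lebesgue_on U) (cgo_grad \<theta> \<theta>p \<tau>)"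
    unfolding square_integrable_component
    by (intro allI continuous_square_integrable continuous_cgo_grad assms)
  fix \<phi> i assume \<phi>: "test_fun U \<phi>"
  have ax: "axis i 1 \<bullet> v = v $ i" for v :: "real^'n" by (simp add: inner_axis' )
  have c: "continuous_on UNIV (\<lambda>x. complex_of_real \<tau> *
      (complex_of_real (axis i 1 \<bullet> \<theta>) + \<i> * complex_of_real (axis i 1 \<bullet> \<theta>p)) * cgo \<theta> \<theta>p \<tau> x)"
    using continuous_cgo_grad[of \<theta> \<theta>p \<tau> i] by (simp add: ax cgo_grad_def)
  show "(\<integral>x. cgo \<theta> \<theta>p \<tau> x * complex_of_real (pd i \<phi> x) \<partial>lebesgue_on U)
      = - (\<integral>x. cgo_grad \<theta> \<theta>p \<tau> x $ i * complex_of_real (\<phi> x) \<partial>lebesgue_on U)"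
    using integral_by_parts_test_fun[OF assms(1) cgo_has_derivative c \<phi>] by (simp add: ax cgo_grad_def)
qed

text \<open>The complex vector \<zeta> = \<tau> (\<theta> + i \<theta>p) has bilinear square zero
  because the two directions are orthonormal, and one integration by parts brings out exactly this
  factor.\<close>

lemma cgo_harmonic:
  fixes U :: "(real^'n::finite) set"
  assumes U: "open U" "bounded U" and d: "norm \<theta> = 1" "norm \<theta>p = 1" "\<theta> \<bullet> \<theta>p = 0" and r: "r \<in> ptest U"
  shows "(\<integral>x. cgo_grad \<theta> \<theta>p \<tau> x \<bullet> pgrad r x \<partial>lebesgue_on U) = 0"
proof -
  let ?M = "lebesgue_on U" and ?v = "cgo \<theta> \<theta>p \<tau>"
  define \<zeta> where "\<zeta> i = complex_of_real \<tau> * (complex_of_real (\<theta> $ i) + \<i> * complex_of_real (\<theta>p $ i))" for i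
  have g: "cgo_grad \<theta> \<theta>p \<tau> x $ i = \<zeta> i * ?v x" for x i by (simp add: cgo_grad_def \<zeta>_def)
  have v: "square_integrable ?M ?v" and gs: "square_integrable ?M (cgo_grad \<theta> \<theta>p \<tau>)"
    using H1_cgo[OF U, of \<theta> \<theta>p \<tau>] by (auto simp: H1_iff)
  have z: "(\<Sum>i\<in>UNIV. \<zeta> i * \<zeta> i) = 0"
  proof -
    have "(\<Sum>i\<in>UNIV. \<theta> $ i * \<theta> $ i) = 1" "(\<Sum>i\<in>UNIV. \<theta>p $ i * \<theta>p $ i) = 1" "(\<Sum>i\<in>UNIV. \<theta> $ i * \<theta>p $ i) = 0"
      using d by (simp_all add: inner_vec_def norm_eq_1)
    moreover have "Re (\<zeta> i * \<zeta> i) = \<tau>\<^sup>2 * (\<theta> $ i * \<theta> $ i) - \<tau>\<^sup>2 * (\<theta>p $ i * \<theta>p $ i)"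
      "Im (\<zeta> i * \<zeta> i) = 2 * \<tau>\<^sup>2 * (\<theta> $ i * \<theta>p $ i)" for i
      by (simp_all add: \<zeta>_def power2_eq_square algebra_simps)
    ultimately show ?thesis
      unfolding complex_eq_iff Re_sum Im_sum
      by (simp only: sum_subtractf sum_distrib_left[symmetric]) simp
  qed
  have "(\<integral>x. (\<Sum>i\<in>UNIV. cgo_grad \<theta> \<theta>p \<tau> x $ i * complex_of_real (pd i \<phi> x)) \<partial>?M) = 0" if \<phi>: "test_fun U \<phi>" for \<phi>
  proof -
    have i: "integrable ?M (\<lambda>x. ?v x * complex_of_real (pd i \<phi> x))" for i
      by (intro square_integrable_mult_of_real v test_fun_square_integrable test_fun_pd \<phi> U)
    have ibp: "(\<integral>x. ?v x * complex_of_real (pd i \<phi> x) \<partial>?M) = - (\<zeta> i * (\<integral>x. ?v x * complex_of_real (\<phi> x) \<partial>?M))" for i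
      using H1_cgo[OF U, of \<theta> \<theta>p \<tau>] \<phi> by (simp add: H1_iff g mult.assoc)
    have "(\<integral>x. (\<Sum>i\<in>UNIV. cgo_grad \<theta> \<theta>p \<tau> x $ i * complex_of_real (pd i \<phi> x)) \<partial>?M)
        = (\<Sum>i\<in>UNIV. \<zeta> i * (\<integral>x. ?v x * complex_of_real (pd i \<phi> x) \<partial>?M))"
      using i by (simp add: g mult.assoc)
    also have "\<dots> = - ((\<Sum>i\<in>UNIV. \<zeta> i * \<zeta> i) * (\<integral>x. ?v x * complex_of_real (\<phi> x) \<partial>?M))"
      by (simp add: ibp sum_distrib_right sum_negf mult.assoc)
    finally show ?thesis by (simp add: z)
  qed
  then show ?thesis using weak_equation_iff[OF U(1) gs] r by blast
qed

lemma norm_cgo_grad: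
  assumes "norm \<theta> = 1" "norm \<theta>p = 1"
  shows "(norm (cgo_grad \<theta> \<theta>p \<tau> x))\<^sup>2 = 2 * \<tau>\<^sup>2 * exp (2 * \<tau> * (x \<bullet> \<theta>))"
proof -
  have v: "(cmod (cgo \<theta> \<theta>p \<tau> x))\<^sup>2 = exp (2 * \<tau> * (x \<bullet> \<theta>))"
    by (simp add: cgo_def power2_eq_square flip: exp_add)
  have "(norm (cgo_grad \<theta> \<theta>p \<tau> x))\<^sup>2 = (\<Sum>i\<in>UNIV. (cmod (cgo_grad \<theta> \<theta>p \<tau> x $ i))\<^sup>2)"
    by (simp add: norm_vec_def L2_set_def sum_nonneg)
  also have "\<dots> = (\<Sum>i\<in>UNIV. \<tau>\<^sup>2 * exp (2 * \<tau> * (x \<bullet> \<theta>)) * (\<theta> $ i * \<theta> $ i) + \<tau>\<^sup>2 * exp (2 * \<tau> * (x \<bullet> \<theta>)) * (\<theta>p $ i * \<theta>p $ i))"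
  proof (rule sum.cong[OF refl])
    fix i
    have "(cmod (complex_of_real (\<theta> $ i) + \<i> * complex_of_real (\<theta>p $ i)))\<^sup>2 = \<theta> $ i * \<theta> $ i + \<theta>p $ i * \<theta>p $ i"
      by (simp add: cmod_power2) (simp add: power2_eq_square)
    then show "(cmod (cgo_grad \<theta> \<theta>p \<tau> x $ i))\<^sup>2 = \<tau>\<^sup>2 * exp (2 * \<tau> * (x \<bullet> \<theta>)) * (\<theta> $ i * \<theta> $ i)
        + \<tau>\<^sup>2 * exp (2 * \<tau> * (x \<bullet> \<theta>)) * (\<theta>p $ i * \<theta>p $ i)"
      by (simp add: cgo_grad_def norm_mult power_mult_distrib v) (simp add: distrib_left mult_ac)
  qed
  also have "\<dots> = \<tau>\<^sup>2 * exp (2 * \<tau> * (x \<bullet> \<theta>)) * (\<theta> \<bullet> \<theta>) + \<tau>\<^sup>2 * exp (2 * \<tau> * (x \<bullet> \<theta>)) * (\<theta>p \<bullet> \<theta>p)"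
    by (simp add: sum.distrib sum_distrib_left inner_vec_def)
  finally show ?thesis using assms by (simp add: norm_eq_1)
qed

lemma cgrad_cnj_cgo: "cgrad (\<lambda>x. cnj (cgo \<theta> \<theta>p \<tau> x)) x $ i = cnj (cgo_grad \<theta> \<theta>p \<tau> x $ i)"
proof -
  have "((\<lambda>x. cnj (cgo \<theta> \<theta>p \<tau> x)) has_derivative (\<lambda>h. cnj (complex_of_real \<tau> *
      (complex_of_real (h \<bullet> \<theta>) + \<i> * complex_of_real (h \<bullet> \<theta>p)) * cgo \<theta> \<theta>p \<tau> x))) (at x)"
    by (rule bounded_linear.has_derivative[OF bounded_linear_cnj cgo_has_derivative])
  from has_derivative_imp_pd[OF this, of i] show ?thesis
    by (simp add: cgrad_def cgo_grad_def inner_axis')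
qed

lemma square_integrable_mult_cnj:
  fixes f g :: "'a \<Rightarrow> complex"
  assumes "square_integrable M f" "square_integrable M g"
  shows "integrable M (\<lambda>x. f x * cnj (g x))"
    "Re (\<integral>x. f x * cnj (g x) \<partial>M) = (\<integral>x. f x \<bullet> g x \<partial>M)"
proof -
  have g: "square_integrable M (\<lambda>x. \<i> * g x)"
    using assms(2) by (auto simp: square_integrable_def norm_mult)
  note i = square_integrable_inner[OF assms] square_integrable_inner[OF assms(1) g]
  have e: "f x * cnj (g x) = complex_of_real (f x \<bullet> g x) + \<i> * complex_of_real (f x \<bullet> (\<i> * g x))" for x
    by (simp add: complex_eq_iff inner_complex_def)
  show "integrable M (\<lambda>x. f x * cnj (g x))"
    unfolding e by (intro Bochner_Integration.integrable_add integrable_mult_right integrable_of_real i)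
  have "(\<integral>x. f x * cnj (g x) \<partial>M) = complex_of_real (\<integral>x. f x \<bullet> g x \<partial>M)
      + \<i> * complex_of_real (\<integral>x. f x \<bullet> (\<i> * g x) \<partial>M)"
    unfolding e using i by simp
  then show "Re (\<integral>x. f x * cnj (g x) \<partial>M) = (\<integral>x. f x \<bullet> g x \<partial>M)" by simp
qed

text \<open>The conjugate in the second argument makes the bilinear pairing Hermitian, and the real
  part of the Hermitian product is the real inner product on complex vectors.\<close>

lemma (in elliptic) Re_dn_pair_cgo:
  assumes "weak_sol U A (cgo \<theta> \<theta>p \<tau>) u Du"
  shows "Re (dn_pair U A (cgo \<theta> \<theta>p \<tau>) (\<lambda>x. cnj (cgo \<theta> \<theta>p \<tau> x)))
    = (\<integral>x. (A x *v Du x) \<bullet> cgo_grad \<theta> \<theta>p \<tau> x \<partial>\<mu>)"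
proof -
  let ?P = "cgo_grad \<theta> \<theta>p \<tau>"
  have H: "H1 U (cgo \<theta> \<theta>p \<tau>) ?P" by (rule H1_cgo[OF U])
  have P: "square_integrable \<mu> (\<lambda>x. ?P x $ i)" for i using H by (auto simp: H1_iff square_integrable_component)
  have Z: "square_integrable \<mu> (\<lambda>x. (A x *v Du x) $ i)" for i
    using square_integrable_A(1)[of Du] assms
    by (auto simp: weak_sol_iff H1_iff square_integrable_component[of _ "\<lambda>x. A x *v Du x"])
  have "dn_pair U A (cgo \<theta> \<theta>p \<tau>) (\<lambda>x. cnj (cgo \<theta> \<theta>p \<tau> x))
      = (\<integral>x. (\<Sum>i\<in>UNIV. (A x *v Du x) $ i * cnj (?P x $ i)) \<partial>\<mu>)"
  proof (subst dn_pair_eq[OF assms H])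
    have "(\<lambda>x. cnj (?P x $ i)) \<in> borel_measurable \<mu>" for i
      using P[of i] borel_measurable_continuous_on[of cnj "\<lambda>x. ?P x $ i" \<mu>]
      by (simp add: square_integrable_def continuous_on_cnj)
    then show "(\<lambda>x. cgrad (\<lambda>x. cnj (cgo \<theta> \<theta>p \<tau> x)) x $ i) \<in> borel_measurable \<mu>" for i
      by (simp add: cgrad_cnj_cgo)
  qed (simp add: cgrad_cnj_cgo)
  then show ?thesis
    using square_integrable_mult_cnj[OF Z P] square_integrable_inner[OF Z P]
    by (simp add: inner_vec_def)
qed

text \<open>For the identity coefficient the exponential is its own weak solution, with zero
  corrector.\<close>

lemma Re_dn_pair_identity:
  fixes U :: "(real^'n::finite) set"
  assumes U: "open U" "bounded U" and d: "norm \<theta> = 1" "norm \<theta>p = 1" "\<theta> \<bullet> \<theta>p = 0"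
  shows "Re (dn_pair U (coef (\<lambda>x. mat 1) (\<lambda>x. 0) \<omega>) (cgo \<theta> \<theta>p \<tau>) (\<lambda>x. cnj (cgo \<theta> \<theta>p \<tau> x)))
    = (\<integral>x. cgo_grad \<theta> \<theta>p \<tau> x \<bullet> cgo_grad \<theta> \<theta>p \<tau> x \<partial>lebesgue_on U)"
proof -
  have c: "coef (\<lambda>x. mat 1) (\<lambda>x. 0) \<omega> = (\<lambda>x::real^'n. mat 1)"
    by (simp add: fun_eq_iff coef_def mat_def vec_eq_iff)
  interpret I: elliptic U "\<lambda>x::real^'n. mat 1" 1 1
    by unfold_locales (use U in \<open>auto simp: power2_norm_eq_inner\<close>)
  have "H10 U (\<lambda>x::real^'n. 0)"
  proof -
    have "((\<lambda>x. 0), (\<lambda>x. 0)) \<in> ptest U" by (simp add: ptest_def test_fun_zero)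
    from H1_pfun[OF U(1) this] have H: "H1 U (\<lambda>x. 0) (pgrad ((\<lambda>x. 0), (\<lambda>x. 0)))"
      by (simp add: pfun_def[abs_def])
    show ?thesis unfolding H10_iff[OF U(1)]
      by (rule exI[of _ "pgrad ((\<lambda>x. 0), (\<lambda>x. 0))"], rule exI[of _ "\<lambda>k. ((\<lambda>x. 0), (\<lambda>x. 0))"])
        (use H in \<open>simp add: ptest_def test_fun_zero pfun_def l2norm_def\<close>)
  qed
  then have "weak_sol U (\<lambda>x. mat 1) (cgo \<theta> \<theta>p \<tau>) (cgo \<theta> \<theta>p \<tau>) (cgo_grad \<theta> \<theta>p \<tau>)"
    unfolding I.weak_sol_iff using H1_cgo[OF U] cgo_harmonic[OF U d] by simp
  from I.Re_dn_pair_cgo[OF this] show ?thesis by (simp add: c)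
qed

section \<open>Asymptotics of the indicator function\<close>

text \<open>Exchanges quantifiers: countably many null sets, one for each point of a dense set, make
  a single null set, and continuity extends the inequality to all arguments. It serves for bounds
  that are given for each \<xi> separately.\<close>

lemma AE_all_continuous:
  fixes f :: "'a \<Rightarrow> 'b::second_countable_topology \<Rightarrow> real"
  assumes "\<And>\<xi>. AE x in M. 0 \<le> f x \<xi>" and cont: "\<And>x. continuous_on UNIV (f x)"
  shows "AE x in M. \<forall>\<xi>. 0 \<le> f x \<xi>"
proof -
  obtain X :: "'b set" where X: "countable X" "\<And>Y. open Y \<Longrightarrow> Y \<noteq> {} \<Longrightarrow> \<exists>d\<in>X. d \<in> Y"
    by (rule countable_dense_setE) blast
  have "AE x in M. \<forall>\<xi>\<in>X. 0 \<le> f x \<xi>" using assms(1) X(1) by (simp add: AE_ball_countable)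
  then show ?thesis
  proof eventually_elim
    case (elim x)
    show ?case
    proof (rule ccontr)
      assume "\<not> (\<forall>\<xi>. 0 \<le> f x \<xi>)"
      then have "{\<xi>. f x \<xi> < 0} \<noteq> {}" by (auto simp: not_le)
      moreover have "open {\<xi>. f x \<xi> < 0}" using cont by (intro open_Collect_less) auto
      ultimately obtain d where "d \<in> X" "f x d < 0" using X(2) by blast
      then show False using elim by force
    qed
  qed
qed

lemma continuous_quadratic_form: "continuous_on UNIV (\<lambda>\<xi>. (A *v \<xi>) \<bullet> (\<xi>::real^'n))"
  by (intro continuous_intros matrix_vector_mult_linear_continuous_on)

lemma ess_bounded_mat_norm:
  assumes "ess_bounded_mat U A"
  obtains B where "0 \<le> B" "AE x in lebesgue_on U. \<forall>\<xi>. norm (A x *v \<xi>) \<le> B * norm \<xi>"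
proof -
  have "\<forall>i j. \<exists>B. AE x in lebesgue_on U. \<bar>A x $ i $ j\<bar> \<le> B" using assms by (simp add: ess_bounded_mat_def)
  then obtain b where b: "\<And>i j. AE x in lebesgue_on U. \<bar>A x $ i $ j\<bar> \<le> b i j" by metis
  define B where "B = (\<Sum>i\<in>UNIV. \<Sum>j\<in>UNIV. \<bar>b i j\<bar>)"
  have "AE x in lebesgue_on U. \<forall>i j. \<bar>A x $ i $ j\<bar> \<le> b i j" using b by (simp add: AE_all_countable)
  then have "AE x in lebesgue_on U. \<forall>\<xi>. norm (A x *v \<xi>) \<le> B * norm \<xi>"
  proof eventually_elim
    case (elim x)
    have "onorm ((*v) (A x)) \<le> (\<Sum>i\<in>UNIV. \<Sum>j\<in>UNIV. \<bar>A x $ i $ j\<bar>)" by (rule onorm_le_matrix_component_sum)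
    also have "\<dots> \<le> B" unfolding B_def using elim by (intro sum_mono) (meson abs_ge_self order_trans)
    finally have "onorm ((*v) (A x)) \<le> B" .
    then show ?case
      using onorm[OF matrix_vector_mul_bounded_linear[of "A x"]]
      by (meson mult_right_mono norm_ge_zero order_trans)
  qed
  then show thesis using that[of B] by (simp add: B_def sum_nonneg)
qed

text \<open>A real supremum is informative only once the set is known to be bounded, which the
  operator norm provides; homogeneity then passes from the unit ball to all \<xi>.\<close>

lemma SUP_cball_norm_le:
  fixes X :: "real^'n::finite^'n"
  assumes "(SUP \<xi>\<in>cball 0 1. norm (X *v \<xi>)) \<le> M"
  shows "norm (X *v \<xi>) \<le> M * norm \<xi>"
proof -
  have lin: "bounded_linear ((*v) X)" by (rule matrix_vector_mul_bounded_linear)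
  have bdd: "bdd_above ((\<lambda>\<xi>. norm (X *v \<xi>)) ` cball 0 1)"
  proof (rule bdd_aboveI2)
    fix \<eta> :: "real^'n" assume "\<eta> \<in> cball 0 1"
    then have "onorm ((*v) X) * norm \<eta> \<le> onorm ((*v) X) * 1"
      by (intro mult_left_mono onorm_pos_le[OF lin]) simp
    then show "norm (X *v \<eta>) \<le> onorm ((*v) X)" using onorm[OF lin, of \<eta>] by simp
  qed
  have unit: "norm (X *v \<eta>) \<le> M" if "norm \<eta> \<le> 1" for \<eta>
    using order_trans[OF cSUP_upper[OF _ bdd, of \<eta>] assms] that by simp
  show ?thesis
  proof (cases "\<xi> = 0")
    case False
    then have "norm (X *v (\<xi> /\<^sub>R norm \<xi>)) \<le> M" by (intro unit) simp
    then show ?thesis using False by (simp add: matrix_vector_mult_scaleR field_simps)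
  qed simp
qed

lemma square_times_exp_tendsto_0:
  fixes K a :: real
  assumes a: "a > 0"
  shows "((\<lambda>\<tau>. K * \<tau>\<^sup>2 * exp (- (a * \<tau>))) \<longlongrightarrow> 0) at_top"
proof -
  have "filterlim (\<lambda>\<tau>. a * \<tau>) at_top at_top"
    by (intro filterlim_tendsto_pos_mult_at_top[OF tendsto_const a] filterlim_ident)
  from filterlim_compose[OF tendsto_power_div_exp_0[of 2] this]
  have "((\<lambda>\<tau>. K / a\<^sup>2 * ((a * \<tau>)\<^sup>2 / exp (a * \<tau>))) \<longlongrightarrow> K / a\<^sup>2 * 0) at_top" by (intro tendsto_intros)
  moreover have "K / a\<^sup>2 * ((a * \<tau>)\<^sup>2 / exp (a * \<tau>)) = K * \<tau>\<^sup>2 * exp (- (a * \<tau>))" for \<tau>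
    using a by (simp add: power_mult_distrib exp_minus inverse_eq_divide)
  ultimately show ?thesis by simp
qed

text \<open>The lower bound carries no power of \<tau>, which keeps the liminf positive at t = h.
  For t > h the exponential beats the factor \<tau>^2 of the upper bound, and in the logarithm that
  factor contributes only \<open>ln \<tau> / \<tau>\<close>.\<close>

lemma indicator_asymptotics:
  fixes f :: "real \<Rightarrow> real" and h c K :: real
  assumes c: "c > 0" and K: "K > 0"
    and lower: "\<forall>\<^sub>F \<tau> in at_top. c * exp (2 * \<tau> * h) \<le> \<bar>f \<tau>\<bar>"
    and upper: "\<forall>\<^sub>F \<tau> in at_top. \<bar>f \<tau>\<bar> \<le> K * \<tau>\<^sup>2 * exp (2 * \<tau> * h)"
  defines "I \<equiv> \<lambda>\<tau> t. exp (- 2 * \<tau> * t) * f \<tau>"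
  shows "t > h \<Longrightarrow> ((\<lambda>\<tau>. \<bar>I \<tau> t\<bar>) \<longlongrightarrow> 0) at_top"
    and "t < h \<Longrightarrow> filterlim (\<lambda>\<tau>. \<bar>I \<tau> t\<bar>) at_top at_top"
    and "Liminf at_top (\<lambda>\<tau>. ereal \<bar>I \<tau> h\<bar>) > 0"
    and "((\<lambda>\<tau>. ln \<bar>I \<tau> t\<bar> / (2 * \<tau>)) \<longlongrightarrow> h - t) at_top"
proof -
  have absI: "\<bar>I \<tau> t\<bar> = exp (- 2 * \<tau> * t) * \<bar>f \<tau>\<bar>" for \<tau> t by (simp add: I_def abs_mult)
  have e: "exp (- 2 * \<tau> * t) * (r * exp (2 * \<tau> * h)) = r * exp (2 * \<tau> * (h - t))" for \<tau> t r
  proof -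
    have "exp (- 2 * \<tau> * t) * exp (2 * \<tau> * h) = exp (2 * \<tau> * (h - t))"
      by (simp add: algebra_simps flip: exp_add)
    then show ?thesis by (simp add: mult.left_commute)
  qed
  have lo: "\<forall>\<^sub>F \<tau> in at_top. c * exp (2 * \<tau> * (h - t)) \<le> \<bar>I \<tau> t\<bar>" for t
    using lower
  proof eventually_elim
    case (elim \<tau>)
    show ?case using mult_left_mono[OF elim, of "exp (- 2 * \<tau> * t)"] by (simp only: absI e) simp
  qed
  have up: "\<forall>\<^sub>F \<tau> in at_top. \<bar>I \<tau> t\<bar> \<le> K * \<tau>\<^sup>2 * exp (2 * \<tau> * (h - t))" for t
    using upper
  proof eventually_elim
    case (elim \<tau>)
    show ?case using mult_left_mono[OF elim, of "exp (- 2 * \<tau> * t)"] by (simp only: absI e) simp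
  qed
  show "((\<lambda>\<tau>. \<bar>I \<tau> t\<bar>) \<longlongrightarrow> 0) at_top" if t: "t > h"
  proof -
    have "((\<lambda>\<tau>. K * \<tau>\<^sup>2 * exp (- (2 * (t - h) * \<tau>))) \<longlongrightarrow> 0) at_top"
      by (rule square_times_exp_tendsto_0) (use t in simp)
    moreover have "- (2 * (t - h) * \<tau>) = 2 * \<tau> * (h - t)" for \<tau> by (simp add: algebra_simps)
    ultimately have "((\<lambda>\<tau>. K * \<tau>\<^sup>2 * exp (2 * \<tau> * (h - t))) \<longlongrightarrow> 0) at_top" by simp
    then show ?thesis by (rule Lim_null_comparison[rotated]) (use up[of t] in simp)
  qed
  show "filterlim (\<lambda>\<tau>. \<bar>I \<tau> t\<bar>) at_top at_top" if t: "t < h"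
  proof (rule filterlim_at_top_mono[OF _ lo[of t]])
    have "filterlim (\<lambda>\<tau>. (2 * (h - t)) * \<tau>) at_top at_top"
      by (intro filterlim_tendsto_pos_mult_at_top[OF tendsto_const] filterlim_ident) (use t in simp)
    then have "filterlim (\<lambda>\<tau>. exp ((2 * (h - t)) * \<tau>)) at_top at_top"
      by (rule filterlim_compose[OF exp_at_top])
    then have "filterlim (\<lambda>\<tau>. c * exp ((2 * (h - t)) * \<tau>)) at_top at_top"
      by (rule filterlim_tendsto_pos_mult_at_top[OF tendsto_const c])
    then show "filterlim (\<lambda>\<tau>. c * exp (2 * \<tau> * (h - t))) at_top at_top" by (simp add: mult.commute mult.left_commute)
  qed
  have "ereal c \<le> Liminf at_top (\<lambda>\<tau>. ereal \<bar>I \<tau> h\<bar>)"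
    by (rule Liminf_bounded) (use lo[of h] in simp)
  then show "Liminf at_top (\<lambda>\<tau>. ereal \<bar>I \<tau> h\<bar>) > 0"
    using c by (meson ereal_less(2) less_le_trans)
  show "((\<lambda>\<tau>. ln \<bar>I \<tau> t\<bar> / (2 * \<tau>)) \<longlongrightarrow> h - t) at_top"
  proof (rule tendsto_sandwich)
    have inv: "((\<lambda>\<tau>. r / (2 * \<tau>)) \<longlongrightarrow> 0) at_top" for r :: real
    proof -
      have "((\<lambda>\<tau>. r / 2 * inverse \<tau>) \<longlongrightarrow> r / 2 * 0) at_top"
        by (intro tendsto_intros tendsto_inverse_0_at_top filterlim_ident)
      then show ?thesis by (simp add: field_simps)
    qed
    show "((\<lambda>\<tau>. ln c / (2 * \<tau>) + (h - t)) \<longlongrightarrow> h - t) at_top"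
      using tendsto_add[OF inv[of "ln c"] tendsto_const[of "h - t"]] by simp
    show "((\<lambda>\<tau>. ln K / (2 * \<tau>) + ln \<tau> / \<tau> + (h - t)) \<longlongrightarrow> h - t) at_top"
      using tendsto_add[OF tendsto_add[OF inv[of "ln K"] ln_x_over_x_tendsto_0] tendsto_const[of "h - t"]] by simp
    show "\<forall>\<^sub>F \<tau> in at_top. ln c / (2 * \<tau>) + (h - t) \<le> ln \<bar>I \<tau> t\<bar> / (2 * \<tau>)"
      using lo[of t] eventually_gt_at_top[of 0]
    proof eventually_elim
      case (elim \<tau>)
      have "ln (c * exp (2 * \<tau> * (h - t))) \<le> ln \<bar>I \<tau> t\<bar>" using elim(1) c by (intro ln_mono) auto
      then have "ln c + 2 * \<tau> * (h - t) \<le> ln \<bar>I \<tau> t\<bar>" using c by (simp add: ln_mult)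
      then have "(ln c + 2 * \<tau> * (h - t)) / (2 * \<tau>) \<le> ln \<bar>I \<tau> t\<bar> / (2 * \<tau>)"
        using elim(2) by (intro divide_right_mono) auto
      then show ?case using elim(2) by (simp add: add_divide_distrib)
    qed
    show "\<forall>\<^sub>F \<tau> in at_top. ln \<bar>I \<tau> t\<bar> / (2 * \<tau>) \<le> ln K / (2 * \<tau>) + ln \<tau> / \<tau> + (h - t)"
      using lo[of t] up[of t] eventually_gt_at_top[of 0]
    proof eventually_elim
      case (elim \<tau>)
      \<comment> \<open>Monotonicity of \<open>ln\<close> asks for a positive argument, which the
        lower bound supplies.\<close>
      have "0 < \<bar>I \<tau> t\<bar>" using elim(1) c by (meson exp_gt_zero less_le_trans mult_pos_pos)
      then have "ln \<bar>I \<tau> t\<bar> \<le> ln (K * \<tau>\<^sup>2 * exp (2 * \<tau> * (h - t)))" using elim(2) by (intro ln_mono) auto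
      then have "ln \<bar>I \<tau> t\<bar> \<le> ln K + 2 * ln \<tau> + 2 * \<tau> * (h - t)"
        using K elim(3) by (simp add: ln_mult ln_realpow)
      then have "ln \<bar>I \<tau> t\<bar> / (2 * \<tau>) \<le> (ln K + 2 * ln \<tau> + 2 * \<tau> * (h - t)) / (2 * \<tau>)"
        using elim(3) by (intro divide_right_mono) auto
      then show ?case using elim(3) by (simp add: add_divide_distrib)
    qed
  qed
qed


lemma ess_bounded_mat_combination:
  assumes "ess_bounded_mat U A" "ess_bounded_mat U B"
  shows "ess_bounded_mat U (\<lambda>x. a *\<^sub>R (b *\<^sub>R A x + c *\<^sub>R B x))"
  unfolding ess_bounded_mat_def
proof (intro allI conjI)
  fix i j
  have m: "(\<lambda>x. A x $ i $ j) \<in> borel_measurable (lebesgue_on U)" "(\<lambda>x. B x $ i $ j) \<in> borel_measurable (lebesgue_on U)"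
    using assms by (auto simp: ess_bounded_mat_def)
  then show "(\<lambda>x. (a *\<^sub>R (b *\<^sub>R A x + c *\<^sub>R B x)) $ i $ j) \<in> borel_measurable (lebesgue_on U)" by simp
  obtain p q where "AE x in lebesgue_on U. \<bar>A x $ i $ j\<bar> \<le> p" "AE x in lebesgue_on U. \<bar>B x $ i $ j\<bar> \<le> q"
    using assms unfolding ess_bounded_mat_def by blast
  then have "AE x in lebesgue_on U. \<bar>(a *\<^sub>R (b *\<^sub>R A x + c *\<^sub>R B x)) $ i $ j\<bar> \<le> \<bar>a\<bar> * (\<bar>b\<bar> * p + \<bar>c\<bar> * q)"
  proof eventually_elim
    case (elim x)
    have "\<bar>b * A x $ i $ j + c * B x $ i $ j\<bar> \<le> \<bar>b\<bar> * \<bar>A x $ i $ j\<bar> + \<bar>c\<bar> * \<bar>B x $ i $ j\<bar>"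
      using abs_triangle_ineq[of "b * A x $ i $ j" "c * B x $ i $ j"] by (simp add: abs_mult)
    also have "\<dots> \<le> \<bar>b\<bar> * p + \<bar>c\<bar> * q" using elim by (intro add_mono mult_left_mono) auto
    finally show ?case by (simp add: abs_mult mult_left_mono)
  qed
  then show "\<exists>B'. AE x in lebesgue_on U. \<bar>(a *\<^sub>R (b *\<^sub>R A x + c *\<^sub>R B x)) $ i $ j\<bar> \<le> B'" by blast
qed

section \<open>Energies of the exponentials and bounds for the difference of the pairings\<close>

context inclusion
begin

lemma energy_cgo_le:
  assumes S: "S \<in> sets lebesgue" "S \<subseteq> U" "\<And>x. x \<in> S \<Longrightarrow> x \<bullet> \<theta> \<le> b" and "0 \<le> \<tau>"
    and d: "norm \<theta> = 1" "norm \<theta>p = 1"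
  shows "energy S (cgo_grad \<theta> \<theta>p \<tau>) \<le> 2 * \<tau>\<^sup>2 * exp (2 * \<tau> * b) * measure lebesgue S"
proof -
  interpret finite_measure \<mu> by (rule finite_measure_lebesgue_on_bounded[OF U])
  have S\<mu>: "S \<in> sets \<mu>" using S U by (auto simp: sets_restrict_space_iff)
  have "energy S (cgo_grad \<theta> \<theta>p \<tau>) \<le> (\<integral>x. (2 * \<tau>\<^sup>2 * exp (2 * \<tau> * b)) * indicator S x \<partial>\<mu>)"
    unfolding energy_def
  proof (rule integral_mono)
    show "integrable \<mu> (\<lambda>x. indicator S x * (norm (cgo_grad \<theta> \<theta>p \<tau> x))\<^sup>2)"
      using H1_cgo[OF U, of \<theta> \<theta>p \<tau>] S by (intro indicator_integrable) (auto simp: H1_iff)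
    show "integrable \<mu> (\<lambda>x. (2 * \<tau>\<^sup>2 * exp (2 * \<tau> * b)) * indicator S x)"
      using S\<mu> by (intro integrable_mult_right) (simp add: emeasure_eq_measure)
    show "indicator S x * (norm (cgo_grad \<theta> \<theta>p \<tau> x))\<^sup>2 \<le> (2 * \<tau>\<^sup>2 * exp (2 * \<tau> * b)) * indicator S x" for x
      using S(3)[of x] \<open>0 \<le> \<tau>\<close>
      by (cases "x \<in> S") (auto simp: norm_cgo_grad[OF d] intro!: mult_left_mono)
  qed
  also have "\<dots> = 2 * \<tau>\<^sup>2 * exp (2 * \<tau> * b) * measure lebesgue S"
    using S S\<mu> U by (simp add: measure_restrict_space Int_absorb2)
  finally show ?thesis .
qed

lemma energy_cgo_ge:
  assumes S: "S \<in> sets lebesgue" "S \<subseteq> S'" "S' \<in> sets lebesgue" "S' \<subseteq> U" "\<And>x. x \<in> S \<Longrightarrow> b \<le> x \<bullet> \<theta>"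
    and "0 \<le> \<tau>" and d: "norm \<theta> = 1" "norm \<theta>p = 1"
  shows "2 * \<tau>\<^sup>2 * exp (2 * \<tau> * b) * measure lebesgue S \<le> energy S' (cgo_grad \<theta> \<theta>p \<tau>)"
proof -
  interpret finite_measure \<mu> by (rule finite_measure_lebesgue_on_bounded[OF U])
  have S\<mu>: "S \<in> sets \<mu>" using S U by (auto simp: sets_restrict_space_iff)
  have "2 * \<tau>\<^sup>2 * exp (2 * \<tau> * b) * measure lebesgue S = (\<integral>x. (2 * \<tau>\<^sup>2 * exp (2 * \<tau> * b)) * indicator S x \<partial>\<mu>)"
    using S S\<mu> U by (simp add: measure_restrict_space Int_absorb2)
  also have "\<dots> \<le> energy S' (cgo_grad \<theta> \<theta>p \<tau>)"
    unfolding energy_def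
  proof (rule integral_mono)
    show "integrable \<mu> (\<lambda>x. indicator S' x * (norm (cgo_grad \<theta> \<theta>p \<tau> x))\<^sup>2)"
      using H1_cgo[OF U, of \<theta> \<theta>p \<tau>] S by (intro indicator_integrable) (auto simp: H1_iff)
    show "integrable \<mu> (\<lambda>x. (2 * \<tau>\<^sup>2 * exp (2 * \<tau> * b)) * indicator S x)"
      using S\<mu> by (intro integrable_mult_right) (simp add: emeasure_eq_measure)
    show "(2 * \<tau>\<^sup>2 * exp (2 * \<tau> * b)) * indicator S x \<le> indicator S' x * (norm (cgo_grad \<theta> \<theta>p \<tau> x))\<^sup>2" for x
      using S(2) S(5)[of x] \<open>0 \<le> \<tau>\<close>
      by (cases "x \<in> S") (auto simp: norm_cgo_grad[OF d] indicator_def subset_iff intro!: mult_left_mono)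
  qed
  finally show ?thesis .
qed

lemma energy_nonneg: "0 \<le> energy S P"
  unfolding energy_def by (intro integral_nonneg_AE AE_I2) simp

text \<open>The constants are fixed before \<tau>, so the energies carry all of its influence; a
  weak solution is chosen for each \<tau> separately.\<close>

lemma dn_gap:
  assumes d: "norm \<theta> = 1" "norm \<theta>p = 1" "\<theta> \<bullet> \<theta>p = 0"
  defines "J \<equiv> \<lambda>\<tau>. Re (dn_pair U A (cgo \<theta> \<theta>p \<tau>) (\<lambda>x. cnj (cgo \<theta> \<theta>p \<tau> x))
       - dn_pair U (coef (\<lambda>x. mat 1) (\<lambda>x. 0) \<omega>) (cgo \<theta> \<theta>p \<tau>) (\<lambda>x. cnj (cgo \<theta> \<theta>p \<tau> x)))"
  obtains K1 K2 where "0 \<le> K1" "0 \<le> K2"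
    "\<And>\<tau>. J \<tau> \<le> K1 * energy (D - T) (cgo_grad \<theta> \<theta>p \<tau>) - (C - \<omega>\<^sup>2 * M\<^sup>2 / m) * energy T (cgo_grad \<theta> \<theta>p \<tau>)"
    "\<And>\<tau>. - K2 * energy D (cgo_grad \<theta> \<theta>p \<tau>) \<le> J \<tau>"
proof -
  define K1 where "K1 = K + \<omega>\<^sup>2 * M\<^sup>2 / m"
  define K2 where "K2 = 1 + \<omega> * M + (K + \<omega> * M) * ((K + \<omega> * M + 1)\<^sup>2 / (2 * m) / min 1 (m / 2))"
  have J: "J \<tau> \<le> K1 * energy (D - T) (cgo_grad \<theta> \<theta>p \<tau>) - (C - \<omega>\<^sup>2 * M\<^sup>2 / m) * energy T (cgo_grad \<theta> \<theta>p \<tau>)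
      \<and> - K2 * energy D (cgo_grad \<theta> \<theta>p \<tau>) \<le> J \<tau>" for \<tau>
  proof -
    obtain u Du where sol: "weak_sol U A (cgo \<theta> \<theta>p \<tau>) u Du"
      using weak_sol_exists[OF H1_cgo[OF U]] by blast
    have "J \<tau> = (\<integral>x. (A x *v Du x) \<bullet> cgo_grad \<theta> \<theta>p \<tau> x \<partial>\<mu>) - (\<integral>x. cgo_grad \<theta> \<theta>p \<tau> x \<bullet> cgo_grad \<theta> \<theta>p \<tau> x \<partial>\<mu>)"
      unfolding J_def minus_complex.sel Re_dn_pair_cgo[OF sol] Re_dn_pair_identity[OF U d] ..
    then show ?thesis
      using energy_gap[OF H1_cgo[OF U] cgo_harmonic[OF U d] sol] unfolding K1_def K2_def by simp
  qed
  show thesis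
  proof (rule that[of K1 K2])
    show "0 \<le> K1" "0 \<le> K2" using pos by (auto simp: K1_def K2_def intro!: add_nonneg_nonneg mult_nonneg_nonneg divide_nonneg_nonneg)
  qed (use J in blast)+
qed

end

section \<open>Reduction to the normalised data and two-sided bounds for the gap\<close>

theorem theorem1p2:
  fixes \<Omega> D :: "(real^'n::finite) set"
    and \<sigma> \<epsilon> :: "real^'n \<Rightarrow> real^'n^'n"
    and \<sigma>0 \<epsilon>0 \<omega> C\<theta> \<delta>\<theta> m M :: real
    and \<theta> \<theta>p :: "real^'n"
  assumes dim: "CARD('n) = 2 \<or> CARD('n) = 3"
    and \<Omega>: "bounded \<Omega>" "connected \<Omega>" "open \<Omega>" "lipschitz_boundary \<Omega>"
    and D: "open D" "closure D \<subseteq> \<Omega>" "D \<noteq> {}"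
    and Dbd: "if CARD('n) = 2 then lipschitz_boundary D else C2_boundary D"
    and cst: "\<sigma>0 \<ge> 0" "\<epsilon>0 > 0" "\<sigma>0\<^sup>2 + \<omega>\<^sup>2 * \<epsilon>0\<^sup>2 > 0"
    and sym: "\<And>x. x \<in> \<Omega> \<Longrightarrow> transpose (\<sigma> x) = \<sigma> x"
             "\<And>x. x \<in> \<Omega> \<Longrightarrow> transpose (\<epsilon> x) = \<epsilon> x"
    and bdd: "ess_bounded_mat \<Omega> \<sigma>" "ess_bounded_mat \<Omega> \<epsilon>"
    and sig_nonneg: "\<forall>\<xi>. AE x in lebesgue_on \<Omega>. (\<sigma> x *v \<xi>) \<bullet> \<xi> \<ge> 0"
    and eps_pd: "\<exists>c>0. \<forall>\<xi>. AE x in lebesgue_on \<Omega>. (\<epsilon> x *v \<xi>) \<bullet> \<xi> \<ge> c * (norm \<xi>)\<^sup>2"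
    and outside: "\<And>x. x \<in> \<Omega> - D \<Longrightarrow> \<sigma> x = \<sigma>0 *\<^sub>R mat 1 \<and> \<epsilon> x = \<epsilon>0 *\<^sub>R mat 1"
    and dirs: "norm \<theta> = 1" "norm \<theta>p = 1" "\<theta> \<bullet> \<theta>p = 0"
    and C\<theta>: "C\<theta> > 0" "\<delta>\<theta> > 0"
    and jump: "\<forall>\<xi>. AE x in lebesgue. x \<in> D_strip D \<theta> \<delta>\<theta> \<longrightarrow>
        ((inverse (\<sigma>0\<^sup>2 + \<omega>\<^sup>2 * \<epsilon>0\<^sup>2) *\<^sub>R
            (\<sigma>0 *\<^sub>R (\<sigma> x - \<sigma>0 *\<^sub>R mat 1) + (\<omega>\<^sup>2 * \<epsilon>0) *\<^sub>R (\<epsilon> x - \<epsilon>0 *\<^sub>R mat 1))) *v \<xi>) \<bullet> \<xi>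
          \<le> - C\<theta> * (norm \<xi>)\<^sup>2"
    and mM: "m > 0" "M > 0"
    and m_bd: "\<forall>\<xi>. AE x in lebesgue_on D. (sig_t \<sigma> \<epsilon> \<sigma>0 \<epsilon>0 \<omega> x *v \<xi>) \<bullet> \<xi> \<ge> m * (norm \<xi>)\<^sup>2"
    and M_bd: "AE x in lebesgue_on D.
        (SUP \<xi>\<in>cball 0 1. norm ((inverse (\<sigma>0\<^sup>2 + \<omega>\<^sup>2 * \<epsilon>0\<^sup>2) *\<^sub>R (\<epsilon>0 *\<^sub>R \<sigma> x - \<sigma>0 *\<^sub>R \<epsilon> x)) *v \<xi>)) \<le> M"
    and \<omega>: "0 \<le> \<omega>" "\<omega> < sqrt (m * C\<theta>) / M"
  shows "(\<forall>t. t > support_fn D \<theta> \<longrightarrow>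
            ((\<lambda>\<tau>. \<bar>indicator_fn \<Omega> \<sigma> \<epsilon> \<sigma>0 \<epsilon>0 \<omega> \<theta> \<theta>p \<tau> t\<bar>) \<longlongrightarrow> 0) at_top)
       \<and> (\<forall>t. t < support_fn D \<theta> \<longrightarrow>
            filterlim (\<lambda>\<tau>. \<bar>indicator_fn \<Omega> \<sigma> \<epsilon> \<sigma>0 \<epsilon>0 \<omega> \<theta> \<theta>p \<tau> t\<bar>) at_top at_top)
       \<and> Liminf at_top (\<lambda>\<tau>. ereal \<bar>indicator_fn \<Omega> \<sigma> \<epsilon> \<sigma>0 \<epsilon>0 \<omega> \<theta> \<theta>p \<tau> (support_fn D \<theta>)\<bar>) > 0
       \<and> (\<forall>t. ((\<lambda>\<tau>. ln \<bar>indicator_fn \<Omega> \<sigma> \<epsilon> \<sigma>0 \<epsilon>0 \<omega> \<theta> \<theta>p \<tau> t\<bar> / (2 * \<tau>))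
              \<longlongrightarrow> support_fn D \<theta> - t) at_top)"
proof -
  define h where "h = support_fn D \<theta>"
  define T where "T = D_strip D \<theta> \<delta>\<theta>"
  define G where "G = sig_t \<sigma> \<epsilon> \<sigma>0 \<epsilon>0 \<omega>"
  define E where "E = eps_t \<sigma> \<epsilon> \<sigma>0 \<epsilon>0 \<omega>"
  define \<rho> where "\<rho> = \<sigma>0\<^sup>2 + \<omega>\<^sup>2 * \<epsilon>0\<^sup>2"
  have \<rho>: "\<rho> > 0" using cst(3) by (simp add: \<rho>_def)
  have Gx: "G x = inverse \<rho> *\<^sub>R (\<sigma>0 *\<^sub>R \<sigma> x + (\<omega>\<^sup>2 * \<epsilon>0) *\<^sub>R \<epsilon> x)" for x by (simp add: G_def sig_t_def \<rho>_def)
  \<comment> \<open>The difference is written as a sum to match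
    \<open>ess_bounded_mat_combination\<close>.\<close>
  have Ex: "E x = inverse \<rho> *\<^sub>R (\<sigma>0 *\<^sub>R \<epsilon> x + (- \<epsilon>0) *\<^sub>R \<sigma> x)" for x by (simp add: E_def eps_t_def \<rho>_def)
  have D\<Omega>: "D \<subseteq> \<Omega>" using D(2) closure_subset by blast
  have Db: "bounded D" using bounded_subset[OF \<Omega>(1) D\<Omega>] .
  have Dm: "D \<in> sets lebesgue" and \<Omega>m: "\<Omega> \<in> sets lebesgue" using D(1) \<Omega>(3) by auto
  have h: "x \<bullet> \<theta> \<le> h" if "x \<in> D" for x using support_fn_upper[OF Db that] by (simp add: h_def)
  \<comment> \<open>The support function bounds the height on \<open>D\<close>, so the strip is
    \<open>D\<close> cut by an open half-space and thereby open.\<close>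
  have T: "T = D \<inter> {x. h - \<delta>\<theta> < x \<bullet> \<theta>}" using h by (auto simp: T_def D_strip_def h_def)
  have "open T" unfolding T by (intro open_Int D(1) open_Collect_less continuous_intros)
  then have Tm: "T \<in> sets lebesgue" by simp
  have bddG: "ess_bounded_mat \<Omega> G" unfolding Gx[abs_def] by (intro ess_bounded_mat_combination bdd)
  have bddE: "ess_bounded_mat \<Omega> E" unfolding Ex[abs_def] by (intro ess_bounded_mat_combination bdd)
  obtain B where B: "0 \<le> B" "AE x in lebesgue_on \<Omega>. \<forall>\<xi>. norm (G x *v \<xi>) \<le> B * norm \<xi>"
    using ess_bounded_mat_norm[OF bddG] by blast
  \<comment> \<open>The operator bound is enlarged to dominate 1, the coefficient off
    \<open>D\<close>, and m, as \<open>inclusion\<close> asks.\<close>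
  define K where "K = max (max B 1) m"
  have AED: "AE x in lebesgue_on \<Omega>. x \<in> D \<longrightarrow> P x" if "AE x in lebesgue_on D. P x" for P
    using that Dm \<Omega>m by (auto simp: AE_restrict_space_iff elim: AE_mp)
  have small: "\<omega>\<^sup>2 * M\<^sup>2 < m * C\<theta>"
  proof -
    have "\<omega> * M < sqrt (m * C\<theta>)" using \<omega>(2) mM by (simp add: pos_less_divide_eq)
    then have "(\<omega> * M)\<^sup>2 < (sqrt (m * C\<theta>))\<^sup>2" using \<omega>(1) mM by (intro power_strict_mono) auto
    then show ?thesis using mM C\<theta> by (simp add: power_mult_distrib)
  qed
  interpret inclusion \<Omega> D T G E K m M C\<theta> \<omega>
  proof
    show "(\<lambda>x. G x $ i $ j) \<in> borel_measurable (lebesgue_on \<Omega>)"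
      "(\<lambda>x. E x $ i $ j) \<in> borel_measurable (lebesgue_on \<Omega>)" for i j
      using bddG bddE by (auto simp: ess_bounded_mat_def)
    have "transpose (G x) = G x \<and> transpose (E x) = E x" if "x \<in> \<Omega>" for x
      using sym[OF that] by (simp add: Gx Ex transpose_def vec_eq_iff)
    then show "AE x in lebesgue_on \<Omega>. transpose (G x) = G x \<and> transpose (E x) = E x"
      by (intro AE_I2) simp
    have "G x = mat 1 \<and> E x = 0" if "x \<in> \<Omega> - D" for x
    proof -
      have "\<sigma>0 *\<^sub>R \<sigma> x + (\<omega>\<^sup>2 * \<epsilon>0) *\<^sub>R \<epsilon> x = \<rho> *\<^sub>R mat 1"
        using outside[OF that] by (simp add: \<rho>_def scaleR_add_left power2_eq_square mult.assoc)
      then show ?thesis using outside[OF that] \<rho> by (simp add: Gx Ex mult.commute)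
    qed
    then show "AE x in lebesgue_on \<Omega>. x \<notin> D \<longrightarrow> G x = mat 1 \<and> E x = 0"
      by (intro AE_I2) simp
    have "AE x in lebesgue_on D. \<forall>\<xi>. 0 \<le> (G x *v \<xi>) \<bullet> \<xi> - m * (norm \<xi>)\<^sup>2"
      by (rule AE_all_continuous)
        (use m_bd in \<open>auto simp: G_def intro!: continuous_intros continuous_quadratic_form\<close>)
    then have 1: "AE x in lebesgue_on \<Omega>. x \<in> D \<longrightarrow> (\<forall>\<xi>. 0 \<le> (G x *v \<xi>) \<bullet> \<xi> - m * (norm \<xi>)\<^sup>2)"
      by (rule AED)
    have "AE x in lebesgue_on D. \<forall>\<xi>. norm (E x *v \<xi>) \<le> M * norm \<xi>"
      using M_bd
    proof eventually_elim
      case (elim x)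
      have neg: "(- X) *v \<xi> = - (X *v \<xi>)" for X :: "real^'n^'n" and \<xi>
        by (simp add: matrix_vector_mult_def vec_eq_iff sum_negf)
      \<comment> \<open>The bound M is stated for the opposite sign, which the norm does not
        see.\<close>
      have "E x = - (inverse (\<sigma>0\<^sup>2 + \<omega>\<^sup>2 * \<epsilon>0\<^sup>2) *\<^sub>R (\<epsilon>0 *\<^sub>R \<sigma> x - \<sigma>0 *\<^sub>R \<epsilon> x))"
        by (simp add: Ex \<rho>_def algebra_simps)
      then have "norm (E x *v \<xi>) = norm ((inverse (\<sigma>0\<^sup>2 + \<omega>\<^sup>2 * \<epsilon>0\<^sup>2) *\<^sub>R (\<epsilon>0 *\<^sub>R \<sigma> x - \<sigma>0 *\<^sub>R \<epsilon> x)) *v \<xi>)" for \<xi>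
        by (simp only: neg norm_minus_cancel)
      then show ?case using SUP_cball_norm_le[OF elim] by simp
    qed
    then have 2: "AE x in lebesgue_on \<Omega>. x \<in> D \<longrightarrow> (\<forall>\<xi>. norm (E x *v \<xi>) \<le> M * norm \<xi>)" by (rule AED)
    show "AE x in lebesgue_on \<Omega>. x \<in> D \<longrightarrow> (\<forall>\<xi>. m * (norm \<xi>)\<^sup>2 \<le> (G x *v \<xi>) \<bullet> \<xi> \<and>
        norm (G x *v \<xi>) \<le> K * norm \<xi> \<and> norm (E x *v \<xi>) \<le> M * norm \<xi>)"
      using 1 2 B(2)
    proof eventually_elim
      case (elim x)
      have "norm (G x *v \<xi>) \<le> K * norm \<xi>" for \<xi>
        by (rule order_trans[OF elim(3)[rule_format] mult_right_mono]) (auto simp: K_def)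
      then show ?case using elim(1,2) by simp
    qed
    have "AE x in lebesgue_on T. \<forall>\<xi>. 0 \<le> (1 - C\<theta>) * (norm \<xi>)\<^sup>2 - (G x *v \<xi>) \<bullet> \<xi>"
    proof (rule AE_all_continuous)
      fix \<xi> :: "real^'n"
      \<comment> \<open>The matrix in the jump condition is \<open>G x - mat 1\<close>, since the
        background constants add up to \<open>\<rho> *\<^sub>R mat 1\<close>.\<close>
      have "inverse (\<sigma>0\<^sup>2 + \<omega>\<^sup>2 * \<epsilon>0\<^sup>2) *\<^sub>R
            (\<sigma>0 *\<^sub>R (\<sigma> x - \<sigma>0 *\<^sub>R mat 1) + (\<omega>\<^sup>2 * \<epsilon>0) *\<^sub>R (\<epsilon> x - \<epsilon>0 *\<^sub>R mat 1)) = G x - mat 1" for x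
      proof -
        have *: "\<sigma>0 *\<^sub>R (\<sigma> x - \<sigma>0 *\<^sub>R mat 1) + (\<omega>\<^sup>2 * \<epsilon>0) *\<^sub>R (\<epsilon> x - \<epsilon>0 *\<^sub>R mat 1)
            = (\<sigma>0 *\<^sub>R \<sigma> x + (\<omega>\<^sup>2 * \<epsilon>0) *\<^sub>R \<epsilon> x) - \<rho> *\<^sub>R mat 1"
          by (simp add: \<rho>_def algebra_simps power2_eq_square)
        show ?thesis unfolding * \<rho>_def[symmetric] Gx using \<rho> by (subst scaleR_diff_right) simp
      qed
      then have "AE x in lebesgue. x \<in> T \<longrightarrow> ((G x - mat 1) *v \<xi>) \<bullet> \<xi> \<le> - C\<theta> * (norm \<xi>)\<^sup>2"
        using jump[rule_format, of \<xi>] by (simp add: T_def)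
      then have "AE x in lebesgue_on T. ((G x - mat 1) *v \<xi>) \<bullet> \<xi> \<le> - C\<theta> * (norm \<xi>)\<^sup>2"
        using Tm by (simp add: AE_restrict_space_iff)
      then show "AE x in lebesgue_on T. 0 \<le> (1 - C\<theta>) * (norm \<xi>)\<^sup>2 - (G x *v \<xi>) \<bullet> \<xi>"
        by eventually_elim
          (simp add: matrix_vector_mult_diff_rdistrib inner_diff_left left_diff_distrib power2_norm_eq_inner)
    qed (intro continuous_intros continuous_quadratic_form)
    then have "AE x in lebesgue. x \<in> T \<longrightarrow> (\<forall>\<xi>. (G x *v \<xi>) \<bullet> \<xi> \<le> (1 - C\<theta>) * (norm \<xi>)\<^sup>2)"
      using Tm by (simp add: AE_restrict_space_iff)
    then show "AE x in lebesgue_on \<Omega>. x \<in> T \<longrightarrow> (\<forall>\<xi>. (G x *v \<xi>) \<bullet> \<xi> \<le> (1 - C\<theta>) * (norm \<xi>)\<^sup>2)"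
      using \<Omega>m by (auto simp: AE_restrict_space_iff elim: AE_mp)
  qed (use \<Omega> Dm Tm D\<Omega> T mM \<omega> small in \<open>auto simp: K_def\<close>)
  define J where "J \<tau> = Re (dn_pair \<Omega> (coef G E \<omega>) (cgo \<theta> \<theta>p \<tau>) (\<lambda>x. cnj (cgo \<theta> \<theta>p \<tau> x))
       - dn_pair \<Omega> (coef (\<lambda>x. mat 1) (\<lambda>x. 0) \<omega>) (cgo \<theta> \<theta>p \<tau>) (\<lambda>x. cnj (cgo \<theta> \<theta>p \<tau> x)))" for \<tau>
  have ind: "indicator_fn \<Omega> \<sigma> \<epsilon> \<sigma>0 \<epsilon>0 \<omega> \<theta> \<theta>p \<tau> t = exp (- 2 * \<tau> * t) * J \<tau>" for \<tau> t
    by (simp add: indicator_fn_def J_def G_def E_def)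
  define P where "P = cgo_grad \<theta> \<theta>p"
  obtain K1 K2 where K12: "0 \<le> K1" "0 \<le> K2"
    and up: "\<And>\<tau>. J \<tau> \<le> K1 * energy (D - T) (P \<tau>) - (C\<theta> - \<omega>\<^sup>2 * M\<^sup>2 / m) * energy T (P \<tau>)"
    and low: "\<And>\<tau>. - K2 * energy D (P \<tau>) \<le> J \<tau>"
    using dn_gap[OF dirs] unfolding J_def P_def by blast
  define \<kappa> where "\<kappa> = C\<theta> - \<omega>\<^sup>2 * M\<^sup>2 / m"
  have \<kappa>: "\<kappa> > 0" using small mM by (simp add: \<kappa>_def field_simps)
  define V where "V = measure lebesgue D"
  have eD: "energy D (P \<tau>) \<le> 2 * \<tau>\<^sup>2 * exp (2 * \<tau> * h) * V" if "0 \<le> \<tau>" for \<tau>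
    unfolding V_def P_def by (rule energy_cgo_le) (use Dm D\<Omega> h that dirs in auto)
  have eDT: "energy (D - T) (P \<tau>) \<le> 2 * \<tau>\<^sup>2 * exp (2 * \<tau> * (h - \<delta>\<theta>)) * V" if "0 \<le> \<tau>" for \<tau>
  proof -
    have "energy (D - T) (P \<tau>) \<le> 2 * \<tau>\<^sup>2 * exp (2 * \<tau> * (h - \<delta>\<theta>)) * measure lebesgue (D - T)"
      unfolding P_def by (rule energy_cgo_le) (use Dm Tm D\<Omega> T that dirs in auto)
    also have "\<dots> \<le> 2 * \<tau>\<^sup>2 * exp (2 * \<tau> * (h - \<delta>\<theta>)) * V"
      unfolding V_def using Dm Tm D(1) Db
      by (intro mult_left_mono measure_mono_fmeasurable lmeasurable_open) auto
    finally show ?thesis .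
  qed
  obtain c0 s0 where c0: "c0 > 0" "s0 > 0" and vol: "\<And>s. 0 < s \<Longrightarrow> s \<le> s0 \<Longrightarrow> \<exists>S\<in>lmeasurable. S \<subseteq> D \<and>
    (\<forall>x\<in>S. h - 2 * s \<le> x \<bullet> \<theta>) \<and> c0 * s\<^sup>2 \<le> measure lebesgue S"
    unfolding h_def using strip_volume[OF dim D(1) Db D(3) dirs(1) Dbd] by blast
  \<comment> \<open>The volume estimate is used at \<open>s = 1 / \<tau>\<close>: its s^2 cancels
    the \<tau>^2 of the energy density, and the depth 2 / \<tau> costs the factor
    \<open>exp (- 4)\<close>. For \<open>\<tau> > 2 / \<delta>\<theta>\<close> the piece of volume
    lies in the strip.\<close>
  have eT: "\<forall>\<^sub>F \<tau> in at_top. 2 * c0 * exp (- 4) * exp (2 * \<tau> * h) \<le> energy T (P \<tau>)"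
    using eventually_ge_at_top[of "1 / s0"] eventually_gt_at_top[of "2 / \<delta>\<theta>"] eventually_gt_at_top[of 0]
  proof eventually_elim
    case (elim \<tau>)
    have "1 / \<tau> \<le> s0" using elim c0(2) by (simp add: field_simps)
    then obtain S where S: "S \<in> lmeasurable" "S \<subseteq> D" "\<And>x. x \<in> S \<Longrightarrow> h - 2 * (1 / \<tau>) \<le> x \<bullet> \<theta>"
      "c0 * (1 / \<tau>)\<^sup>2 \<le> measure lebesgue S"
      using vol[of "1 / \<tau>"] elim(3) by auto
    have "2 * (1 / \<tau>) < \<delta>\<theta>" using elim C\<theta>(2) by (simp add: field_simps)
    then have ST: "S \<subseteq> T" unfolding T using S(2,3) by force
    have "2 * c0 * exp (- 4) * exp (2 * \<tau> * h) = 2 * \<tau>\<^sup>2 * exp (2 * \<tau> * (h - 2 * (1 / \<tau>))) * (c0 * (1 / \<tau>)\<^sup>2)"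
    proof -
      have "2 * \<tau> * (h - 2 * (1 / \<tau>)) = 2 * \<tau> * h + (- 4)" using elim(3) by (simp add: field_simps)
      then have "exp (2 * \<tau> * (h - 2 * (1 / \<tau>))) = exp (2 * \<tau> * h) * exp (- 4)" by (simp only: exp_add)
      then show ?thesis using elim(3) by (simp add: power_divide)
    qed
    also have "\<dots> \<le> 2 * \<tau>\<^sup>2 * exp (2 * \<tau> * (h - 2 * (1 / \<tau>))) * measure lebesgue S"
      using S(4) by (intro mult_left_mono) auto
    also have "\<dots> \<le> energy T (P \<tau>)"
      unfolding P_def by (rule energy_cgo_ge) (use S ST Tm T D\<Omega> elim(3) dirs in auto)
    finally show ?case .
  qed
  \<comment> \<open>Half of what \<open>eT\<close> delivers after multiplication by \<kappa>; the
    other half absorbs the energy in \<open>D - T\<close>, which is of order \<tau>^2 exp (- 2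
    \<delta>\<theta> \<tau>) relative to exp (2 \<tau> h).\<close>
  define c1 where "c1 = \<kappa> * c0 * exp (- 4)"
  have c1: "c1 > 0" using \<kappa> c0 by (simp add: c1_def)
  have "((\<lambda>\<tau>. (2 * K1 * V) * \<tau>\<^sup>2 * exp (- ((2 * \<delta>\<theta>) * \<tau>))) \<longlongrightarrow> 0) at_top"
    by (rule square_times_exp_tendsto_0) (use C\<theta> in simp)
  then have "\<forall>\<^sub>F \<tau> in at_top. (2 * K1 * V) * \<tau>\<^sup>2 * exp (- ((2 * \<delta>\<theta>) * \<tau>)) < c1"
    using c1 by (rule order_tendstoD)
  then have lower: "\<forall>\<^sub>F \<tau> in at_top. c1 * exp (2 * \<tau> * h) \<le> \<bar>J \<tau>\<bar>"
    using eT eventually_ge_at_top[of 0]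
  proof eventually_elim
    case (elim \<tau>)
    have "\<kappa> * (2 * c0 * exp (- 4) * exp (2 * \<tau> * h)) \<le> \<kappa> * energy T (P \<tau>)"
      using elim(2) \<kappa> by (intro mult_left_mono) auto
    then have 1: "2 * c1 * exp (2 * \<tau> * h) \<le> \<kappa> * energy T (P \<tau>)" by (simp add: c1_def mult_ac)
    have "K1 * energy (D - T) (P \<tau>) \<le> K1 * (2 * \<tau>\<^sup>2 * exp (2 * \<tau> * (h - \<delta>\<theta>)) * V)"
      using eDT[OF elim(3)] K12 by (intro mult_left_mono) auto
    also have "\<dots> = ((2 * K1 * V) * \<tau>\<^sup>2 * exp (- ((2 * \<delta>\<theta>) * \<tau>))) * exp (2 * \<tau> * h)"
    proof -
      have "2 * \<tau> * (h - \<delta>\<theta>) = - ((2 * \<delta>\<theta>) * \<tau>) + 2 * \<tau> * h" by (simp add: algebra_simps)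
      then have "exp (2 * \<tau> * (h - \<delta>\<theta>)) = exp (- ((2 * \<delta>\<theta>) * \<tau>)) * exp (2 * \<tau> * h)" by (simp only: exp_add)
      then show ?thesis by simp
    qed
    also have "\<dots> \<le> c1 * exp (2 * \<tau> * h)" using elim(1) by (intro mult_right_mono) auto
    finally have "J \<tau> \<le> - (c1 * exp (2 * \<tau> * h))" using up[of \<tau>] 1 unfolding \<kappa>_def[symmetric] by linarith
    then show ?case by linarith
  qed
  \<comment> \<open>The summand 1 makes the constant positive, so that its logarithm can be
    taken.\<close>
  define K3 where "K3 = 2 * (K1 + K2) * V + 1"
  have K3: "K3 > 0" using K12 by (simp add: K3_def V_def add_nonneg_pos)
  have upper: "\<forall>\<^sub>F \<tau> in at_top. \<bar>J \<tau>\<bar> \<le> K3 * \<tau>\<^sup>2 * exp (2 * \<tau> * h)"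
    using eventually_ge_at_top[of 0]
  proof eventually_elim
    case (elim \<tau>)
    define Z where "Z = \<tau>\<^sup>2 * exp (2 * \<tau> * h)"
    have Z: "0 \<le> Z" by (simp add: Z_def)
    have "exp (2 * \<tau> * (h - \<delta>\<theta>)) \<le> exp (2 * \<tau> * h)" using elim C\<theta> by (simp add: mult_left_mono)
    then have "2 * \<tau>\<^sup>2 * exp (2 * \<tau> * (h - \<delta>\<theta>)) * V \<le> 2 * \<tau>\<^sup>2 * exp (2 * \<tau> * h) * V"
      by (intro mult_right_mono mult_left_mono) (auto simp: V_def)
    then have "energy (D - T) (P \<tau>) \<le> 2 * Z * V" using eDT[OF elim] by (simp add: Z_def mult.assoc)
    then have "K1 * energy (D - T) (P \<tau>) \<le> K1 * (2 * Z * V)" using K12 by (intro mult_left_mono)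
    moreover have "0 \<le> \<kappa> * energy T (P \<tau>)" using \<kappa> energy_nonneg[of T "P \<tau>"] by simp
    ultimately have 1: "J \<tau> \<le> K1 * (2 * Z * V)" using up[of \<tau>] unfolding \<kappa>_def[symmetric] by linarith
    have "energy D (P \<tau>) \<le> 2 * Z * V" using eD[OF elim] by (simp add: Z_def mult.assoc)
    then have "K2 * energy D (P \<tau>) \<le> K2 * (2 * Z * V)" using K12 by (intro mult_left_mono)
    then have 2: "- J \<tau> \<le> K2 * (2 * Z * V)" using low[of \<tau>] by simp
    have "0 \<le> K1 * (2 * Z * V)" "0 \<le> K2 * (2 * Z * V)" using K12 Z by (auto simp: V_def)
    then have "\<bar>J \<tau>\<bar> \<le> K1 * (2 * Z * V) + K2 * (2 * Z * V) + Z" using 1 2 Z by linarith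
    also have "\<dots> = K3 * \<tau>\<^sup>2 * exp (2 * \<tau> * h)" by (simp add: K3_def Z_def algebra_simps)
    finally show ?case .
  qed
  show ?thesis
    unfolding ind h_def[symmetric]
    using indicator_asymptotics[OF c1 K3 lower upper] by (intro conjI allI impI)
qed

end
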